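(* The inverse $t$-Kostka polynomials satisfy: (1) $\mathcal K_{\lambda/\mu,\nu}(t)\in\mathbb Z[t]$ for all partitions $\mu\subset\lambda$ and $\nu$; (2) $\mathcal K_{\lambda,\nu}(t)=0$ unless $\lambda\le\nu$ in dominance order; (3) $\mathcal K_{\lambda,\lambda}(t)=1$ for every partition $\lambda$. Consequently, with partitions of a given size ordered by dominance, the matrix $(\mathcal K_{\lambda,\nu}(t))_{\lambda,\nu}$ is unitriangular, in the triangular direction opposite to that of the Kostka--Foulkes matrix $(K_{\lambda,\nu}(t))_{\lambda,\nu}$ (for which $K_{\lambda,\nu}(t)=0$ unless $\lambda\ge\nu$).
   Context: $\mathcal K_{\lambda/\mu,\nu}(t)$ is defined by $s_{\lambda/\mu}[(1-t)X]=\sum_\nu\mathcal K_{\lambda/\mu,\nu}(t)\,Q_\nu(X;t)$, where $Q_\nu(X;t)$ are the Hall--Littlewood $Q$-functions and $f[(1-t)X]$ denotes the substitution $p_r\mapsto(1-t^r)p_r$; $\mathcal K_{\lambda,\nu}(t)=\mathcal K_{\lambda/\varnothing,\nu}(t)$. Dominance order: $\lambda\le\nu$ iff $|\lambda|=|\nu|$ and $\sum_{i\le j}\lambda_i\le\sum_{i\le j}\nu_i$ for all $j$. *)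

theory Defs
  imports
    "HOL-Library.Poly_Mapping"
    "HOL-Library.FuncSet"
    "HOL-Combinatorics.Permutations"
    "HOL-Computational_Algebra.Polynomial_Factorial"
begin

section \<open>Partitions\<close>

definition is_partition :: "nat list \<Rightarrow> bool" where
  "is_partition lam \<longleftrightarrow> sorted_wrt (\<ge>) lam \<and> 0 \<notin> set lam"

definition partitions_of :: "nat \<Rightarrow> nat list set" where
  "partitions_of k = {lam. is_partition lam \<and> sum_list lam = k}"

definition part :: "nat list \<Rightarrow> nat \<Rightarrow> nat" where
  "part lam i = (if i < length lam then lam ! i else 0)"

definition partition_subset :: "nat list \<Rightarrow> nat list \<Rightarrow> bool" where
  "partition_subset \<mu> lam \<longleftrightarrow> (\<forall>i. part \<mu> i \<le> part lam i)"

definition dominance_le :: "nat list \<Rightarrow> nat list \<Rightarrow> bool" where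
  "dominance_le lam \<nu> \<longleftrightarrow>
     sum_list lam = sum_list \<nu> \<and> (\<forall>j. (\<Sum>i<j. part lam i) \<le> (\<Sum>i<j. part \<nu> i))"


section \<open>Symmetric functions over \<open>\<rat>(t)\<close>\<close>

text \<open>
  The field \<open>\<rat>(t)\<close> is taken as the fraction field of \<open>\<int>[t]\<close>, so that \<open>\<int>[t]\<close> is
  the range of \<^const>\<open>to_fract\<close>.
  A symmetric function in \<open>X = (x\<^sub>0, x\<^sub>1, \<dots>)\<close> is an element of an inverse limit of rings of
  symmetric polynomials; it is represented by the sequence of its restrictions
  \<open>f(x\<^sub>0, \<dots>, x\<^bsub>n-1\<^esub>)\<close>, with \<open>n = 0, 1, 2, \<dots>\<close>.  These restrictions are polynomials, but are
  regarded as elements of the field \<open>\<rat>(t)(x\<^sub>0, x\<^sub>1, \<dots>)\<close>, because the Hall--Littlewood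
  functions are given by a sum of rational functions.
\<close>

type_synonym qt = "int poly fract"
type_synonym xfrac = "((nat \<Rightarrow>\<^sub>0 nat) \<Rightarrow>\<^sub>0 qt) fract"
type_synonym symfun = "nat \<Rightarrow> xfrac"

definition tt :: qt where
  "tt = to_fract [:0, 1:]"

definition Zt :: "qt set" where
  "Zt = range to_fract"

definition scalar :: "qt \<Rightarrow> xfrac" where
  "scalar c = to_fract (Poly_Mapping.single 0 c)"

definition xvar :: "nat \<Rightarrow> xfrac" where
  "xvar i = to_fract (Poly_Mapping.single (Poly_Mapping.single i 1) 1)"

definition has_expansion :: "(nat list \<Rightarrow> symfun) \<Rightarrow> symfun \<Rightarrow> (nat list \<Rightarrow> qt) \<Rightarrow> bool" where
  "has_expansion B f c \<longleftrightarrow>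
     finite {\<nu>. c \<nu> \<noteq> 0} \<and> {\<nu>. c \<nu> \<noteq> 0} \<subseteq> Collect is_partition \<and>
     (\<forall>n. f n = (\<Sum>\<nu> | c \<nu> \<noteq> 0. scalar (c \<nu>) * B \<nu> n))"

definition expansion_coeff :: "(nat list \<Rightarrow> symfun) \<Rightarrow> symfun \<Rightarrow> nat list \<Rightarrow> qt" where
  "expansion_coeff B f = (THE c. has_expansion B f c)"

definition power_sum :: "nat list \<Rightarrow> symfun" where
  "power_sum \<nu> n = (\<Prod>r\<leftarrow>\<nu>. \<Sum>i<n. xvar i ^ r)"

text \<open>The substitution \<open>p\<^sub>r \<mapsto> (1 - t\<^sup>r) p\<^sub>r\<close>, with \<open>f\<close> written as a
  \<open>\<rat>(t)\<close>-linear combination of products of power sums.\<close>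

definition subst_1mt :: "symfun \<Rightarrow> symfun" where
  "subst_1mt f n =
     (let c = expansion_coeff power_sum f
      in \<Sum>\<nu> | c \<nu> \<noteq> 0. scalar (c \<nu>) * (\<Prod>r\<leftarrow>\<nu>. scalar (1 - tt ^ r) * (\<Sum>i<n. xvar i ^ r)))"


section \<open>Skew Schur functions\<close>

definition skew_diagram :: "nat list \<Rightarrow> nat list \<Rightarrow> (nat \<times> nat) set" where
  "skew_diagram lam \<mu> = {(i, j). part \<mu> i \<le> j \<and> j < part lam i}"

definition ssyt :: "nat list \<Rightarrow> nat list \<Rightarrow> nat \<Rightarrow> (nat \<times> nat \<Rightarrow> nat) set" where
  "ssyt lam \<mu> n =
     {T \<in> skew_diagram lam \<mu> \<rightarrow>\<^sub>E {..<n}.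
        (\<forall>i j j'. (i, j) \<in> skew_diagram lam \<mu> \<and> (i, j') \<in> skew_diagram lam \<mu> \<and> j < j'
            \<longrightarrow> T (i, j) \<le> T (i, j')) \<and>
        (\<forall>i i' j. (i, j) \<in> skew_diagram lam \<mu> \<and> (i', j) \<in> skew_diagram lam \<mu> \<and> i < i'
            \<longrightarrow> T (i, j) < T (i', j))}"

definition skew_schur :: "nat list \<Rightarrow> nat list \<Rightarrow> symfun" where
  "skew_schur lam \<mu> n = (\<Sum>T \<in> ssyt lam \<mu> n. \<Prod>c \<in> skew_diagram lam \<mu>. xvar (T c))"

abbreviation schur :: "nat list \<Rightarrow> symfun" where
  "schur lam \<equiv> skew_schur lam []"


section \<open>Hall--Littlewood functions\<close>

definition v_fact :: "nat \<Rightarrow> qt" where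
  "v_fact m = (\<Prod>i = 1..m. (1 - tt ^ i) / (1 - tt))"

definition phi_fact :: "nat \<Rightarrow> qt" where
  "phi_fact m = (\<Prod>i = 1..m. 1 - tt ^ i)"

text \<open>\<open>v\<^sub>\<lambda>(t) = \<Prod>\<^bsub>i\<ge>0\<^esub> v\<^bsub>m\<^sub>i\<^esub>(t)\<close> for \<open>\<lambda>\<close> padded with zeros to length \<open>n\<close>,
  so \<open>m\<^sub>0 = n - \<ell>(\<lambda>)\<close>.\<close>

definition hl_v :: "nat list \<Rightarrow> nat \<Rightarrow> qt" where
  "hl_v lam n = v_fact (n - length lam) * (\<Prod>i \<in> set lam. v_fact (count_list lam i))"

definition hl_b :: "nat list \<Rightarrow> qt" where
  "hl_b lam = (\<Prod>i \<in> set lam. phi_fact (count_list lam i))"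

text \<open>\<open>P\<^sub>\<lambda>(x\<^sub>0, \<dots>, x\<^bsub>n-1\<^esub>; t)\<close> is
  \<open>v\<^sub>\<lambda>(t)\<^sup>-\<^sup>1 \<Sum>\<^bsub>w \<in> S\<^sub>n\<^esub> w(x\<^sup>\<lambda> \<Prod>\<^bsub>i<j\<^esub> (x\<^sub>i - t x\<^sub>j) / (x\<^sub>i - x\<^sub>j))\<close> for
  \<open>n \<ge> \<ell>(\<lambda>)\<close>; by stability it restricts to zero in fewer than \<open>\<ell>(\<lambda>)\<close> variables.\<close>

definition hall_littlewood_P :: "nat list \<Rightarrow> symfun" where
  "hall_littlewood_P lam n =
     (if n < length lam then 0
      else scalar (inverse (hl_v lam n)) *
        (\<Sum>w | w permutes {..<n}.
           (\<Prod>i<length lam. xvar (w i) ^ (lam ! i)) *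
           (\<Prod>j<n. \<Prod>i<j. (xvar (w i) - scalar tt * xvar (w j)) / (xvar (w i) - xvar (w j)))))"

definition hall_littlewood_Q :: "nat list \<Rightarrow> symfun" where
  "hall_littlewood_Q lam n = scalar (hl_b lam) * hall_littlewood_P lam n"


section \<open>Kostka--Foulkes and inverse \<open>t\<close>-Kostka polynomials\<close>

text \<open>Kostka--Foulkes polynomials: \<open>s\<^sub>\<lambda> = \<Sum>\<^sub>\<nu> K\<^bsub>\<lambda>,\<nu>\<^esub>(t) P\<^sub>\<nu>(X; t)\<close>.\<close>

definition kostka_foulkes :: "nat list \<Rightarrow> nat list \<Rightarrow> qt" where
  "kostka_foulkes lam \<nu> = expansion_coeff hall_littlewood_P (schur lam) \<nu>"

definition inv_kostka_skew :: "nat list \<Rightarrow> nat list \<Rightarrow> nat list \<Rightarrow> qt" where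
  "inv_kostka_skew lam \<mu> \<nu> = expansion_coeff hall_littlewood_Q (subst_1mt (skew_schur lam \<mu>)) \<nu>"

definition inv_kostka :: "nat list \<Rightarrow> nat list \<Rightarrow> qt" where
  "inv_kostka lam \<nu> = inv_kostka_skew lam [] \<nu>"


section \<open>Triangularity with respect to a partial order\<close>

definition triangular_on :: "'a set \<Rightarrow> ('a \<Rightarrow> 'a \<Rightarrow> bool) \<Rightarrow> ('a \<Rightarrow> 'a \<Rightarrow> 'b::zero_neq_one) \<Rightarrow> bool" where
  "triangular_on A le M \<longleftrightarrow> (\<forall>a\<in>A. \<forall>b\<in>A. \<not> le a b \<longrightarrow> M a b = 0)"

definition unitriangular_on :: "'a set \<Rightarrow> ('a \<Rightarrow> 'a \<Rightarrow> bool) \<Rightarrow> ('a \<Rightarrow> 'a \<Rightarrow> 'b::zero_neq_one) \<Rightarrow> bool" where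
  "unitriangular_on A le M \<longleftrightarrow> triangular_on A le M \<and> (\<forall>a\<in>A. M a a = 1)"

end

theory Submission
  imports Defs "HOL-Computational_Algebra.Formal_Laurent_Series" "HOL-Combinatorics.Multiset_Permutations"
begin

text \<open>
  Let \<open>q\<^sub>r\<close> be the coefficients of \<open>\<Prod>\<^sub>i (1 - t x\<^sub>i u) / (1 - x\<^sub>i u)\<close>, so that \<open>q\<^sub>r = h\<^sub>r[(1 - t)X]\<close> by
  Newton's identities.  By Jacobi--Trudi, \<open>s\<^bsub>\<lambda>/\<mu>\<^esub>[(1 - t)X]\<close> is an integral combination of products
  \<open>q\<^sub>\<alpha> = \<Prod>\<^sub>i q\<^bsub>\<alpha>\<^sub>i\<^esub>\<close>; for \<open>\<mu> = \<emptyset>\<close> it is \<open>q\<^sub>\<lambda>\<close> plus terms with \<open>\<alpha> > \<lambda>\<close> in dominance order.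
  Separating the variable that carries the first part in the symmetrization formula gives
  \<open>Q\<^bsub>(a,\<lambda>)\<^esub>(V) = (1 - t) \<Sum>\<^sub>i x\<^sub>i\<^sup>a \<Prod>\<^bsub>j\<noteq>i\<^esub> (x\<^sub>i - t x\<^sub>j) / (x\<^sub>i - x\<^sub>j) Q\<^sub>\<lambda>(V - {i})\<close>, and partial fractions turn
  this into \<open>Q\<^sub>\<lambda> = q\<^sub>\<lambda> + \<Sum> c\<^sub>\<alpha> q\<^sub>\<alpha>\<close> with \<open>\<alpha> > \<lambda>\<close> and \<open>c\<^sub>\<alpha> \<in> \<int>[t]\<close>.  This unitriangular relation is inverted
  over \<open>\<int>[t]\<close>.  Uniqueness of the expansions and the triangularity of the Kostka--Foulkes matrix
  come from the leading monomial of \<open>P\<^sub>\<lambda>\<close>: rescaling \<open>x\<^sub>i\<close> by \<open>u\<^bsup>-w i\<^esup>\<close> and comparing orders in \<open>u\<close> shows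
  that all exponents of \<open>P\<^sub>\<lambda>\<close> are dominated by \<open>\<lambda>\<close>, and that \<open>x\<^sup>\<lambda>\<close> occurs.
\<close>

section \<open>The coefficient field\<close>

text \<open>The Hall-Littlewood functions are given as sums of rational functions, so neither their
  polynomiality nor their monomials can be read off the definition. The expansion in the products
  \<open>qprod\<close> supplies polynomiality, and the embedding into Laurent series reads off
  orders summand by summand, without clearing denominators. Since the recursion for Q removes an
  arbitrary variable, every expansion must have coefficients that are the same for all finite sets
  of variables; \<open>lspan\<close> records this uniformity. Power sums serve two purposes only:
  they identify the substituted skew Schur function with the Jacobi-Trudi determinant in the q's,
  and they show that Schur functions have an expansion in the P's at all. Both need coefficients in
  \<rat>(t), since Newton's identities divide by k or by 1 - t^k; integrality is carried by the q's
  alone. All coefficients are defined through \<open>THE\<close>, so the independence of the power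
  sums, of the P's and of the Q's has to be proved before anything can be said about them.\<close>

instance fract :: ("{idom, ring_char_0}") field_char_0
proof
  show "inj (of_nat :: nat \<Rightarrow> 'a fract)"
    by (rule injI) (simp add: of_nat_fract eq_fract)
qed

lemma to_fract_prod: "to_fract (prod f A) = (\<Prod>x\<in>A. to_fract (f x))"
  by (induction A rule: infinite_finite_induct) auto

lemma to_fract_power: "to_fract (x ^ n) = to_fract x ^ n"
  by (induction n) auto

lemma single_eq_iff: "Poly_Mapping.single i a = Poly_Mapping.single j b \<longleftrightarrow> a = 0 \<and> b = 0 \<or> i = j \<and> a = b"
  by (metis lookup_single_eq lookup_single_not_eq single_zero)

lemma scalar_0 [simp]: "scalar 0 = 0"
  by (simp add: scalar_def)

lemma scalar_1 [simp]: "scalar 1 = 1"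
  by (simp add: scalar_def single_one)

lemma scalar_add: "scalar (a + b) = scalar a + scalar b"
  by (simp add: scalar_def single_add)

lemma scalar_diff: "scalar (a - b) = scalar a - scalar b"
  by (simp add: scalar_def single_diff)

lemma scalar_uminus: "scalar (- a) = - scalar a"
  by (simp add: scalar_def single_uminus)

lemma scalar_mult: "scalar (a * b) = scalar a * scalar b"
  by (simp add: scalar_def mult_single flip: to_fract_mult)

lemma scalar_eq_iff [simp]: "scalar a = scalar b \<longleftrightarrow> a = b"
  by (auto simp: scalar_def single_eq_iff)

lemma scalar_eq_0_iff [simp]: "scalar a = 0 \<longleftrightarrow> a = 0"
  using scalar_eq_iff[of a 0] by (simp del: scalar_eq_iff)

lemma scalar_prod: "scalar (prod f A) = (\<Prod>x\<in>A. scalar (f x))"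
  by (induction A rule: infinite_finite_induct) (auto simp: scalar_mult)

lemma scalar_power: "scalar (a ^ n) = scalar a ^ n"
  by (induction n) (auto simp: scalar_mult)

lemma scalar_inverse: "scalar (inverse a) = inverse (scalar a)"
proof (cases "a = 0")
  case False
  have "scalar a * scalar (inverse a) = 1"
    using False by (simp flip: scalar_mult)
  then show ?thesis
    by (simp add: inverse_unique)
qed auto

lemma scalar_divide: "scalar (a / b) = scalar a / scalar b"
  by (simp add: divide_inverse scalar_mult scalar_inverse)

lemma scalar_of_nat: "scalar (of_nat n) = of_nat n"
  by (induction n) (auto simp: scalar_add)

lemma single_power: "Poly_Mapping.single a (b::'b::comm_semiring_1) ^ n = Poly_Mapping.single (of_nat n * a) (b ^ n)"
  for a :: "'a :: comm_semiring_1"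
  by (induction n) (auto simp: mult_single algebra_simps single_one)

lemma inj_xvar: "inj xvar"
  by (rule injI) (simp add: xvar_def single_eq_iff)

lemma xvar_eq_iff [simp]: "xvar i = xvar j \<longleftrightarrow> i = j"
  using inj_xvar by (auto dest: injD)

lemma xvar_nonzero [simp]: "xvar i \<noteq> 0"
  by (simp add: xvar_def) (metis lookup_single_eq lookup_zero zero_neq_one)

definition tx :: xfrac where "tx = scalar tt"

lemma tt_power: "tt ^ n = to_fract (monom 1 n)"
  by (simp add: tt_def monom_altdef flip: to_fract_power)

lemma tt_power_neq_1: "n > 0 \<Longrightarrow> tt ^ n \<noteq> 1"
  by (metis One_nat_def degree_1 degree_monom_eq nat_less_le to_fract_1 to_fract_eq_iff tt_power zero_neq_one)

lemma Zt_0 [simp]: "0 \<in> Zt"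
  unfolding Zt_def by (metis rangeI to_fract_0)

lemma Zt_1 [simp]: "1 \<in> Zt"
  unfolding Zt_def by (metis rangeI to_fract_1)

lemma Zt_tt [simp]: "tt \<in> Zt"
  unfolding Zt_def by (simp add: tt_def)

lemma Zt_add [intro]: "a \<in> Zt \<Longrightarrow> b \<in> Zt \<Longrightarrow> a + b \<in> Zt"
  unfolding Zt_def by (auto simp flip: to_fract_add)

lemma Zt_uminus [intro]: "a \<in> Zt \<Longrightarrow> - a \<in> Zt"
  unfolding Zt_def by (auto simp flip: to_fract_uminus)

lemma Zt_diff [intro]: "a \<in> Zt \<Longrightarrow> b \<in> Zt \<Longrightarrow> a - b \<in> Zt"
  unfolding Zt_def by (auto simp flip: to_fract_diff)

lemma Zt_mult [intro]: "a \<in> Zt \<Longrightarrow> b \<in> Zt \<Longrightarrow> a * b \<in> Zt"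
  unfolding Zt_def by (auto simp flip: to_fract_mult)

lemma Zt_power [intro]: "a \<in> Zt \<Longrightarrow> a ^ n \<in> Zt"
  by (induction n) auto

section \<open>Linear combinations over a ring of coefficients\<close>

text \<open>Two instances occur: \<open>Zt\<close>, where integrality is tracked, and
  \<open>UNIV\<close>, where only the existence of an expansion over \<rat>(t) matters.\<close>

definition coeff_ring :: "qt set \<Rightarrow> bool" where
  "coeff_ring K \<longleftrightarrow> 1 \<in> K \<and> (\<forall>a\<in>K. \<forall>b\<in>K. a - b \<in> K \<and> a * b \<in> K)"

lemma coeff_ring_UNIV [simp]: "coeff_ring UNIV"
  by (simp add: coeff_ring_def)

lemma coeff_ring_Zt [simp]: "coeff_ring Zt"
  by (auto simp: coeff_ring_def)

lemma coeff_ring_0: "coeff_ring K \<Longrightarrow> 0 \<in> K"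
  unfolding coeff_ring_def by (metis diff_self)

lemma coeff_ring_add: "coeff_ring K \<Longrightarrow> a \<in> K \<Longrightarrow> b \<in> K \<Longrightarrow> a + b \<in> K"
  using coeff_ring_0[of K] unfolding coeff_ring_def by (metis diff_0 diff_minus_eq_add)

lemma coeff_ring_mult: "coeff_ring K \<Longrightarrow> a \<in> K \<Longrightarrow> b \<in> K \<Longrightarrow> a * b \<in> K"
  unfolding coeff_ring_def by blast

lemma coeff_ring_uminus: "coeff_ring K \<Longrightarrow> a \<in> K \<Longrightarrow> - a \<in> K"
  using coeff_ring_0[of K] unfolding coeff_ring_def by (metis diff_0)

text \<open>One choice of coefficients has to serve all points of D simultaneously. The points are
  sets of variables, pairs of a variable and a set containing it, pairs of an alphabet parameter and
  a number of variables, or numbers of variables.\<close>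

definition lspan :: "'d set \<Rightarrow> qt set \<Rightarrow> ('i \<Rightarrow> 'd \<Rightarrow> xfrac) \<Rightarrow> 'i set \<Rightarrow> ('d \<Rightarrow> xfrac) set" where
  "lspan D K B I =
     {f. \<exists>S c. finite S \<and> S \<subseteq> I \<and> (\<forall>i. c i \<in> K) \<and> (\<forall>d\<in>D. f d = (\<Sum>i\<in>S. scalar (c i) * B i d))}"

lemma lspanI:
  "finite S \<Longrightarrow> S \<subseteq> I \<Longrightarrow> (\<And>i. c i \<in> K) \<Longrightarrow> (\<And>d. d \<in> D \<Longrightarrow> f d = (\<Sum>i\<in>S. scalar (c i) * B i d))
   \<Longrightarrow> f \<in> lspan D K B I"
  unfolding lspan_def by blast

lemma lspan_cong:
  "f \<in> lspan D K B I \<Longrightarrow> (\<And>d. d \<in> D \<Longrightarrow> g d = f d) \<Longrightarrow> g \<in> lspan D K B I"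
  unfolding lspan_def mem_Collect_eq by (elim exE conjE) (intro exI conjI; auto)

lemma lspan_mono:
  "f \<in> lspan D K B I \<Longrightarrow> I \<subseteq> J \<Longrightarrow> f \<in> lspan D K B J"
  unfolding lspan_def by blast

lemma lspan_mono_ring:
  "f \<in> lspan D K B I \<Longrightarrow> K \<subseteq> L \<Longrightarrow> f \<in> lspan D L B I"
  unfolding lspan_def by blast

context
  fixes K assumes K: "coeff_ring K"
begin

lemma lspan_zero: "(\<lambda>d. 0) \<in> lspan D K B I"
  by (rule lspanI[of "{}" _ "\<lambda>_. 0"]) (use K in \<open>auto simp: coeff_ring_0\<close>)

lemma lspan_scaled_base:
  assumes "i \<in> I" "k \<in> K"
  shows "(\<lambda>d. scalar k * B i d) \<in> lspan D K B I"
  by (rule lspanI[of "{i}" _ "\<lambda>_. k"]) (use assms in auto)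

lemma lspan_base: "i \<in> I \<Longrightarrow> B i \<in> lspan D K B I"
  using lspan_scaled_base[of i I 1 B] K by (simp add: coeff_ring_def)

lemma lspan_add:
  assumes "f \<in> lspan D K B I" "g \<in> lspan D K B I"
  shows "(\<lambda>d. f d + g d) \<in> lspan D K B I"
proof -
  obtain S c where S: "finite S" "S \<subseteq> I" "\<And>i. c i \<in> K"
    and f: "\<And>d. d \<in> D \<Longrightarrow> f d = (\<Sum>i\<in>S. scalar (c i) * B i d)"
    using assms(1) unfolding lspan_def by blast
  obtain T e where T: "finite T" "T \<subseteq> I" "\<And>i. e i \<in> K"
    and g: "\<And>d. d \<in> D \<Longrightarrow> g d = (\<Sum>i\<in>T. scalar (e i) * B i d)"
    using assms(2) unfolding lspan_def by blast
  define h where "h i = (if i \<in> S then c i else 0) + (if i \<in> T then e i else 0)" for i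
  show ?thesis
  proof (rule lspanI[of "S \<union> T" _ h])
    fix d assume d: "d \<in> D"
    have "f d = (\<Sum>i\<in>S \<union> T. scalar (if i \<in> S then c i else 0) * B i d)"
      unfolding f[OF d] by (rule sum.mono_neutral_cong_left) (use S T in auto)
    moreover have "g d = (\<Sum>i\<in>S \<union> T. scalar (if i \<in> T then e i else 0) * B i d)"
      unfolding g[OF d] by (rule sum.mono_neutral_cong_left) (use S T in auto)
    ultimately show "f d + g d = (\<Sum>i\<in>S \<union> T. scalar (h i) * B i d)"
      by (simp add: h_def scalar_add sum.distrib algebra_simps)
  qed (use S T K in \<open>auto simp: h_def intro!: coeff_ring_add coeff_ring_0\<close>)
qed

lemma lspan_scale:
  assumes "f \<in> lspan D K B I" "k \<in> K"
  shows "(\<lambda>d. scalar k * f d) \<in> lspan D K B I"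
proof -
  obtain S c where S: "finite S" "S \<subseteq> I" "\<And>i. c i \<in> K"
    and f: "\<And>d. d \<in> D \<Longrightarrow> f d = (\<Sum>i\<in>S. scalar (c i) * B i d)"
    using assms(1) unfolding lspan_def by blast
  show ?thesis
    by (rule lspanI[of S _ "\<lambda>i. k * c i"])
       (use S assms(2) K in \<open>auto simp: f sum_distrib_left scalar_mult mult.assoc coeff_ring_mult\<close>)
qed

lemma lspan_uminus:
  assumes "f \<in> lspan D K B I"
  shows "(\<lambda>d. - f d) \<in> lspan D K B I"
  using lspan_scale[OF assms, of "-1"] K
  by (simp add: scalar_uminus coeff_ring_uminus coeff_ring_def)

lemma lspan_diff:
  assumes "f \<in> lspan D K B I" "g \<in> lspan D K B I"
  shows "(\<lambda>d. f d - g d) \<in> lspan D K B I"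
  using lspan_add[OF assms(1) lspan_uminus[OF assms(2)]] by simp

lemma lspan_sum:
  assumes "\<And>a. a \<in> A \<Longrightarrow> f a \<in> lspan D K B I"
  shows "(\<lambda>d. \<Sum>a\<in>A. f a d) \<in> lspan D K B I"
  using assms
  by (induction A rule: infinite_finite_induct) (auto intro: lspan_zero lspan_add)

text \<open>The coefficients of f do not depend on the point, so they can be pulled out of the sum
  over a. The weights \<open>w d a\<close> may be arbitrary elements of the function field; only
  what they produce from the basis functions has to lie in the target span. Sums over the variable
  removed from V have this shape.\<close>

lemma lspan_map:
  assumes f: "f \<in> lspan D K B I"
    and h: "\<And>d a. d \<in> D' \<Longrightarrow> a \<in> A d \<Longrightarrow> h d a \<in> D"
    and B: "\<And>i. i \<in> I \<Longrightarrow> (\<lambda>d. \<Sum>a\<in>A d. w d a * B i (h d a)) \<in> lspan D' K C J"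
  shows "(\<lambda>d. \<Sum>a\<in>A d. w d a * f (h d a)) \<in> lspan D' K C J"
proof -
  obtain S c where S: "finite S" "S \<subseteq> I" "\<And>i. c i \<in> K"
    and f: "\<And>d. d \<in> D \<Longrightarrow> f d = (\<Sum>i\<in>S. scalar (c i) * B i d)"
    using f unfolding lspan_def by blast
  have "(\<lambda>d. \<Sum>i\<in>S. scalar (c i) * (\<Sum>a\<in>A d. w d a * B i (h d a))) \<in> lspan D' K C J"
    by (intro lspan_sum lspan_scale B) (use S in auto)
  then show ?thesis
    by (rule lspan_cong)
       (simp add: f h sum_distrib_left mult.left_commute sum.swap[of _ S])
qed

lemma lspan_trans:
  assumes "f \<in> lspan D K B I" "\<And>i. i \<in> I \<Longrightarrow> B i \<in> lspan D K C J"
  shows "f \<in> lspan D K C J"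
  using lspan_map[OF assms(1), where D' = D and A = "\<lambda>_. {()}" and h = "\<lambda>d _. d" and w = "\<lambda>_ _. 1"
      and C = C and J = J] assms(2)
  by simp

lemma lspan_comp:
  assumes "f \<in> lspan D K B I" "\<And>d. d \<in> D' \<Longrightarrow> h d \<in> D"
  shows "(\<lambda>d. f (h d)) \<in> lspan D' K (\<lambda>i d. B i (h d)) I"
  using lspan_map[OF assms(1), where D' = D' and A = "\<lambda>_. {()}" and h = "\<lambda>d _. h d" and w = "\<lambda>_ _. 1"
      and C = "\<lambda>i d. B i (h d)" and J = I] assms(2) lspan_base[of _ I "\<lambda>i d. B i (h d)" D']
  by simp

lemma lspan_mult:
  assumes f: "f \<in> lspan D K B I" and g: "g \<in> lspan D K C J"
    and BC: "\<And>i j. i \<in> I \<Longrightarrow> j \<in> J \<Longrightarrow> (\<lambda>d. B i d * C j d) \<in> lspan D K E L"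
  shows "(\<lambda>d. f d * g d) \<in> lspan D K E L"
proof -
  have "(\<lambda>d. g d * B i d) \<in> lspan D K E L" if "i \<in> I" for i
    using lspan_map[OF g, where D' = D and A = "\<lambda>_. {()}" and h = "\<lambda>d _. d" and w = "\<lambda>d _. B i d"
        and C = E and J = L] BC[OF that] by (simp add: mult.commute)
  then show ?thesis
    using lspan_map[OF f, where D' = D and A = "\<lambda>_. {()}" and h = "\<lambda>d _. d" and w = "\<lambda>d _. g d"
        and C = E and J = L] by (simp add: mult.commute)
qed

end

lemma lspan_has_expansion:
  assumes "f \<in> lspan UNIV K B I" "I \<subseteq> Collect is_partition" "0 \<in> K"
  obtains c where "has_expansion B f c" "\<And>i. c i \<in> K" "\<And>i. c i \<noteq> 0 \<Longrightarrow> i \<in> I"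
proof -
  obtain S c where S: "finite S" "S \<subseteq> I" "\<And>i. c i \<in> K"
    and f: "\<And>d. f d = (\<Sum>i\<in>S. scalar (c i) * B i d)"
    using assms(1) unfolding lspan_def by auto
  define e where "e i = (if i \<in> S then c i else 0)" for i
  have sub: "{i. e i \<noteq> 0} \<subseteq> S"
    by (auto simp: e_def)
  have "f d = (\<Sum>i | e i \<noteq> 0. scalar (e i) * B i d)" for d
    unfolding f by (rule sum.mono_neutral_cong_right) (use S in \<open>auto simp: e_def\<close>)
  then have "has_expansion B f e"
    unfolding has_expansion_def using sub S assms(2) finite_subset[OF sub] by blast
  then show ?thesis
    by (rule that) (use S assms(3) sub in \<open>auto simp: e_def split: if_splits\<close>)
qed

text \<open>The relation is assumed for all n at once. In a fixed number of variables
  \<open>hall_littlewood_P\<close> vanishes on long partitions, so independence can hold only in the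
  limit.\<close>

definition indep_family :: "(nat list \<Rightarrow> symfun) \<Rightarrow> bool" where
  "indep_family B \<longleftrightarrow> (\<forall>S c. finite S \<longrightarrow> S \<subseteq> Collect is_partition \<longrightarrow>
     (\<forall>n. (\<Sum>\<nu>\<in>S. scalar (c \<nu>) * B \<nu> n) = 0) \<longrightarrow> (\<forall>\<nu>\<in>S. c \<nu> = 0))"

lemma has_expansion_unique:
  assumes B: "indep_family B" and c: "has_expansion B f c" and e: "has_expansion B f e"
  shows "c = e"
proof -
  define S where "S = {\<nu>. c \<nu> \<noteq> 0} \<union> {\<nu>. e \<nu> \<noteq> 0}"
  have S: "finite S" "S \<subseteq> Collect is_partition"
    using c e by (auto simp: S_def has_expansion_def)
  have "(\<Sum>\<nu>\<in>S. scalar (c \<nu> - e \<nu>) * B \<nu> n) = 0" for n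
  proof -
    have "f n = (\<Sum>\<nu>\<in>S. scalar (c \<nu>) * B \<nu> n)"
      using c S unfolding has_expansion_def
      by (subst sum.mono_neutral_cong_right[where S = "{\<nu>. c \<nu> \<noteq> 0}"]) (auto simp: S_def)
    moreover have "f n = (\<Sum>\<nu>\<in>S. scalar (e \<nu>) * B \<nu> n)"
      using e S unfolding has_expansion_def
      by (subst sum.mono_neutral_cong_right[where S = "{\<nu>. e \<nu> \<noteq> 0}"]) (auto simp: S_def)
    ultimately show ?thesis
      by (simp add: scalar_diff left_diff_distrib sum_subtractf)
  qed
  then have "\<forall>\<nu>\<in>S. c \<nu> - e \<nu> = 0"
    using B[unfolded indep_family_def, rule_format, of S "\<lambda>\<nu>. c \<nu> - e \<nu>"] S by simp
  then have "c \<nu> = e \<nu>" if "\<nu> \<in> S" for \<nu>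
    using that by simp
  moreover have "c \<nu> = e \<nu>" if "\<nu> \<notin> S" for \<nu>
    using that by (simp add: S_def)
  ultimately show ?thesis
    by blast
qed

lemma expansion_coeff_eqI:
  assumes "indep_family B" "has_expansion B f c"
  shows "expansion_coeff B f = c"
  unfolding expansion_coeff_def
  using assms by (blast intro: has_expansion_unique)

section \<open>The generating function of the functions \<open>q\<^sub>r\<close>\<close>

unbundle fps_syntax

definition lin_fps :: "'a::field \<Rightarrow> 'a fps" where
  "lin_fps c = 1 - fps_const c * fps_X"

text \<open>The parameter s joins two alphabets: s = 0 generates the complete homogeneous functions
  of X, and s = t those of (1 - t)X.\<close>

definition qgen :: "'a::field \<Rightarrow> (nat \<Rightarrow> 'a) \<Rightarrow> nat set \<Rightarrow> 'a fps" where
  "qgen s x V = (\<Prod>i\<in>V. lin_fps (s * x i) * inverse (lin_fps (x i)))"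

definition qcoef :: "'a::field \<Rightarrow> (nat \<Rightarrow> 'a) \<Rightarrow> nat set \<Rightarrow> nat \<Rightarrow> 'a" where
  "qcoef s x V k = qgen s x V $ k"

text \<open>Up to the factor 1 - s, this is the coefficient at the pole 1/x_i in the partial
  fraction decomposition of \<open>qgen\<close>; the same product weights the i-th term of the
  recursion for Q.\<close>

definition hl_res :: "'a::field \<Rightarrow> (nat \<Rightarrow> 'a) \<Rightarrow> nat set \<Rightarrow> nat \<Rightarrow> 'a" where
  "hl_res s x V i = (\<Prod>j\<in>V - {i}. (x i - s * x j) / (x i - x j))"

lemma lin_fps_0 [simp]: "lin_fps 0 = 1"
  by (simp add: lin_fps_def)

lemma lin_fps_nth_0 [simp]: "lin_fps c $ 0 = 1"
  by (simp add: lin_fps_def)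

lemma lin_fps_mult_nth: "(lin_fps c * F) $ k = F $ k - (if k = 0 then 0 else c * F $ (k - 1))"
  by (cases k) (auto simp: lin_fps_def left_diff_distrib mult.assoc)

lemma inverse_lin_fps: "inverse (lin_fps c) = Abs_fps (\<lambda>n. c ^ n)"
proof (rule fps_inverse_unique)
  show "lin_fps c * Abs_fps (\<lambda>n. c ^ n) = 1"
    by (rule fps_ext) (auto simp: lin_fps_mult_nth power_eq_if)
qed

lemma lin_fps_mult_inverse: "lin_fps c * inverse (lin_fps c) = 1"
  by (subst mult.commute, rule inverse_mult_eq_1) simp

lemma lin_fps_ratio_nth:
  "(lin_fps c * inverse (lin_fps (s * c))) $ k = (if k = 0 then 1 else (s ^ k - s ^ (k - 1)) * c ^ k)"
  by (cases k) (auto simp: lin_fps_mult_nth inverse_lin_fps power_mult_distrib algebra_simps)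

lemma qgen_empty [simp]: "qgen s x {} = 1"
  by (simp add: qgen_def)

lemma qgen_insert:
  "finite V \<Longrightarrow> i \<notin> V \<Longrightarrow> qgen s x (insert i V) = lin_fps (s * x i) * inverse (lin_fps (x i)) * qgen s x V"
  by (simp add: qgen_def)

lemma qgen_remove:
  assumes "finite V" "i \<in> V"
  shows "qgen s x (V - {i}) = lin_fps (x i) * inverse (lin_fps (s * x i)) * qgen s x V"
proof -
  have "qgen s x V = lin_fps (s * x i) * inverse (lin_fps (x i)) * qgen s x (V - {i})"
    using assms qgen_insert[of "V - {i}" i s x] by (simp add: insert_absorb)
  then have "lin_fps (x i) * inverse (lin_fps (s * x i)) * qgen s x V =
      (lin_fps (x i) * inverse (lin_fps (x i))) * (lin_fps (s * x i) * inverse (lin_fps (s * x i))) * qgen s x (V - {i})"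
    by (simp add: mult_ac)
  then show ?thesis
    by (simp add: lin_fps_mult_inverse)
qed

lemma qcoef_0 [simp]: "qcoef s x V 0 = 1"
  by (induction V rule: infinite_finite_induct) (auto simp: qcoef_def qgen_def fps_prod_nth)

text \<open>Deleting i multiplies the generating function by (1 - x_i u)/(1 - s x_i u), whose
  coefficients are integral polynomials in s and x_i. The integrality of the expansion of Q
  originates here.\<close>

lemma qcoef_remove:
  assumes "finite V" "i \<in> V"
  shows "qcoef s x (V - {i}) r =
    (\<Sum>k\<le>r. (if k = 0 then 1 else s ^ k - s ^ (k - 1)) * x i ^ k * qcoef s x V (r - k))"
  unfolding qcoef_def qgen_remove[OF assms] fps_mult_nth[of _ "qgen s x V"] lin_fps_ratio_nth atLeast0AtMost
  by (intro sum.cong) auto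

lemma qcoef_zero_insert:
  assumes "finite V" "i \<notin> V"
  shows "qcoef 0 x (insert i V) r = (\<Sum>k\<le>r. x i ^ k * qcoef 0 x V (r - k))"
  unfolding qcoef_def qgen_insert[OF assms]
  by (simp add: fps_mult_nth[of _ "qgen 0 x V"] inverse_lin_fps atLeast0AtMost)

lemma qcoef_empty: "qcoef s x {} k = (if k = 0 then 1 else 0)"
  by (simp add: qcoef_def)

text \<open>The logarithmic derivative of the factor is c/(1 - c u) - s c/(1 - s c u); in this
  product form no logarithm of a power series is needed.\<close>

lemma fps_deriv_lin_ratio:
  "fps_deriv (lin_fps (s * c) * inverse (lin_fps c)) =
     lin_fps (s * c) * inverse (lin_fps c) * Abs_fps (\<lambda>k. (1 - s ^ Suc k) * c ^ Suc k)"
proof -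
  have A: "Abs_fps (\<lambda>k. (1 - s ^ Suc k) * c ^ Suc k) =
      fps_const c * inverse (lin_fps c) - fps_const (s * c) * inverse (lin_fps (s * c))"
    by (rule fps_ext) (simp add: inverse_lin_fps power_mult_distrib algebra_simps)
  have D: "fps_deriv (lin_fps d) = - fps_const d" for d :: 'a
    by (simp add: lin_fps_def)
  have "fps_deriv (lin_fps (s * c) * inverse (lin_fps c)) =
      fps_const c * lin_fps (s * c) * inverse (lin_fps c) ^ 2 - fps_const (s * c) * inverse (lin_fps c)"
    by (simp add: D fps_inverse_deriv algebra_simps flip: fps_const_neg)
  also have "\<dots> = lin_fps (s * c) * inverse (lin_fps c) * (fps_const c * inverse (lin_fps c))
      - (lin_fps (s * c) * inverse (lin_fps (s * c))) * (fps_const (s * c) * inverse (lin_fps c))"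
    by (simp add: lin_fps_mult_inverse power2_eq_square mult_ac)
  finally show ?thesis
    unfolding A by (simp add: right_diff_distrib mult_ac)
qed

lemma fps_deriv_qgen:
  "finite V \<Longrightarrow> fps_deriv (qgen s x V) = qgen s x V * Abs_fps (\<lambda>k. (1 - s ^ Suc k) * (\<Sum>i\<in>V. x i ^ Suc k))"
proof (induction V rule: finite_induct)
  case empty
  then show ?case by (simp add: fps_zero_def[symmetric])
next
  case (insert i V)
  have "Abs_fps (\<lambda>k. (1 - s ^ Suc k) * (\<Sum>j\<in>insert i V. x j ^ Suc k)) =
      Abs_fps (\<lambda>k. (1 - s ^ Suc k) * x i ^ Suc k) + Abs_fps (\<lambda>k. (1 - s ^ Suc k) * (\<Sum>j\<in>V. x j ^ Suc k))"
    using insert.hyps by (intro fps_ext) (simp add: distrib_left)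
  then show ?case
    unfolding qgen_insert[OF insert.hyps] fps_deriv_mult[of "_ * _" "qgen s x V"] fps_deriv_lin_ratio insert.IH
    by (simp only: distrib_left distrib_right mult_ac add_ac)
qed

text \<open>Comparison of coefficients in the logarithmic derivative. Each power sum appears with
  its factor 1 - s^r, so passing from s = 0 to s = t is exactly the substitution p_r -> (1 - t^r)
  p_r.\<close>

lemma qcoef_newton:
  assumes "finite V"
  shows "of_nat (Suc k) * qcoef s x V (Suc k) =
    (\<Sum>j\<le>k. qcoef s x V j * ((1 - s ^ Suc (k - j)) * (\<Sum>i\<in>V. x i ^ Suc (k - j))))"
proof -
  have "of_nat (Suc k) * qcoef s x V (Suc k) = fps_deriv (qgen s x V) $ k"
    by (simp add: qcoef_def)
  also have "\<dots> = (\<Sum>j\<le>k. qcoef s x V j * ((1 - s ^ Suc (k - j)) * (\<Sum>i\<in>V. x i ^ Suc (k - j))))"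
    unfolding fps_deriv_qgen[OF assms] fps_mult_nth by (simp add: qcoef_def atLeast0AtMost)
  finally show ?thesis .
qed

lemma hl_res_insert:
  assumes "finite V" "a \<notin> V" "i \<in> V"
  shows "hl_res s x (insert a V) i = hl_res s x V i * ((x i - s * x a) / (x i - x a))"
proof -
  have "insert a V - {i} = insert a (V - {i})"
    using assms by auto
  then show ?thesis
    using assms by (simp add: hl_res_def)
qed

lemma hl_res_insert_self:
  assumes "a \<notin> V"
  shows "hl_res s x (insert a V) a = (\<Prod>j\<in>V. (x a - s * x j) / (x a - x j))"
  using assms by (simp add: hl_res_def insert_Diff_if)

lemma partial_fraction_step:
  fixes z :: "'a::field"
  assumes "z \<noteq> u" "z \<noteq> a" "u \<noteq> a"
  shows "z / (z - u) * ((z - s * a) / (z - a)) =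
    (u - s * a) / (u - a) * (z / (z - u)) + (1 - s) * (a / (a - u)) * (z / (z - a))"
proof -
  have nz: "z - u \<noteq> 0" "z - a \<noteq> 0" "u - a \<noteq> 0"
    using assms by auto
  have e: "a / (a - u) = - (a / (u - a))"
    by (metis minus_diff_eq minus_divide_right)
  have "(z - s * a) * (u - a) = (u - s * a) * (z - a) - (1 - s) * a * (z - u)"
    by (simp add: algebra_simps)
  moreover define P Q where "P = z - s * a" and "Q = u - s * a"
  ultimately have "z * (P * (u - a)) / ((z - u) * (z - a) * (u - a)) =
      z * (Q * (z - a) - (1 - s) * a * (z - u)) / ((z - u) * (z - a) * (u - a))"
    by simp
  also have "\<dots> = z * (Q * (z - a)) / ((z - u) * (z - a) * (u - a)) -
      z * ((1 - s) * a * (z - u)) / ((z - u) * (z - a) * (u - a))"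
    by (simp only: right_diff_distrib[of z] diff_divide_distrib)
  finally show ?thesis
    unfolding e P_def[symmetric] Q_def[symmetric] using nz by (simp add: mult_ac)
qed

text \<open>The fractions z/(z - x_i) vanish at z = 0, so for nonzero x_j the constant s^|V| is the
  value of the product there. In the induction the coefficient at the new pole x_a is the product
  over V at z = x_a; hence z is kept arbitrary.\<close>

lemma partial_fraction:
  fixes x :: "nat \<Rightarrow> 'a::field"
  assumes "finite V" "inj_on x V" "z \<notin> x ` V"
  shows "(\<Prod>j\<in>V. (z - s * x j) / (z - x j)) =
    s ^ card V + (1 - s) * (\<Sum>i\<in>V. hl_res s x V i * (z / (z - x i)))"
  using assms
proof (induction V arbitrary: z rule: finite_induct)
  case empty
  then show ?case by simp
next
  case (insert a V)
  have a: "x a \<notin> x ` V" and inj: "inj_on x V"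
    using insert by auto
  have z: "z \<notin> x ` V" "z \<noteq> x a"
    using insert by auto
  define G where "G = hl_res s x V"
  define w where "w = (z - s * x a) / (z - x a)"
  have w: "w = s + (1 - s) * (z / (z - x a))"
    using z(2) unfolding w_def by (simp add: field_simps)
  have step: "z / (z - x i) * w =
      (x i - s * x a) / (x i - x a) * (z / (z - x i)) + (1 - s) * (x a / (x a - x i)) * (z / (z - x a))"
    if "i \<in> V" for i
    unfolding w_def using that z a by (intro partial_fraction_step) (metis imageI)+
  have Ga: "hl_res s x (insert a V) a = s ^ card V + (1 - s) * (\<Sum>i\<in>V. G i * (x a / (x a - x i)))"
    unfolding hl_res_insert_self[OF insert.hyps(2)] G_def by (rule insert.IH[OF inj a])
  have "(\<Prod>j\<in>insert a V. (z - s * x j) / (z - x j)) = (\<Prod>j\<in>V. (z - s * x j) / (z - x j)) * w"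
    using insert.hyps by (simp add: w_def)
  also have "\<dots> = s ^ card V * w + (1 - s) * (\<Sum>i\<in>V. G i * (z / (z - x i) * w))"
    unfolding insert.IH[OF inj z(1)] G_def by (simp add: distrib_right sum_distrib_right mult.assoc)
  also have "(\<Sum>i\<in>V. G i * (z / (z - x i) * w)) =
      (\<Sum>i\<in>V. hl_res s x (insert a V) i * (z / (z - x i))) +
      (1 - s) * (\<Sum>i\<in>V. G i * (x a / (x a - x i))) * (z / (z - x a))"
    unfolding sum_distrib_left sum_distrib_right sum.distrib[symmetric]
  proof (rule sum.cong[OF refl])
    fix i assume i: "i \<in> V"
    show "G i * (z / (z - x i) * w) = hl_res s x (insert a V) i * (z / (z - x i)) +
      (1 - s) * (G i * (x a / (x a - x i))) * (z / (z - x a))"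
      unfolding step[OF i] hl_res_insert[OF insert.hyps i] G_def[symmetric] by (simp only: distrib_left mult_ac)
  qed
  also have "s ^ card V * w + (1 - s) * ((\<Sum>i\<in>V. hl_res s x (insert a V) i * (z / (z - x i))) +
      (1 - s) * (\<Sum>i\<in>V. G i * (x a / (x a - x i))) * (z / (z - x a))) =
      s ^ Suc (card V) + (1 - s) * (hl_res s x (insert a V) a * (z / (z - x a)) +
        (\<Sum>i\<in>V. hl_res s x (insert a V) i * (z / (z - x i))))"
    unfolding w Ga by (simp add: algebra_simps)
  finally show ?case
    using insert.hyps by simp
qed

lemma lin_fps_ratio_partial_fraction:
  fixes u a :: "'a::field"
  assumes "u \<noteq> a"
  shows "inverse (lin_fps u) * (lin_fps (s * a) * inverse (lin_fps a)) =
    fps_const ((u - s * a) / (u - a)) * inverse (lin_fps u) +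
    fps_const ((1 - s) * (a / (a - u))) * inverse (lin_fps a)"
proof -
  define p q where "p = (u - s * a) / (u - a)" and "q = (1 - s) * (a / (a - u))"
  have nz: "u - a \<noteq> 0" using assms by auto
  have e: "a / (a - u) = - (a / (u - a))"
    by (metis minus_diff_eq minus_divide_right)
  have pq: "p + q = 1" "p * a + q * u = s * a"
    unfolding p_def q_def e using nz by (simp_all add: divide_simps) (simp_all add: algebra_simps)
  have "fps_const p * lin_fps a + fps_const q * lin_fps u =
     fps_const (p + q) - fps_const (p * a + q * u) * fps_X"
    by (simp add: lin_fps_def algebra_simps flip: fps_const_add fps_const_mult)
  then have L: "lin_fps (s * a) = fps_const p * lin_fps a + fps_const q * lin_fps u"
    unfolding pq by (simp add: lin_fps_def)
  have "inverse (lin_fps u) * (lin_fps (s * a) * inverse (lin_fps a)) =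
     fps_const p * inverse (lin_fps u) * (lin_fps a * inverse (lin_fps a)) +
     fps_const q * inverse (lin_fps a) * (lin_fps u * inverse (lin_fps u))"
    unfolding L by (simp only: distrib_left distrib_right mult_ac)
  then show ?thesis
    by (simp add: lin_fps_mult_inverse p_def q_def)
qed

text \<open>This is \<open>partial_fraction\<close> with u = 1/z, as an identity of formal power
  series. The evaluated form is still needed in the proof: it computes the coefficient at the pole
  of the new variable.\<close>

lemma qgen_partial_fraction:
  fixes x :: "nat \<Rightarrow> 'a::field"
  assumes "finite V" "inj_on x V"
  shows "qgen s x V = fps_const (s ^ card V) +
    fps_const (1 - s) * (\<Sum>i\<in>V. fps_const (hl_res s x V i) * inverse (lin_fps (x i)))"
  using assms
proof (induction V rule: finite_induct)
  case empty
  then show ?case by simp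
next
  case (insert a V)
  have a: "x a \<notin> x ` V" and inj: "inj_on x V"
    using insert by auto
  define G where "G = hl_res s x V"
  define w where "w = lin_fps (s * x a) * inverse (lin_fps (x a))"
  have L: "lin_fps (s * x a) = fps_const s * lin_fps (x a) + fps_const (1 - s)"
    by (simp add: lin_fps_def algebra_simps flip: fps_const_add fps_const_mult fps_const_sub)
  have w: "w = fps_const s + fps_const (1 - s) * inverse (lin_fps (x a))"
    unfolding w_def L distrib_right by (simp only: mult.assoc lin_fps_mult_inverse mult_1_right)
  have Ga: "hl_res s x (insert a V) a = s ^ card V + (1 - s) * (\<Sum>i\<in>V. G i * (x a / (x a - x i)))"
    unfolding hl_res_insert_self[OF insert.hyps(2)] G_def by (rule partial_fraction[OF insert.hyps(1) inj a])
  have "qgen s x (insert a V) = fps_const (s ^ card V) * w +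
      fps_const (1 - s) * (\<Sum>i\<in>V. fps_const (G i) * (inverse (lin_fps (x i)) * w))"
    unfolding qgen_insert[OF insert.hyps] w_def[symmetric] insert.IH[OF inj] G_def
    by (simp add: distrib_left sum_distrib_left mult_ac)
  also have "(\<Sum>i\<in>V. fps_const (G i) * (inverse (lin_fps (x i)) * w)) =
      (\<Sum>i\<in>V. fps_const (hl_res s x (insert a V) i) * inverse (lin_fps (x i))) +
      (\<Sum>i\<in>V. fps_const ((1 - s) * (G i * (x a / (x a - x i))))) * inverse (lin_fps (x a))"
    unfolding sum_distrib_right sum.distrib[symmetric]
  proof (rule sum.cong[OF refl])
    fix i assume i: "i \<in> V"
    have "x i \<noteq> x a" using i a by (metis imageI)
    from lin_fps_ratio_partial_fraction[OF this, of s]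
    show "fps_const (G i) * (inverse (lin_fps (x i)) * w) =
      fps_const (hl_res s x (insert a V) i) * inverse (lin_fps (x i)) +
      fps_const ((1 - s) * (G i * (x a / (x a - x i)))) * inverse (lin_fps (x a))"
      unfolding w_def[symmetric] hl_res_insert[OF insert.hyps i] G_def[symmetric]
      by (simp only: distrib_left mult.assoc[symmetric] fps_const_mult) (simp only: mult_ac)
  qed
  also have "(\<Sum>i\<in>V. fps_const ((1 - s) * (G i * (x a / (x a - x i))))) =
      fps_const ((1 - s) * (\<Sum>i\<in>V. G i * (x a / (x a - x i))))"
    by (rule fps_ext) (simp add: fps_sum_nth sum_distrib_left)
  also have "(1 - s) * (\<Sum>i\<in>V. G i * (x a / (x a - x i))) = hl_res s x (insert a V) a - s ^ card V"
    unfolding Ga by simp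
  also have "fps_const (s ^ card V) * w + fps_const (1 - s) * ((\<Sum>i\<in>V. fps_const (hl_res s x (insert a V) i) * inverse (lin_fps (x i))) +
      fps_const (hl_res s x (insert a V) a - s ^ card V) * inverse (lin_fps (x a))) =
    fps_const (s ^ Suc (card V)) + fps_const (1 - s) * (fps_const (hl_res s x (insert a V) a) * inverse (lin_fps (x a)) +
       (\<Sum>i\<in>V. fps_const (hl_res s x (insert a V) i) * inverse (lin_fps (x i))))"
    unfolding w by (simp add: algebra_simps flip: fps_const_sub fps_const_mult)
  finally show ?case
    using insert.hyps by simp
qed

text \<open>The constant s^|V| is invisible in degree k > 0. In degree 0 the formula would fail,
  which is why \<open>hlQ_minus_qprod\<close> excludes zero parts.\<close>

lemma qcoef_pos:
  assumes "finite V" "inj_on x V" "k > 0"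
  shows "qcoef s x V k = (1 - s) * (\<Sum>i\<in>V. x i ^ k * hl_res s x V i)"
  unfolding qcoef_def qgen_partial_fraction[OF assms(1,2)]
  using assms(3) by (simp add: fps_sum_nth inverse_lin_fps mult.commute)

text \<open>This is the degree 0 counterpart, where the constant counts. The resulting (1 - s^n)/(1
  - s) are the factors of \<open>v_fact\<close>.\<close>

lemma sum_hl_res:
  assumes "finite V" "inj_on x V"
  shows "(1 - s) * (\<Sum>i\<in>V. hl_res s x V i) = 1 - s ^ card V"
proof -
  have "qgen s x V $ 0 = s ^ card V + (1 - s) * (\<Sum>i\<in>V. hl_res s x V i)"
    unfolding qgen_partial_fraction[OF assms] by (simp add: fps_sum_nth inverse_lin_fps)
  then show ?thesis
    using qcoef_0[of s x V] by (simp add: qcoef_def eq_diff_eq add.commute)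
qed

section \<open>Expansion of \<open>Q\<^sub>\<lambda>\<close> in products of the \<open>q\<^sub>r\<close>\<close>

lemma part_Cons_0 [simp]: "part (a # l) 0 = a"
  by (simp add: part_def)

lemma part_Cons_Suc [simp]: "part (a # l) (Suc i) = part l i"
  by (simp add: part_def)

lemma part_Nil [simp]: "part [] i = 0"
  by (simp add: part_def)

lemma part_tl: "part (tl l) i = part l (Suc i)"
  by (cases l) auto

definition psum :: "nat list \<Rightarrow> nat \<Rightarrow> nat" where
  "psum l j = (\<Sum>i<j. part l i)"

lemma psum_0 [simp]: "psum l 0 = 0"
  by (simp add: psum_def)

lemma psum_Cons_Suc [simp]: "psum (a # l) (Suc j) = a + psum l j"
  by (simp add: psum_def sum.lessThan_Suc_shift del: sum.lessThan_Suc)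

lemma psum_Suc: "psum l (Suc j) = psum l j + part l j"
  by (simp add: psum_def)

lemma dominance_le_psum: "dominance_le lam \<nu> \<longleftrightarrow> sum_list lam = sum_list \<nu> \<and> (\<forall>j. psum lam j \<le> psum \<nu> j)"
  by (simp add: dominance_le_def psum_def)

lemma psum_eq_imp_eq:
  assumes "\<And>j. psum l j = psum l' j" "length l = length l'"
  shows "l = l'"
proof (rule nth_equalityI)
  fix i assume "i < length l"
  have "part l i = part l' i"
    using assms(1)[of i] assms(1)[of "Suc i"] by (simp add: psum_Suc)
  then show "l ! i = l' ! i"
    using \<open>i < length l\<close> assms(2) by (simp add: part_def)
qed fact

text \<open>The index may be any composition: zeros are harmless because q_0 = 1, and unsorted
  indices arise both in the recursion for Q and in Jacobi-Trudi.\<close>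

definition qprod :: "xfrac \<Rightarrow> nat list \<Rightarrow> nat set \<Rightarrow> xfrac" where
  "qprod s al V = (\<Prod>r\<leftarrow>al. qcoef s xvar V r)"

lemma qprod_Nil [simp]: "qprod s [] V = 1"
  and qprod_Cons [simp]: "qprod s (r # al) V = qcoef s xvar V r * qprod s al V"
  by (simp_all add: qprod_def)

text \<open>Indexes \<open>(m, \<beta>)\<close> of the terms \<open>x\<^sub>i\<^sup>m q\<^sub>\<beta>(V)\<close> in the expansion of \<open>q\<^sub>\<alpha>(V - {i})\<close>.\<close>

definition rem_index :: "nat list \<Rightarrow> (nat \<times> nat list) set" where
  "rem_index al = {(m, be). length be = length al \<and> m + sum_list be = sum_list al \<and>
     (\<forall>j. psum al j \<le> m + psum be j)}"

definition rem_base :: "nat \<times> nat list \<Rightarrow> nat \<times> nat set \<Rightarrow> xfrac" where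
  "rem_base = (\<lambda>(m, be) (i, V). xvar i ^ m * qprod tx be V)"

lemma qcoef_remove_diff:
  "(\<lambda>(i, V). qcoef tx xvar (V - {i}) r - qcoef tx xvar V r)
     \<in> lspan {(i, V). finite V \<and> i \<in> V} Zt rem_base {(k, [r - k]) |k. 1 \<le> k \<and> k \<le> r}"
proof -
  have "(\<lambda>d. \<Sum>k\<in>{1..r}. scalar (tt ^ k - tt ^ (k - 1)) * rem_base (k, [r - k]) d)
     \<in> lspan {(i, V). finite V \<and> i \<in> V} Zt rem_base {(k, [r - k]) |k. 1 \<le> k \<and> k \<le> r}"
    by (intro lspan_sum lspan_scale lspan_base coeff_ring_Zt) (auto intro!: Zt_diff Zt_power)
  then show ?thesis
  proof (rule lspan_cong, clarsimp)
    fix i :: nat and V :: "nat set" assume "finite V" "i \<in> V"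
    then have "qcoef tx xvar (V - {i}) r = qcoef tx xvar V r +
        (\<Sum>k=1..r. (tx ^ k - tx ^ (k - 1)) * xvar i ^ k * qcoef tx xvar V (r - k))"
      by (simp add: qcoef_remove sum.atMost_shift sum.atLeast1_atMost_eq lessThan_Suc_atMost del: power_Suc)
    then show "qcoef tx xvar (V - {i}) r - qcoef tx xvar V r =
       (\<Sum>k = Suc 0..r. scalar (tt ^ k - tt ^ (k - Suc 0)) * rem_base (k, [r - k]) (i, V))"
      by (simp add: rem_base_def scalar_diff scalar_power tx_def mult.assoc)
  qed
qed

text \<open>By A B - a b = (A - a) B + a (B - b), either the first factor contributes a positive
  power of x_i or the change comes from the tail. Moving a total of m from the entries to the
  exponent of x_i lowers every prefix sum by at most m, which is the inequality in
  \<open>rem_index\<close>; the index (0, al) corresponds to moving nothing.\<close>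

lemma qprod_remove_diff:
  "(\<lambda>(i, V). qprod tx al (V - {i}) - qprod tx al V)
     \<in> lspan {(i, V). finite V \<and> i \<in> V} Zt rem_base (rem_index al - {(0, al)})"
proof (induction al)
  case Nil
  show ?case
    by (rule lspan_cong[OF lspan_zero]) auto
next
  case (Cons r al)
  let ?D = "{(i, V). finite V \<and> i \<in> V} :: (nat \<times> nat set) set"
  define A a B b where "A = (\<lambda>(i, V). qcoef tx xvar (V - {i}) r)" and "a = (\<lambda>(i::nat, V). qcoef tx xvar V r)"
    and "B = (\<lambda>(i, V). qprod tx al (V - {i}))" and "b = (\<lambda>(i::nat, V). qprod tx al V)"
  note defs = A_def a_def B_def b_def
  have IH: "(\<lambda>d. B d - b d) \<in> lspan ?D Zt rem_base (rem_index al - {(0, al)})"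
    using Cons.IH by (simp add: defs case_prod_unfold)
  have b: "b \<in> lspan ?D Zt rem_base (rem_index al)"
    by (rule lspan_cong[OF lspan_base[of _ "(0, al)"]]) (auto simp: defs rem_base_def rem_index_def)
  have "(\<lambda>d. (B d - b d) + b d) \<in> lspan ?D Zt rem_base (rem_index al)"
    by (intro lspan_add b coeff_ring_Zt lspan_mono[OF IH]) auto
  then have B: "B \<in> lspan ?D Zt rem_base (rem_index al)"
    by simp
  have "(\<lambda>d. (A d - a d) * B d) \<in> lspan ?D Zt rem_base (rem_index (r # al) - {(0, r # al)})"
  proof (rule lspan_mult[OF coeff_ring_Zt _ B])
    show "(\<lambda>d. A d - a d) \<in> lspan ?D Zt rem_base {(k, [r - k]) |k. 1 \<le> k \<and> k \<le> r}"
      using qcoef_remove_diff by (simp add: defs case_prod_unfold)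
    fix u v assume "u \<in> {(k, [r - k]) |k. 1 \<le> k \<and> k \<le> r}" "v \<in> rem_index al"
    then obtain k m be where u: "u = (k, [r - k])" "1 \<le> k" "k \<le> r" and v: "v = (m, be)"
      "length be = length al" "m + sum_list be = sum_list al" "\<And>j. psum al j \<le> m + psum be j"
      unfolding rem_index_def by blast
    have "psum (r # al) j \<le> k + m + psum ((r - k) # be) j" for j
      using v(4)[of "j - 1"] u by (cases j) auto
    then have "(k + m, (r - k) # be) \<in> rem_index (r # al) - {(0, r # al)}"
      using u v by (auto simp: rem_index_def)
    then show "(\<lambda>d. rem_base u d * rem_base v d) \<in> lspan ?D Zt rem_base (rem_index (r # al) - {(0, r # al)})"
      by (rule lspan_cong[OF lspan_base[OF coeff_ring_Zt]])
         (auto simp: rem_base_def u v(1) power_add)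
  qed
  moreover have "(\<lambda>d. a d * (B d - b d)) \<in> lspan ?D Zt rem_base (rem_index (r # al) - {(0, r # al)})"
  proof (rule lspan_mult[OF coeff_ring_Zt _ IH])
    show "a \<in> lspan ?D Zt rem_base {(0, [r])}"
      by (rule lspan_cong[OF lspan_base[of _ "(0, [r])"]]) (auto simp: defs rem_base_def)
    fix u v assume "u \<in> {(0::nat, [r])}" "v \<in> rem_index al - {(0, al)}"
    then obtain m be where u: "u = (0, [r])" and v: "v = (m, be)" "(m, be) \<noteq> (0, al)"
      "length be = length al" "m + sum_list be = sum_list al" "\<And>j. psum al j \<le> m + psum be j"
      unfolding rem_index_def by blast
    have "psum (r # al) j \<le> m + psum (r # be) j" for j
      using v(5)[of "j - 1"] by (cases j) auto
    then have "(m, r # be) \<in> rem_index (r # al) - {(0, r # al)}"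
      using v by (auto simp: rem_index_def)
    then show "(\<lambda>d. rem_base u d * rem_base v d) \<in> lspan ?D Zt rem_base (rem_index (r # al) - {(0, r # al)})"
      by (rule lspan_cong[OF lspan_base[OF coeff_ring_Zt]])
         (auto simp: rem_base_def u v(1))
  qed
  ultimately have "(\<lambda>d. (A d - a d) * B d + a d * (B d - b d)) \<in> lspan ?D Zt rem_base (rem_index (r # al) - {(0, r # al)})"
    by (rule lspan_add[OF coeff_ring_Zt])
  then show ?case
    by (rule lspan_cong) (auto simp: defs algebra_simps)
qed

text \<open>Defined for every set of variables, since the recursion deletes an arbitrary one and so
  leaves the initial segments. It stops once lam is exhausted, hence no normalization by the number
  of remaining variables is required.\<close>

fun hlQ :: "nat list \<Rightarrow> nat set \<Rightarrow> xfrac" where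
  "hlQ [] V = 1"
| "hlQ (a # lam) V = (1 - tx) * (\<Sum>i\<in>V. xvar i ^ a * hl_res tx xvar V i * hlQ lam (V - {i}))"

text \<open>The tail is expanded on V - {i} by induction and rewritten in terms of V by
  \<open>qprod_remove_diff\<close>; the sum over i then turns x_i^(a+m) into q_(a+m). Whatever left
  the tail thus joins the first part, which raises the index in dominance. Zeros are kept in be, so
  that all indices have equal length and are determined by their prefix sums.\<close>

lemma hlQ_minus_qprod:
  assumes "0 \<notin> set lam"
  shows "(\<lambda>V. hlQ lam V - qprod tx lam V)
    \<in> lspan {V. finite V} Zt (qprod tx) {be. dominance_le lam be \<and> be \<noteq> lam \<and> length be = length lam}"
  using assms
proof (induction lam)
  case Nil
  show ?case
    by (rule lspan_cong[OF lspan_zero]) auto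
next
  case (Cons a lam)
  let ?D = "{(i, V). finite V \<and> i \<in> V} :: (nat \<times> nat set) set"
  let ?J = "\<lambda>lam. {be. dominance_le lam be \<and> be \<noteq> lam \<and> length be = length lam}"
  have a: "a > 0" using Cons.prems by auto
  have "(\<lambda>d. hlQ lam (snd d - {fst d}) - qprod tx lam (snd d - {fst d}))
      \<in> lspan ?D Zt (\<lambda>be d. qprod tx be (snd d - {fst d})) (?J lam)"
    by (rule lspan_comp[OF coeff_ring_Zt Cons.IH]) (use Cons.prems in auto)
  then have 1: "(\<lambda>d. hlQ lam (snd d - {fst d}) - qprod tx lam (snd d - {fst d}))
      \<in> lspan ?D Zt rem_base (rem_index lam - {(0, lam)})"
  proof (rule lspan_trans[OF coeff_ring_Zt])
    fix be assume be: "be \<in> ?J lam"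
    \<comment> \<open>Going up in dominance and then shifting exponents to x_i cannot lead to (0,
      lam): the prefix sums of be would be squeezed between those of lam.\<close>
    have nz: "rem_index be \<subseteq> rem_index lam - {(0, lam)}"
    proof
      fix v assume "v \<in> rem_index be"
      then obtain m ga where v: "v = (m, ga)" and ga: "length ga = length be" "m + sum_list ga = sum_list be"
        "\<And>j. psum be j \<le> m + psum ga j"
        unfolding rem_index_def by blast
      have "psum lam j \<le> m + psum ga j" for j
        using be ga(3)[of j] by (force simp: dominance_le_psum intro: order.trans)
      moreover have "(m, ga) \<noteq> (0, lam)"
      proof
        assume "(m, ga) = (0, lam)"
        then have "psum be j = psum lam j" for j
          using be ga(3)[of j] by (simp add: dominance_le_psum order.antisym)
        then have "be = lam"
          using be by (intro psum_eq_imp_eq) auto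
        then show False using be by simp
      qed
      ultimately show "v \<in> rem_index lam - {(0, lam)}"
        using v ga be by (auto simp: rem_index_def dominance_le_psum)
    qed
    have b: "(\<lambda>d. qprod tx be (snd d)) \<in> lspan ?D Zt rem_base (rem_index be)"
      by (rule lspan_cong[OF lspan_base[of _ "(0, be)"]]) (auto simp: rem_base_def rem_index_def)
    have c: "(\<lambda>d. qprod tx be (snd d - {fst d}) - qprod tx be (snd d)) \<in> lspan ?D Zt rem_base (rem_index be)"
      using lspan_mono[OF qprod_remove_diff, of be "rem_index be"] by (simp add: case_prod_unfold)
    show "(\<lambda>d. qprod tx be (snd d - {fst d})) \<in> lspan ?D Zt rem_base (rem_index lam - {(0, lam)})"
      using lspan_mono[OF lspan_add[OF coeff_ring_Zt b c] nz] by simp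
  qed
  have 2: "(\<lambda>d. qprod tx lam (snd d - {fst d}) - qprod tx lam (snd d)) \<in> lspan ?D Zt rem_base (rem_index lam - {(0, lam)})"
    using qprod_remove_diff[of lam] by (simp add: case_prod_unfold)
  define G where "G = (\<lambda>d. hlQ lam (snd d - {fst d}) - qprod tx lam (snd d))"
  have G: "G \<in> lspan ?D Zt rem_base (rem_index lam - {(0, lam)})"
    using lspan_add[OF coeff_ring_Zt 1 2] by (simp add: G_def)
  define w where "w V i = (1 - tx) * (xvar i ^ a * hl_res tx xvar V i)" for V i
  \<comment> \<open>Here a > 0 matters: it makes a + m positive, so that \<open>qcoef_pos\<close>
    applies even for m = 0.\<close>
  have q: "(\<Sum>i\<in>V. w V i * (xvar i ^ m * z)) = qcoef tx xvar V (a + m) * z" if "finite V" for V m z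
  proof -
    have "qcoef tx xvar V (a + m) = (1 - tx) * (\<Sum>i\<in>V. xvar i ^ (a + m) * hl_res tx xvar V i)"
      using that a by (intro qcoef_pos) (auto simp: inj_on_def)
    then show ?thesis
      by (simp add: w_def sum_distrib_left sum_distrib_right power_add mult_ac)
  qed
  have "(\<lambda>V. \<Sum>i\<in>V. w V i * G (i, V)) \<in> lspan {V. finite V} Zt (qprod tx) (?J (a # lam))"
  proof (rule lspan_map[OF coeff_ring_Zt G])
    fix v assume "v \<in> rem_index lam - {(0, lam)}"
    then obtain m be where v: "v = (m, be)" "(m, be) \<noteq> (0, lam)"
      "length be = length lam" "m + sum_list be = sum_list lam" "\<And>j. psum lam j \<le> m + psum be j"
      unfolding rem_index_def by blast
    have "psum (a # lam) j \<le> psum ((a + m) # be) j" for j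
      using v(5)[of "j - 1"] by (cases j) auto
    then have "(a + m) # be \<in> ?J (a # lam)"
      using v by (auto simp: dominance_le_psum)
    then show "(\<lambda>V. \<Sum>i\<in>V. w V i * rem_base v (i, V)) \<in> lspan {V. finite V} Zt (qprod tx) (?J (a # lam))"
      by (rule lspan_cong[OF lspan_base[OF coeff_ring_Zt]]) (simp add: v(1) rem_base_def q)
  qed auto
  then show ?case
  proof (rule lspan_cong)
    fix V :: "nat set" assume "V \<in> {V. finite V}"
    then have V: "finite V" by simp
    have "hlQ (a # lam) V - qprod tx (a # lam) V =
        (\<Sum>i\<in>V. w V i * hlQ lam (V - {i})) - (\<Sum>i\<in>V. w V i * (xvar i ^ 0 * qprod tx lam V))"
      unfolding q[OF V] by (simp add: w_def sum_distrib_left mult_ac)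
    then show "hlQ (a # lam) V - qprod tx (a # lam) V = (\<Sum>i\<in>V. w V i * G (i, V))"
      by (simp add: G_def right_diff_distrib sum_subtractf)
  qed
qed

section \<open>The symmetrization formula and its agreement with the recursion\<close>

fun hl_term :: "nat list \<Rightarrow> nat list \<Rightarrow> xfrac" where
  "hl_term lam [] = 1"
| "hl_term lam (v # ws) = xvar v ^ part lam 0 *
     (\<Prod>u\<in>set ws. (xvar v - tx * xvar u) / (xvar v - xvar u)) * hl_term (tl lam) ws"

definition hl_sum :: "nat list \<Rightarrow> nat set \<Rightarrow> xfrac" where
  "hl_sum lam V = (\<Sum>ws\<in>permutations_of_set V. hl_term lam ws)"

lemma hl_sum_empty [simp]: "hl_sum lam {} = 1"
  by (simp add: hl_sum_def)

text \<open>The orderings are grouped by their first variable; the factors pairing it with all later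
  ones form \<open>hl_res\<close>.\<close>

lemma hl_sum_rec:
  assumes "finite V" "V \<noteq> {}"
  shows "hl_sum lam V = (\<Sum>v\<in>V. xvar v ^ part lam 0 * hl_res tx xvar V v * hl_sum (tl lam) (V - {v}))"
proof -
  have "hl_sum lam V = (\<Sum>v\<in>V. \<Sum>ws\<in>(#) v ` permutations_of_set (V - {v}). hl_term lam ws)"
    unfolding hl_sum_def permutations_of_set_nonempty[OF assms(2)]
    by (rule sum.UNION_disjoint) (use assms in auto)
  also have "\<dots> = (\<Sum>v\<in>V. \<Sum>ws\<in>permutations_of_set (V - {v}).
      xvar v ^ part lam 0 * hl_res tx xvar V v * hl_term (tl lam) ws)"
  proof (rule sum.cong[OF refl])
    fix v assume "v \<in> V"
    have "(\<Sum>ws\<in>(#) v ` permutations_of_set (V - {v}). hl_term lam ws) =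
        (\<Sum>ws\<in>permutations_of_set (V - {v}). hl_term lam (v # ws))"
      by (simp add: sum.reindex)
    also have "\<dots> = (\<Sum>ws\<in>permutations_of_set (V - {v}).
        xvar v ^ part lam 0 * hl_res tx xvar V v * hl_term (tl lam) ws)"
      by (intro sum.cong refl) (simp add: hl_res_def permutations_of_setD(1))
    finally show "(\<Sum>ws\<in>(#) v ` permutations_of_set (V - {v}). hl_term lam ws) = \<dots>" .
  qed
  finally show ?thesis
    by (simp add: hl_sum_def sum_distrib_left)
qed

lemma v_fact_Suc: "v_fact (Suc n) = v_fact n * ((1 - tt ^ Suc n) / (1 - tt))"
  by (simp add: v_fact_def)

lemma v_fact_0 [simp]: "v_fact 0 = 1"
  by (simp add: v_fact_def)

lemma one_minus_tt_power: "n > 0 \<Longrightarrow> 1 - tt ^ n \<noteq> 0"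
  using tt_power_neq_1[of n] by auto

lemma one_minus_tt: "1 - tt \<noteq> 0"
  using one_minus_tt_power[of 1] by simp

lemma v_fact_nonzero [simp]: "v_fact n \<noteq> 0"
  using one_minus_tt by (auto simp: v_fact_def one_minus_tt_power simp del: right_minus_eq)

lemma scalar_one_minus_tt: "scalar (1 - tt) = 1 - tx"
  by (simp add: scalar_diff tx_def)

lemma one_minus_tx: "1 - tx \<noteq> 0"
  using one_minus_tt by (simp flip: scalar_one_minus_tt)

text \<open>Without exponents each step contributes the sum of the residues, (1 - t^n)/(1 - t),
  regardless of which variable was split off. This evaluation explains the factor for m_0 in
  \<open>hl_v\<close>.\<close>

lemma hl_sum_Nil: "finite V \<Longrightarrow> hl_sum [] V = scalar (v_fact (card V))"
proof (induction "card V" arbitrary: V)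
  case 0
  then show ?case by simp
next
  case (Suc n)
  have ne: "V \<noteq> {}" using Suc.hyps by auto
  have "hl_sum [] V = (\<Sum>v\<in>V. hl_res tx xvar V v * hl_sum [] (V - {v}))"
    by (simp add: hl_sum_rec[OF Suc.prems ne])
  also have "\<dots> = (\<Sum>v\<in>V. hl_res tx xvar V v) * scalar (v_fact n)"
    unfolding sum_distrib_right
  proof (rule sum.cong[OF refl])
    fix v assume v: "v \<in> V"
    have "card (V - {v}) = n"
      using Suc v by simp
    then show "hl_res tx xvar V v * hl_sum [] (V - {v}) = hl_res tx xvar V v * scalar (v_fact n)"
      using Suc.hyps(1)[of "V - {v}"] Suc.prems by simp
  qed
  also have "(\<Sum>v\<in>V. hl_res tx xvar V v) = scalar ((1 - tt ^ Suc n) / (1 - tt))"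
  proof -
    have "(1 - tx) * (\<Sum>v\<in>V. hl_res tx xvar V v) = 1 - tx ^ Suc n"
      using sum_hl_res[OF Suc.prems, of xvar tx] Suc.hyps(2) by (simp add: inj_on_def)
    also have "\<dots> = scalar (1 - tt ^ Suc n)"
      by (simp only: scalar_diff scalar_power tx_def scalar_1)
    finally show ?thesis
      unfolding scalar_divide scalar_one_minus_tt
      using one_minus_tx by (metis eq_divide_imp mult.commute)
  qed
  finally show ?case
    unfolding Suc.hyps(2)[symmetric] v_fact_Suc scalar_mult by (simp only: mult.commute)
qed

lemma hlQ_eq_0: "finite V \<Longrightarrow> card V < length lam \<Longrightarrow> hlQ lam V = 0"
proof (induction lam arbitrary: V)
  case (Cons a lam)
  have "hlQ lam (V - {i}) = 0" if "i \<in> V" for i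
    using that Cons.prems card_gt_0_iff[of V] by (intro Cons.IH) auto
  then show ?case by simp
qed simp

text \<open>\<open>hlQ\<close> stops after the parts of lam are used up, whereas
  \<open>hl_sum\<close> goes on ordering the remaining variables with exponent 0; these contribute
  \<open>v_fact\<close> of their number.\<close>

lemma hlQ_eq_hl_sum:
  "finite V \<Longrightarrow> length lam \<le> card V \<Longrightarrow>
    hlQ lam V * scalar (v_fact (card V - length lam)) = (1 - tx) ^ length lam * hl_sum lam V"
proof (induction lam arbitrary: V)
  case Nil
  then show ?case by (simp add: hl_sum_Nil)
next
  case (Cons a lam)
  have ne: "V \<noteq> {}" using Cons.prems by auto
  let ?c = "scalar (v_fact (card V - length (a # lam)))"
  have IH: "hlQ lam (V - {i}) * ?c = (1 - tx) ^ length lam * hl_sum lam (V - {i})" if "i \<in> V" for i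
    using Cons.IH[of "V - {i}"] Cons.prems that by simp
  have "hlQ (a # lam) V * ?c = (1 - tx) * (\<Sum>i\<in>V. xvar i ^ a * hl_res tx xvar V i * (hlQ lam (V - {i}) * ?c))"
    by (simp add: sum_distrib_left sum_distrib_right mult_ac del: length_Cons)
  also have "\<dots> = (1 - tx) * (\<Sum>i\<in>V. xvar i ^ a * hl_res tx xvar V i * ((1 - tx) ^ length lam * hl_sum lam (V - {i})))"
    by (simp only: IH cong: sum.cong)
  also have "\<dots> = (1 - tx) ^ length (a # lam) * hl_sum (a # lam) V"
    unfolding hl_sum_rec[OF Cons.prems(1) ne] by (simp add: sum_distrib_left mult_ac)
  finally show ?case .
qed

lemma hl_term_closed_form:
  "distinct ws \<Longrightarrow> hl_term lam ws = (\<Prod>i<length ws. xvar (ws ! i) ^ part lam i) *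
     (\<Prod>j<length ws. \<Prod>i<j. (xvar (ws ! i) - tx * xvar (ws ! j)) / (xvar (ws ! i) - xvar (ws ! j)))"
proof (induction ws arbitrary: lam)
  case (Cons v ws)
  define f where "f i j = (xvar ((v # ws) ! i) - tx * xvar ((v # ws) ! j)) / (xvar ((v # ws) ! i) - xvar ((v # ws) ! j))" for i j
  have "(\<Prod>u\<in>set ws. (xvar v - tx * xvar u) / (xvar v - xvar u)) = (\<Prod>j<length ws. f 0 (Suc j))"
    using Cons.prems bij_betw_nth[of ws "{..<length ws}" "set ws"]
    by (subst prod.reindex_bij_betw[symmetric, of "(!) ws" "{..<length ws}" "set ws"]) (auto simp: f_def)
  moreover have "(\<Prod>j<length (v # ws). \<Prod>i<j. f i j) = (\<Prod>j<length ws. f 0 (Suc j)) * (\<Prod>j<length ws. \<Prod>i<j. f (Suc i) (Suc j))"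
    by (simp add: prod.lessThan_Suc_shift prod.distrib del: prod.lessThan_Suc)
  moreover have "(\<Prod>i<length (v # ws). xvar ((v # ws) ! i) ^ part lam i) =
      xvar v ^ part lam 0 * (\<Prod>i<length ws. xvar (ws ! i) ^ part (tl lam) i)"
    by (simp add: prod.lessThan_Suc_shift part_tl del: prod.lessThan_Suc)
  ultimately show ?case
    using Cons.IH[of "tl lam"] Cons.prems by (simp add: f_def[symmetric] del: prod.lessThan_Suc) (simp add: f_def mult_ac)
qed simp

lemma bij_betw_permutes_permutations_of_set:
  "bij_betw (\<lambda>w. map w [0..<n]) {w. w permutes {..<n}} (permutations_of_set {..<n})"
proof -
  let ?f = "\<lambda>w. map w [0..<n]"
  have inj: "inj_on ?f {w. w permutes {..<n}}"
  proof (rule inj_onI, clarify)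
    fix w w' assume w: "w permutes {..<n}" "w' permutes {..<n}" and eq: "?f w = ?f w'"
    show "w = w'"
    proof
      fix i show "w i = w' i"
      proof (cases "i < n")
        case True
        then show ?thesis
          using arg_cong[OF eq, of "\<lambda>l. l ! i"] by simp
      next
        case False
        then show ?thesis
          using w by (simp add: permutes_not_in)
      qed
    qed
  qed
  have sub: "?f ` {w. w permutes {..<n}} \<subseteq> permutations_of_set {..<n}"
    by (auto simp: permutations_of_set_def distinct_map permutes_image lessThan_atLeast0 dest: permutes_inj_on)
  have "card (?f ` {w. w permutes {..<n}}) = card (permutations_of_set {..<n})"
    using inj by (simp add: card_image card_permutations[OF refl])
  then show ?thesis
    unfolding bij_betw_def using inj sub card_subset_eq[of "permutations_of_set {..<n}"] by simp
qed

lemma hall_littlewood_P_hl_sum: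
  "length lam \<le> n \<Longrightarrow> hall_littlewood_P lam n = scalar (inverse (hl_v lam n)) * hl_sum lam {..<n}"
proof -
  assume len: "length lam \<le> n"
  have "hl_sum lam {..<n} = (\<Sum>w | w permutes {..<n}. hl_term lam (map w [0..<n]))"
    unfolding hl_sum_def by (rule sum.reindex_bij_betw[OF bij_betw_permutes_permutations_of_set, symmetric])
  also have "\<dots> = (\<Sum>w | w permutes {..<n}.
           (\<Prod>i<length lam. xvar (w i) ^ (lam ! i)) *
           (\<Prod>j<n. \<Prod>i<j. (xvar (w i) - scalar tt * xvar (w j)) / (xvar (w i) - xvar (w j))))"
  proof (rule sum.cong[OF refl], clarify)
    fix w assume w: "w permutes {..<n}"
    have d: "distinct (map w [0..<n])"
      using w by (auto simp: distinct_map dest: permutes_inj_on)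
    have "(\<Prod>i<n. xvar (w i) ^ part lam i) = (\<Prod>i<length lam. xvar (w i) ^ (lam ! i))"
      using len by (intro prod.mono_neutral_cong_right) (auto simp: part_def)
    then show "hl_term lam (map w [0..<n]) = (\<Prod>i<length lam. xvar (w i) ^ (lam ! i)) *
           (\<Prod>j<n. \<Prod>i<j. (xvar (w i) - scalar tt * xvar (w j)) / (xvar (w i) - xvar (w j)))"
      unfolding hl_term_closed_form[OF d] by (simp add: tx_def)
  qed
  finally show ?thesis
    using len by (simp add: hall_littlewood_P_def)
qed

lemma phi_fact_v_fact: "phi_fact m = (1 - tt) ^ m * v_fact m"
proof (induction m)
  case (Suc m)
  have "phi_fact (Suc m) = phi_fact m * (1 - tt ^ Suc m)"
    by (simp add: phi_fact_def)
  then show ?case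
    using one_minus_tt by (simp add: v_fact_Suc Suc mult_ac del: power_Suc right_minus_eq) (simp add: mult_ac)
qed (simp add: phi_fact_def)

text \<open>Each \<open>phi_fact m\<close> is (1 - t)^m times \<open>v_fact m\<close>, and the
  multiplicities of the parts add up to the length. The extra factor on the left is the one that
  \<open>hl_v\<close> has for the padding zeros.\<close>

lemma hl_b_hl_v: "hl_b lam * v_fact (n - length lam) = (1 - tt) ^ length lam * hl_v lam n"
proof -
  have "hl_b lam = (1 - tt) ^ (\<Sum>i\<in>set lam. count_list lam i) * (\<Prod>i\<in>set lam. v_fact (count_list lam i))"
    by (simp add: hl_b_def phi_fact_v_fact prod.distrib power_sum)
  then show ?thesis
    by (simp add: hl_v_def sum_count_set mult_ac)
qed

lemma hl_v_nonzero [simp]: "hl_v lam n \<noteq> 0"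
  by (simp add: hl_v_def)

lemma hl_b_nonzero [simp]: "hl_b lam \<noteq> 0"
  using hl_b_hl_v[of lam 0] one_minus_tt by auto

text \<open>Below the length of lam both sides vanish, by convention on the left and for lack of
  variables on the right. So the truncation in the definition of P fits the recursion.\<close>

lemma hall_littlewood_Q_hlQ: "hall_littlewood_Q lam n = hlQ lam {..<n}"
proof (cases "length lam \<le> n")
  case True
  have "hall_littlewood_Q lam n * scalar (v_fact (n - length lam)) =
      scalar (hl_b lam * v_fact (n - length lam) * inverse (hl_v lam n)) * hl_sum lam {..<n}"
    by (simp add: hall_littlewood_Q_def hall_littlewood_P_hl_sum[OF True] scalar_mult mult_ac)
  also have "\<dots> = (1 - tx) ^ length lam * hl_sum lam {..<n}"
    unfolding hl_b_hl_v by (simp add: mult.assoc scalar_power scalar_one_minus_tt)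
  also have "\<dots> = hlQ lam {..<n} * scalar (v_fact (n - length lam))"
    using hlQ_eq_hl_sum[of "{..<n}" lam] True by simp
  finally show ?thesis
    by simp
next
  case False
  then show ?thesis
    by (simp add: hall_littlewood_Q_def hall_littlewood_P_def hlQ_eq_0)
qed

section \<open>Inverting the expansion\<close>

text \<open>The maximum of n + 1 distinct naturals is at least n, so removing it costs at most f n.
  This is applied to sorted parts, to permuted prefixes and to staircases.\<close>

lemma sum_antimono_le_sum_lessThan:
  fixes f :: "nat \<Rightarrow> nat"
  assumes "antimono f" "finite A"
  shows "sum f A \<le> (\<Sum>i<card A. f i)"
  using assms(2)
proof (induction "card A" arbitrary: A)
  case 0
  then show ?case by simp
next
  case (Suc n)
  have ne: "A \<noteq> {}" using Suc.hyps by auto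
  have M: "Max A \<in> A" using ne Suc.prems by simp
  have "A \<subseteq> {..Max A}" using Suc.prems by auto
  then have "n \<le> Max A"
    using card_mono[of "{..Max A}" A] Suc.hyps(2) by simp
  then have "f (Max A) \<le> f n"
    using assms(1) by (simp add: antimonoD)
  moreover have "sum f (A - {Max A}) \<le> (\<Sum>i<n. f i)"
    using Suc.hyps(1)[of "A - {Max A}"] Suc.prems M card_Diff_singleton[OF M] by (simp flip: Suc.hyps(2))
  ultimately show ?case
    using sum.remove[OF Suc.prems M, of f] by (simp flip: Suc.hyps(2))
qed

lemma antimono_part: "sorted_wrt (\<ge>) l \<Longrightarrow> antimono (part l)"
  unfolding sorted_wrt_iff_nth_less
  by (rule antimonoI) (metis (no_types, lifting) le0 le_eq_less_or_eq order.strict_trans part_def)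

lemma part_filter_pos: "sorted_wrt (\<ge>) l \<Longrightarrow> part (filter (\<lambda>r. r \<noteq> 0) l) i = part l i"
proof (induction l arbitrary: i)
  case (Cons a l)
  show ?case
  proof (cases "a = 0")
    case True
    then have "\<forall>r\<in>set (a # l). r = 0" using Cons.prems by auto
    then show ?thesis
      by (cases i) (auto simp: part_def filter_False)
  next
    case False
    then show ?thesis
      using Cons by (cases i) auto
  qed
qed simp

lemma part_eq_0_iff: "is_partition l \<Longrightarrow> part l i = 0 \<longleftrightarrow> i \<ge> length l"
  unfolding is_partition_def part_def by (metis nth_mem not_le)

lemma partition_eqI:
  assumes "is_partition l" "is_partition l'" "\<And>j. psum l j = psum l' j"
  shows "l = l'"
proof (rule psum_eq_imp_eq)
  have "part l i = part l' i" for i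
    using assms(3)[of i] assms(3)[of "Suc i"] by (simp add: psum_Suc)
  then have "i \<ge> length l \<longleftrightarrow> i \<ge> length l'" for i
    using part_eq_0_iff[OF assms(1), of i] part_eq_0_iff[OF assms(2), of i] by simp
  then show "length l = length l'"
    by (metis order.antisym order.refl)
qed fact

text \<open>A normal form for indices of \<open>qprod\<close>: factors commute and q_0 = 1, so
  sorting and deleting zeros changes nothing there.\<close>

definition canon :: "nat list \<Rightarrow> nat list" where
  "canon al = rev (sort (filter (\<lambda>r. r \<noteq> 0) al))"

lemma is_partition_canon [simp]: "is_partition (canon al)"
  by (simp add: is_partition_def canon_def sorted_wrt_rev)

lemma sum_list_canon: "sum_list (canon al) = sum_list al"
proof -
  have "sum_list (canon al) = sum_list (filter (\<lambda>r. r \<noteq> 0) al)"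
    by (metis canon_def mset_rev mset_sort sum_mset_sum_list)
  also have "\<dots> = sum_list al"
    by (induction al) auto
  finally show ?thesis .
qed

lemma qprod_canon: "qprod s (canon al) V = qprod s al V"
proof -
  have "qprod s (canon al) V = qprod s (filter (\<lambda>r. r \<noteq> 0) al) V"
  proof -
    have "mset (canon al) = mset (filter (\<lambda>r. r \<noteq> 0) al)"
      by (simp add: canon_def)
    moreover have "qprod s l V = prod_mset (image_mset (qcoef s xvar V) (mset l))" for l
      by (induction l) auto
    ultimately show ?thesis by simp
  qed
  also have "\<dots> = qprod s al V"
    by (induction al) auto
  finally show ?thesis .
qed

lemma psum_le_psum_canon: "psum al j \<le> psum (canon al) j"
proof -
  \<comment> \<open>z keeps the zeros, so it is a genuine rearrangement of al; deleting zeros from a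
    decreasing list leaves all values of \<open>part\<close> unchanged.\<close>
  define z where "z = rev (sort al)"
  have z: "sorted_wrt (\<ge>) z"
    by (simp add: z_def sorted_wrt_rev)
  have "canon al = filter (\<lambda>r. r \<noteq> 0) z"
    by (simp add: canon_def z_def filter_sort flip: rev_filter)
  then have psum_z: "psum (canon al) k = psum z k" for k
    using part_filter_pos[OF z] by (simp add: psum_def)
  obtain p where p: "p permutes {..<length z}" "permute_list p z = al"
    using mset_eq_permutation[of al z] by (auto simp: z_def)
  have len: "length z = length al"
    by (simp add: z_def)
  \<comment> \<open>The rearrangement relates entries only inside the list; beyond its end
    \<open>part\<close> is 0.\<close>
  define m where "m = min j (length al)"
  have "psum al j = (\<Sum>i<m. part al i)"
    unfolding psum_def by (rule sum.mono_neutral_right) (auto simp: m_def part_def)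
  also have "\<dots> = (\<Sum>i<m. part z (p i))"
  proof (rule sum.cong[OF refl])
    fix i assume i: "i \<in> {..<m}"
    then have "i < length z" by (simp add: m_def len)
    moreover from this have "p i < length z"
      using permutes_in_image[OF p(1), of i] by simp
    moreover have "al ! i = z ! p i"
      using permute_list_nth[OF p(1) \<open>i < length z\<close>] p(2) by simp
    ultimately show "part al i = part z (p i)"
      by (simp add: part_def len)
  qed
  also have "\<dots> = sum (part z) (p ` {..<m})"
    using permutes_inj_on[OF p(1)] by (simp add: sum.reindex)
  also have "\<dots> \<le> (\<Sum>i<card (p ` {..<m}). part z i)"
    by (intro sum_antimono_le_sum_lessThan antimono_part z) simp
  also have "\<dots> = (\<Sum>i<m. part z i)"
    using permutes_inj_on[OF p(1)] by (simp add: card_image)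
  also have "\<dots> \<le> psum z j"
    unfolding psum_def by (rule sum_mono2) (auto simp: m_def)
  finally show ?thesis
    by (simp add: psum_z)
qed

lemma dominance_le_canon: "dominance_le al (canon al)"
  by (simp add: dominance_le_psum sum_list_canon psum_le_psum_canon)

lemma dominance_le_refl: "dominance_le l l"
  by (simp add: dominance_le_psum)

lemma dominance_le_trans: "dominance_le a b \<Longrightarrow> dominance_le b c \<Longrightarrow> dominance_le a c"
  unfolding dominance_le_psum by (metis order.trans)

lemma dominance_le_antisym:
  "is_partition a \<Longrightarrow> is_partition b \<Longrightarrow> dominance_le a b \<Longrightarrow> dominance_le b a \<Longrightarrow> a = b"
  unfolding dominance_le_psum by (intro partition_eqI) (auto intro: order.antisym)

lemma length_le_sum_list: "0 \<notin> set l \<Longrightarrow> length l \<le> sum_list l"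
  by (induction l) auto

lemma finite_partitions_of: "finite (partitions_of k)"
proof (rule finite_subset)
  show "partitions_of k \<subseteq> {l. set l \<subseteq> {..k} \<and> length l \<le> k}"
    using length_le_sum_list member_le_sum_list
    by (fastforce simp: partitions_of_def is_partition_def)
  show "finite {l. set l \<subseteq> {..k} \<and> length l \<le> k}"
    by (rule finite_lists_length_le) simp
qed

definition up_set :: "nat list \<Rightarrow> nat list set" where
  "up_set al = {\<nu>. is_partition \<nu> \<and> dominance_le al \<nu>}"

lemma finite_up_set: "finite (up_set al)"
  by (rule finite_subset[OF _ finite_partitions_of[of "sum_list al"]])
     (auto simp: up_set_def partitions_of_def dominance_le_def)

lemma up_set_mono: "dominance_le a b \<Longrightarrow> up_set b \<subseteq> up_set a"
  by (auto simp: up_set_def intro: dominance_le_trans)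

lemma up_set_strict_mono:
  assumes "is_partition a" "\<nu> \<in> up_set a" "\<nu> \<noteq> a"
  shows "up_set \<nu> \<subseteq> up_set a - {a}"
  using assms up_set_mono[of a \<nu>] dominance_le_antisym[of a \<nu>] by (auto simp: up_set_def)

text \<open>Back substitution in a unitriangular system. The measure is the number of partitions
  above lam, which is finite and drops strictly along dominance.\<close>

lemma qprod_minus_hlQ:
  assumes "is_partition lam"
  shows "(\<lambda>V. qprod tx lam V - hlQ lam V) \<in> lspan {V. finite V} Zt hlQ (up_set lam - {lam})"
  using assms
proof (induction "card (up_set lam)" arbitrary: lam rule: less_induct)
  case less
  note lam = less.prems
  have "(\<lambda>V. hlQ lam V - qprod tx lam V)
    \<in> lspan {V. finite V} Zt (qprod tx) {be. dominance_le lam be \<and> be \<noteq> lam \<and> length be = length lam}"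
    using lam by (intro hlQ_minus_qprod) (simp add: is_partition_def)
  then have "(\<lambda>V. hlQ lam V - qprod tx lam V) \<in> lspan {V. finite V} Zt hlQ (up_set lam - {lam})"
  proof (rule lspan_trans[OF coeff_ring_Zt])
    fix be assume "be \<in> {be. dominance_le lam be \<and> be \<noteq> lam \<and> length be = length lam}"
    then have be: "dominance_le lam be" "be \<noteq> lam" "length be = length lam" by auto
    define \<nu> where "\<nu> = canon be"
    \<comment> \<open>Sorting only raises prefix sums, so an index above lam that sorts to lam has
      the prefix sums of lam; equal length then makes it equal to lam.\<close>
    have "\<nu> \<noteq> lam"
    proof
      assume "\<nu> = lam"
      then have "psum be j = psum lam j" for j
        using be(1) psum_le_psum_canon[of be j] by (auto simp: \<nu>_def dominance_le_psum intro: order.antisym)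
      then show False
        using be(2,3) psum_eq_imp_eq by blast
    qed
    moreover have \<nu>: "\<nu> \<in> up_set lam"
      using be(1) dominance_le_canon[of be] by (auto simp: up_set_def \<nu>_def intro: dominance_le_trans)
    ultimately have sub: "up_set \<nu> \<subseteq> up_set lam - {lam}"
      using up_set_strict_mono lam by blast
    have "lam \<in> up_set lam"
      using lam by (simp add: up_set_def dominance_le_refl)
    then have "card (up_set \<nu>) < card (up_set lam)"
      using sub by (intro psubset_card_mono finite_up_set) auto
    then have "(\<lambda>V. qprod tx \<nu> V - hlQ \<nu> V) \<in> lspan {V. finite V} Zt hlQ (up_set \<nu> - {\<nu>})"
      using less.hyps by (simp add: \<nu>_def)
    then have "(\<lambda>V. qprod tx \<nu> V - hlQ \<nu> V) \<in> lspan {V. finite V} Zt hlQ (up_set lam - {lam})"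
      by (rule lspan_mono) (use sub in auto)
    moreover have "hlQ \<nu> \<in> lspan {V. finite V} Zt hlQ (up_set lam - {lam})"
      using \<nu> \<open>\<nu> \<noteq> lam\<close> by (intro lspan_base coeff_ring_Zt) auto
    ultimately have "(\<lambda>V. (qprod tx \<nu> V - hlQ \<nu> V) + hlQ \<nu> V) \<in> lspan {V. finite V} Zt hlQ (up_set lam - {lam})"
      by (rule lspan_add[OF coeff_ring_Zt])
    then show "qprod tx be \<in> lspan {V. finite V} Zt hlQ (up_set lam - {lam})"
      by (rule lspan_cong) (simp add: \<nu>_def qprod_canon)
  qed
  from lspan_uminus[OF coeff_ring_Zt this] show ?case
    by simp
qed

lemma qprod_lspan_hall_littlewood_Q:
  "(\<lambda>n. qprod tx al {..<n}) \<in> lspan D Zt hall_littlewood_Q (up_set al)"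
proof -
  have "up_set (canon al) \<subseteq> up_set al"
    by (intro up_set_mono dominance_le_canon)
  then have "(\<lambda>V. qprod tx (canon al) V - hlQ (canon al) V) \<in> lspan {V. finite V} Zt hlQ (up_set al)"
    by (intro lspan_mono[OF qprod_minus_hlQ]) auto
  moreover have "hlQ (canon al) \<in> lspan {V. finite V} Zt hlQ (up_set al)"
    using dominance_le_canon[of al] by (intro lspan_base coeff_ring_Zt) (simp add: up_set_def)
  ultimately have "(\<lambda>V. (qprod tx (canon al) V - hlQ (canon al) V) + hlQ (canon al) V) \<in> lspan {V. finite V} Zt hlQ (up_set al)"
    by (rule lspan_add[OF coeff_ring_Zt])
  then have "qprod tx al \<in> lspan {V. finite V} Zt hlQ (up_set al)"
    by (rule lspan_cong) (simp add: qprod_canon)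
  from lspan_comp[OF coeff_ring_Zt this, of D lessThan] show ?thesis
    by (simp add: hall_littlewood_Q_hlQ[abs_def])
qed

lemma qprod_minus_hall_littlewood_Q:
  assumes "is_partition lam"
  shows "(\<lambda>n. qprod tx lam {..<n} - hall_littlewood_Q lam n)
    \<in> lspan D Zt hall_littlewood_Q (up_set lam - {lam})"
  using lspan_comp[OF coeff_ring_Zt qprod_minus_hlQ[OF assms], of D lessThan]
  by (simp add: hall_littlewood_Q_hlQ[abs_def])

section \<open>The Jacobi--Trudi formula for skew Schur functions\<close>

text \<open>Represents h_(b - c) or q_(b - c). The case distinction keeps truncated subtraction from
  turning a negative index into index 0, where the value is 1.\<close>

definition jt_entry :: "xfrac \<Rightarrow> nat \<Rightarrow> nat \<Rightarrow> nat \<Rightarrow> xfrac" where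
  "jt_entry s n b c = (if c \<le> b then qcoef s xvar {..<n} (b - c) else 0)"

text \<open>The Leibniz expansion of det(h_(\<lambda>_i - i + j - \<mu>_j)), with both sequences
  shifted by the staircase l - 1 - i so that they consist of natural numbers. The row data are
  arbitrary functions because the recursion in n passes through sequences that come from no
  partition.\<close>

definition jacobi_trudi :: "xfrac \<Rightarrow> nat \<Rightarrow> nat \<Rightarrow> (nat \<Rightarrow> nat) \<Rightarrow> (nat \<Rightarrow> nat) \<Rightarrow> xfrac" where
  "jacobi_trudi s l n be c = (\<Sum>\<sigma> | \<sigma> permutes {..<l}. of_int (sign \<sigma>) * (\<Prod>i<l. jt_entry s n (be i) (c (\<sigma> i))))"

lemma jacobi_trudi_cong: "(\<And>i. i < l \<Longrightarrow> be i = be' i) \<Longrightarrow> jacobi_trudi s l n be c = jacobi_trudi s l n be' c"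
  unfolding jacobi_trudi_def by (intro sum.cong refl arg_cong2[where f = "(*)"] prod.cong) auto

lemma jt_entry_0: "jt_entry s 0 b c = (if b = c then 1 else 0)"
  by (simp add: jt_entry_def qcoef_empty)

text \<open>The sum is split by the power of x_n. Letting g run over all g \<le> b makes its range
  independent of the column c, so that the determinant can be expanded row by row.\<close>

lemma jt_entry_Suc: "jt_entry 0 (Suc n) b c = (\<Sum>g\<le>b. xvar n ^ (b - g) * jt_entry 0 n g c)"
proof (cases "c \<le> b")
  case True
  have "jt_entry 0 (Suc n) b c = (\<Sum>k\<le>b - c. xvar n ^ k * qcoef 0 xvar {..<n} (b - c - k))"
    using True by (simp add: jt_entry_def lessThan_Suc qcoef_zero_insert)
  also have "\<dots> = (\<Sum>g\<in>{c..b}. xvar n ^ (b - g) * jt_entry 0 n g c)"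
    by (rule sum.reindex_bij_witness[of _ "\<lambda>g. b - g" "\<lambda>k. b - k"]) (use True in \<open>auto simp: jt_entry_def add.commute\<close>)
  also have "\<dots> = (\<Sum>g\<le>b. xvar n ^ (b - g) * jt_entry 0 n g c)"
    by (rule sum.mono_neutral_left) (auto simp: jt_entry_def)
  finally show ?thesis .
next
  case False
  then show ?thesis
    by (auto simp: jt_entry_def intro!: sum.neutral)
qed

lemma prod_power_diff:
  fixes y :: "'a::comm_monoid_mult"
  assumes "\<And>i. i \<in> A \<Longrightarrow> g i \<le> b i"
  shows "(\<Prod>i\<in>A. y ^ (b i - g i)) = y ^ (sum b A - sum g A)"
  using assms by (simp add: sum_subtractf_nat flip: power_sum)

lemma jacobi_trudi_Suc:
  "jacobi_trudi 0 l (Suc n) be c =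
     (\<Sum>ga\<in>PiE {..<l} (\<lambda>i. {..be i}). xvar n ^ (sum be {..<l} - sum ga {..<l}) * jacobi_trudi 0 l n ga c)"
proof -
  have "(\<Prod>i<l. jt_entry 0 (Suc n) (be i) (c (\<sigma> i))) =
      (\<Sum>ga\<in>PiE {..<l} (\<lambda>i. {..be i}). xvar n ^ (sum be {..<l} - sum ga {..<l}) * (\<Prod>i<l. jt_entry 0 n (ga i) (c (\<sigma> i))))" for \<sigma>
  proof -
    have "(\<Prod>i<l. jt_entry 0 (Suc n) (be i) (c (\<sigma> i))) =
        (\<Sum>ga\<in>PiE {..<l} (\<lambda>i. {..be i}). \<Prod>i<l. xvar n ^ (be i - ga i) * jt_entry 0 n (ga i) (c (\<sigma> i)))"
      unfolding jt_entry_Suc by (rule prod_sum_PiE) auto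
    also have "\<dots> = (\<Sum>ga\<in>PiE {..<l} (\<lambda>i. {..be i}). xvar n ^ (sum be {..<l} - sum ga {..<l}) * (\<Prod>i<l. jt_entry 0 n (ga i) (c (\<sigma> i))))"
    proof (rule sum.cong[OF refl])
      fix ga assume "ga \<in> PiE {..<l} (\<lambda>i. {..be i})"
      then have "(\<Prod>i<l. xvar n ^ (be i - ga i)) = xvar n ^ (sum be {..<l} - sum ga {..<l})"
        by (intro prod_power_diff) auto
      then show "(\<Prod>i<l. xvar n ^ (be i - ga i) * jt_entry 0 n (ga i) (c (\<sigma> i))) =
          xvar n ^ (sum be {..<l} - sum ga {..<l}) * (\<Prod>i<l. jt_entry 0 n (ga i) (c (\<sigma> i)))"
        by (simp add: prod.distrib)
    qed
    finally show ?thesis .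
  qed
  then have "jacobi_trudi 0 l (Suc n) be c = (\<Sum>\<sigma> | \<sigma> permutes {..<l}. \<Sum>ga\<in>PiE {..<l} (\<lambda>i. {..be i}).
      xvar n ^ (sum be {..<l} - sum ga {..<l}) * (of_int (sign \<sigma>) * (\<Prod>i<l. jt_entry 0 n (ga i) (c (\<sigma> i)))))"
    by (simp add: jacobi_trudi_def sum_distrib_left mult.left_commute)
  then show ?thesis
    by (subst (asm) sum.swap) (simp add: jacobi_trudi_def sum_distrib_left)
qed

lemma jacobi_trudi_swap:
  assumes "Suc i < l"
  shows "jacobi_trudi s l n (ga \<circ> transpose i (Suc i)) c = - jacobi_trudi s l n ga c"
proof -
  let ?\<tau> = "transpose i (Suc i)"
  have \<tau>: "?\<tau> permutes {..<l}"
    using assms by (intro permutes_swap_id) auto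
  have "jacobi_trudi s l n (ga \<circ> ?\<tau>) c =
      (\<Sum>\<sigma> | \<sigma> permutes {..<l}. of_int (sign (\<sigma> \<circ> ?\<tau>)) * (\<Prod>j<l. jt_entry s n (ga (?\<tau> j)) (c (\<sigma> (?\<tau> j)))))"
    unfolding jacobi_trudi_def by (subst sum_permutations_compose_right[OF \<tau>]) simp
  also have "\<dots> = (\<Sum>\<sigma> | \<sigma> permutes {..<l}. - (of_int (sign \<sigma>) * (\<Prod>j<l. jt_entry s n (ga j) (c (\<sigma> j)))))"
  proof (rule sum.cong[OF refl], clarify)
    fix \<sigma> assume "\<sigma> permutes {..<l}"
    then have "permutation \<sigma>"
      by (auto simp: permutation_permutes)
    then have "sign (\<sigma> \<circ> ?\<tau>) = - sign \<sigma>"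
      by (simp add: sign_compose sign_swap_id permutation_swap_id)
    moreover have "(\<Prod>j<l. jt_entry s n (ga (?\<tau> j)) (c (\<sigma> (?\<tau> j)))) = (\<Prod>j<l. jt_entry s n (ga j) (c (\<sigma> j)))"
      using prod.permute[OF \<tau>, of "\<lambda>j. jt_entry s n (ga j) (c (\<sigma> j))"] by (simp add: o_def)
    ultimately show "of_int (sign (\<sigma> \<circ> ?\<tau>)) * (\<Prod>j<l. jt_entry s n (ga (?\<tau> j)) (c (\<sigma> (?\<tau> j)))) =
        - (of_int (sign \<sigma>) * (\<Prod>j<l. jt_entry s n (ga j) (c (\<sigma> j))))"
      by simp
  qed
  finally show ?thesis
    by (simp add: jacobi_trudi_def sum_negf)
qed

text \<open>Swapping \<open>\<gamma>\<^sub>i\<close> and \<open>\<gamma>\<^bsub>i+1\<^esub>\<close> at the first \<open>i\<close> with \<open>\<gamma>\<^sub>i \<le> \<beta>\<^bsub>i+1\<^esub>\<close> is a sign-reversing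
  involution on the terms that do not come from horizontal strips.\<close>

definition interlacing :: "nat \<Rightarrow> (nat \<Rightarrow> nat) \<Rightarrow> (nat \<Rightarrow> nat) set" where
  "interlacing l be = {ga \<in> PiE {..<l} (\<lambda>i. {..be i}). \<forall>i. Suc i < l \<longrightarrow> be (Suc i) < ga i}"

lemma finite_interlacing: "finite (interlacing l be)"
  by (rule finite_subset[of _ "PiE {..<l} (\<lambda>i. {..be i})"]) (auto simp: interlacing_def intro: finite_PiE)

lemma jacobi_trudi_Suc_interlacing:
  assumes dec: "\<And>i. Suc i < l \<Longrightarrow> be (Suc i) < be i"
  shows "jacobi_trudi 0 l (Suc n) be c = (\<Sum>ga\<in>interlacing l be. xvar n ^ (sum be {..<l} - sum ga {..<l}) * jacobi_trudi 0 l n ga c)"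
proof -
  define Bad where "Bad = {ga \<in> PiE {..<l} (\<lambda>i. {..be i}). \<exists>i. Suc i < l \<and> ga i \<le> be (Suc i)}"
  define f where "f ga = xvar n ^ (sum be {..<l} - sum ga {..<l}) * jacobi_trudi 0 l n ga c" for ga
  define i0 where "i0 ga = (LEAST i. Suc i < l \<and> ga i \<le> be (Suc i))" for ga
  define \<phi> where "\<phi> ga = ga \<circ> transpose (i0 ga) (Suc (i0 ga))" for ga :: "nat \<Rightarrow> nat"
  have i0: "Suc (i0 ga) < l" "ga (i0 ga) \<le> be (Suc (i0 ga))" if "ga \<in> Bad" for ga
    using LeastI_ex[of "\<lambda>i. Suc i < l \<and> ga i \<le> be (Suc i)"] that unfolding Bad_def i0_def by auto
  have i0_least: "\<not> (Suc i < l \<and> ga i \<le> be (Suc i))" if "i < i0 ga" for ga i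
    using not_less_Least that unfolding i0_def by blast
  have Bad: "ga i \<le> be i" if "ga \<in> Bad" "i < l" for ga i
    using that by (auto simp: Bad_def)
  have \<phi>: "\<phi> ga \<in> Bad" "i0 (\<phi> ga) = i0 ga" if ga: "ga \<in> Bad" for ga
  proof -
    let ?i = "i0 ga"
    note i = i0[OF ga]
    have 1: "\<phi> ga ?i = ga (Suc ?i)" "\<phi> ga (Suc ?i) = ga ?i"
      and 2: "\<And>k. k \<noteq> ?i \<Longrightarrow> k \<noteq> Suc ?i \<Longrightarrow> \<phi> ga k = ga k"
      by (simp_all add: \<phi>_def)
    \<comment> \<open>Since be decreases, both swapped values are at most be (i + 1) and fit into
      row i as well as into row i + 1.\<close>
    have 3: "\<phi> ga k \<le> be k" if "k < l" for k
      using 1 2[of k] Bad[OF ga, of k] Bad[OF ga, of "Suc ?i"] i dec[OF i(1)] that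
      by (cases "k = ?i"; cases "k = Suc ?i") auto
    have 4: "\<phi> ga k = undefined" if "\<not> k < l" for k
      using 2[of k] that i ga by (auto simp: Bad_def PiE_def extensional_def)
    have 5: "Suc ?i < l \<and> \<phi> ga ?i \<le> be (Suc ?i)"
      using 1 i Bad[OF ga, of "Suc ?i"] by simp
    have "\<phi> ga \<in> PiE {..<l} (\<lambda>i. {..be i})"
      using 3 4 by (intro PiE_I) auto
    then show "\<phi> ga \<in> Bad"
      using 5 unfolding Bad_def by blast
    \<comment> \<open>The condition at k involves only the entry at k. Entries before the swap are
      unchanged, and the new entry at the swap position still violates the condition, so the first
      violation stays where it was. This makes the map an involution.\<close>
    show "i0 (\<phi> ga) = ?i"
      unfolding i0_def[of "\<phi> ga"]
    proof (rule Least_equality)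
      show "Suc ?i < l \<and> \<phi> ga ?i \<le> be (Suc ?i)" by fact
      fix k assume k: "Suc k < l \<and> \<phi> ga k \<le> be (Suc k)"
      show "?i \<le> k"
      proof (rule ccontr)
        assume "\<not> ?i \<le> k"
        then show False
          using i0_least[of k ga] 2[of k] k by simp
      qed
    qed
  qed
  have "sum f Bad = (\<Sum>ga\<in>Bad. f (\<phi> ga))"
    by (rule sum.reindex_bij_witness[of _ \<phi> \<phi>]) (use \<phi> in \<open>auto simp: \<phi>_def o_def\<close>)
  also have "\<dots> = (\<Sum>ga\<in>Bad. - f ga)"
  proof (rule sum.cong[OF refl])
    fix ga assume ga: "ga \<in> Bad"
    have "transpose (i0 ga) (Suc (i0 ga)) permutes {..<l}"
      using i0[OF ga] by (intro permutes_swap_id) auto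
    then have "sum (\<phi> ga) {..<l} = sum ga {..<l}"
      using sum.permute[of "transpose (i0 ga) (Suc (i0 ga))" "{..<l}" ga] by (simp add: \<phi>_def)
    then show "f (\<phi> ga) = - f ga"
      using jacobi_trudi_swap[OF i0(1)[OF ga], of 0 n ga c] by (simp add: f_def \<phi>_def)
  qed
  \<comment> \<open>The sum equals its own negative, hence is 0 in characteristic 0.\<close>
  finally have "sum f Bad = 0"
    by (simp add: sum_negf)
  moreover have "PiE {..<l} (\<lambda>i. {..be i}) = interlacing l be \<union> Bad"
    by (auto simp: interlacing_def Bad_def not_less)
  moreover have "interlacing l be \<inter> Bad = {}"
    by (auto simp: interlacing_def Bad_def not_less)
  moreover have "finite Bad"
    by (rule finite_subset[of _ "PiE {..<l} (\<lambda>i. {..be i})"]) (auto simp: Bad_def intro: finite_PiE)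
  ultimately have "sum f (PiE {..<l} (\<lambda>i. {..be i})) = sum f (interlacing l be)"
    by (simp add: sum.union_disjoint finite_interlacing)
  then show ?thesis
    unfolding jacobi_trudi_Suc f_def .
qed

text \<open>Because both sequences decrease, the whole block of rows from k on and columns up to k
  vanishes, and no permutation can avoid a block of this size.\<close>

lemma jacobi_trudi_eq_0:
  assumes be: "\<And>i j. i \<le> j \<Longrightarrow> j < l \<Longrightarrow> be j \<le> be i"
    and c: "\<And>i j. i \<le> j \<Longrightarrow> j < l \<Longrightarrow> c j \<le> c i"
    and k: "k < l" "be k < c k"
  shows "jacobi_trudi s l n be c = 0"
  unfolding jacobi_trudi_def
proof (rule sum.neutral, clarify)
  fix \<sigma> assume \<sigma>: "\<sigma> permutes {..<l}"
  \<comment> \<open>The l - k rows from k on cannot be mapped injectively into the l - k - 1 columns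
    after k.\<close>
  have "\<exists>i\<in>{k..<l}. \<sigma> i \<le> k"
  proof (rule ccontr)
    assume "\<not> ?thesis"
    then have "\<sigma> ` {k..<l} \<subseteq> {Suc k..<l}"
      using permutes_in_image[OF \<sigma>] by (auto simp: not_le)
    then have "card (\<sigma> ` {k..<l}) \<le> l - Suc k"
      using card_mono[of "{Suc k..<l}"] by simp
    moreover have "card (\<sigma> ` {k..<l}) = l - k"
      using permutes_inj_on[OF \<sigma>] by (simp add: card_image)
    ultimately show False
      using k by simp
  qed
  then obtain i where i: "k \<le> i" "i < l" "\<sigma> i \<le> k" by auto
  have "be i < c (\<sigma> i)"
    using be[OF i(1,2)] c[OF i(3) k(1)] k(2) by simp
  then have "jt_entry s n (be i) (c (\<sigma> i)) = 0"
    by (simp add: jt_entry_def)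
  then have "(\<Prod>i<l. jt_entry s n (be i) (c (\<sigma> i))) = 0"
    using i by (intro prod_zero) auto
  then show "of_int (sign \<sigma>) * (\<Prod>i<l. jt_entry s n (be i) (c (\<sigma> i))) = 0"
    by simp
qed

lemma jacobi_trudi_0_self:
  assumes "\<And>i. i < l \<Longrightarrow> be i = c i" "inj_on c {..<l}"
  shows "jacobi_trudi s l 0 be c = 1"
proof -
  have "jacobi_trudi s l 0 be c = (\<Sum>\<sigma>\<in>{id}. of_int (sign \<sigma>) * (\<Prod>i<l. jt_entry s 0 (be i) (c (\<sigma> i))))"
    unfolding jacobi_trudi_def
  proof (rule sum.mono_neutral_right)
    show "\<forall>\<sigma>\<in>{\<sigma>. \<sigma> permutes {..<l}} - {id}. of_int (sign \<sigma>) * (\<Prod>i<l. jt_entry s 0 (be i) (c (\<sigma> i))) = 0"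
    proof
      fix \<sigma> assume "\<sigma> \<in> {\<sigma>. \<sigma> permutes {..<l}} - {id}"
      then have \<sigma>: "\<sigma> permutes {..<l}" "\<sigma> \<noteq> id" by auto
      then obtain i where i: "\<sigma> i \<noteq> i" by (auto simp: fun_eq_iff)
      then have "i < l"
        using \<sigma>(1) by (metis lessThan_iff permutes_not_in)
      moreover from this have "\<sigma> i < l"
        using permutes_in_image[OF \<sigma>(1)] by simp
      ultimately have "c i \<noteq> c (\<sigma> i)"
        using assms(2) i by (auto dest: inj_onD)
      then have "(\<Prod>i<l. jt_entry s 0 (be i) (c (\<sigma> i))) = 0"
        using assms(1) \<open>i < l\<close> by (intro prod_zero bexI[of _ i]) (auto simp: jt_entry_0)
      then show "of_int (sign \<sigma>) * (\<Prod>i<l. jt_entry s 0 (be i) (c (\<sigma> i))) = 0" by simp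
    qed
  qed (auto simp: finite_permutations permutes_id)
  also have "\<dots> = 1"
    using assms(1) by (simp add: jt_entry_0 sign_id)
  finally show ?thesis .
qed

lemma jacobi_trudi_0_eq_0:
  assumes "sum be {..<l} \<noteq> sum c {..<l}"
  shows "jacobi_trudi s l 0 be c = 0"
  unfolding jacobi_trudi_def
proof (rule sum.neutral, clarify)
  fix \<sigma> assume \<sigma>: "\<sigma> permutes {..<l}"
  have "\<exists>i<l. be i \<noteq> c (\<sigma> i)"
  proof (rule ccontr)
    assume "\<not> ?thesis"
    then have "sum be {..<l} = (\<Sum>i<l. c (\<sigma> i))"
      by (intro sum.cong) auto
    then show False
      using sum.permute[OF \<sigma>, of c] assms by (simp add: o_def)
  qed
  then have "(\<Prod>i<l. jt_entry s 0 (be i) (c (\<sigma> i))) = 0"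
    by (intro prod_zero) (auto simp: jt_entry_0)
  then show "of_int (sign \<sigma>) * (\<Prod>i<l. jt_entry s 0 (be i) (c (\<sigma> i))) = 0"
    by simp
qed

section \<open>Semistandard tableaux and removal of the largest entry\<close>

definition fdiag :: "(nat \<Rightarrow> nat) \<Rightarrow> (nat \<Rightarrow> nat) \<Rightarrow> (nat \<times> nat) set" where
  "fdiag a b = {(i, j). b i \<le> j \<and> j < a i}"

text \<open>Shapes are functions rather than lists here, so that the shape left after deleting a
  horizontal strip needs no trimming of zeros.\<close>

definition fssyt :: "(nat \<Rightarrow> nat) \<Rightarrow> (nat \<Rightarrow> nat) \<Rightarrow> nat \<Rightarrow> (nat \<times> nat \<Rightarrow> nat) set" where
  "fssyt a b n =
     {T \<in> fdiag a b \<rightarrow>\<^sub>E {..<n}.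
        (\<forall>i j j'. (i, j) \<in> fdiag a b \<and> (i, j') \<in> fdiag a b \<and> j < j' \<longrightarrow> T (i, j) \<le> T (i, j')) \<and>
        (\<forall>i i' j. (i, j) \<in> fdiag a b \<and> (i', j) \<in> fdiag a b \<and> i < i' \<longrightarrow> T (i, j) < T (i', j))}"

lemma skew_diagram_fdiag: "skew_diagram lam mu = fdiag (part lam) (part mu)"
  by (simp add: skew_diagram_def fdiag_def)

lemma ssyt_fssyt: "ssyt lam mu n = fssyt (part lam) (part mu) n"
  by (simp add: ssyt_def fssyt_def skew_diagram_fdiag)

definition horizontal_strips :: "(nat \<Rightarrow> nat) \<Rightarrow> (nat \<Rightarrow> nat) set" where
  "horizontal_strips a = {r. (\<forall>i. a (Suc i) \<le> r i \<and> r i \<le> a i)}"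

text \<open>The entries below n fill an initial piece of each row, and this is where it ends. The
  alternative \<open>a i \<le> j\<close> supplies a value when the row contains no n.\<close>

definition inner_shape :: "(nat \<Rightarrow> nat) \<Rightarrow> (nat \<Rightarrow> nat) \<Rightarrow> nat \<Rightarrow> (nat \<times> nat \<Rightarrow> nat) \<Rightarrow> nat \<Rightarrow> nat" where
  "inner_shape a b n T i = (LEAST j. b i \<le> j \<and> (a i \<le> j \<or> n \<le> T (i, j)))"

definition extend_tableau :: "(nat \<Rightarrow> nat) \<Rightarrow> (nat \<Rightarrow> nat) \<Rightarrow> nat \<Rightarrow> (nat \<Rightarrow> nat) \<Rightarrow> (nat \<times> nat \<Rightarrow> nat) \<Rightarrow> nat \<times> nat \<Rightarrow> nat" where
  "extend_tableau a b n r T c = (if c \<in> fdiag a b then if c \<in> fdiag r b then T c else n else undefined)"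

text \<open>A horizontal strip has at most one cell per column, so it may be filled with a new
  largest letter n. The last two claims say that deleting the letter undoes this.\<close>

lemma fssyt_extend:
  assumes a: "antimono a" and ba: "\<And>i. b i \<le> a i"
    and r: "r \<in> horizontal_strips a" "\<And>i. b i \<le> r i"
    and T: "T \<in> fssyt r b n"
  shows "extend_tableau a b n r T \<in> fssyt a b (Suc n)"
    and "inner_shape a b n (extend_tableau a b n r T) = r"
    and "restrict (extend_tableau a b n r T) (fdiag r b) = T"
proof -
  let ?E = "extend_tableau a b n r T"
  have r1: "a (Suc i) \<le> r i" "r i \<le> a i" for i
    using r(1) by (auto simp: horizontal_strips_def)
  have r2: "a i' \<le> r i" if "i < i'" for i i'
    using r1(1)[of i] antimonoD[OF a, of "Suc i" i'] that by simp
  have sub: "fdiag r b \<subseteq> fdiag a b"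
    using r1(2) by (auto simp: fdiag_def intro: order.strict_trans2)
  have T1: "T c < n" if "c \<in> fdiag r b" for c
    using T that by (auto simp: fssyt_def)
  have T2: "T (i, j) \<le> T (i, j')" if "(i, j) \<in> fdiag r b" "(i, j') \<in> fdiag r b" "j < j'" for i j j'
    using T that by (auto simp: fssyt_def)
  have T3: "T (i, j) < T (i', j)" if "(i, j) \<in> fdiag r b" "(i', j) \<in> fdiag r b" "i < i'" for i i' j
    using T that by (auto simp: fssyt_def)
  have "?E \<in> fdiag a b \<rightarrow>\<^sub>E {..<Suc n}"
    using T1 by (auto simp: extend_tableau_def less_Suc_eq)
  moreover have "?E (i, j) \<le> ?E (i, j')" if "(i, j) \<in> fdiag a b" "(i, j') \<in> fdiag a b" "j < j'" for i j j'
    using that T1[of "(i, j)"] T2[of i j j'] by (auto simp: extend_tableau_def fdiag_def)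
  moreover have "?E (i, j) < ?E (i', j)" if "(i, j) \<in> fdiag a b" "(i', j) \<in> fdiag a b" "i < i'" for i i' j
    using that T1[of "(i, j)"] T3[of i j i'] r2[of i i'] by (auto simp: extend_tableau_def fdiag_def)
  ultimately show "?E \<in> fssyt a b (Suc n)"
    unfolding fssyt_def by blast
  show "inner_shape a b n ?E = r"
  proof
    fix i show "inner_shape a b n ?E i = r i"
      unfolding inner_shape_def
    proof (rule Least_equality)
      show "b i \<le> r i \<and> (a i \<le> r i \<or> n \<le> ?E (i, r i))"
        using r(2)[of i] by (auto simp: extend_tableau_def fdiag_def)
      fix j assume j: "b i \<le> j \<and> (a i \<le> j \<or> n \<le> ?E (i, j))"
      show "r i \<le> j"
      proof (rule ccontr)
        assume "\<not> r i \<le> j"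
        then have "(i, j) \<in> fdiag r b" "j < a i"
          using j r1(2)[of i] by (auto simp: fdiag_def)
        then show False
          using T1[of "(i, j)"] sub j by (auto simp: extend_tableau_def)
      qed
    qed
  qed
  show "restrict ?E (fdiag r b) = T"
  proof
    fix c show "restrict ?E (fdiag r b) c = T c"
    proof (cases "c \<in> fdiag r b")
      case True
      then show ?thesis using sub by (auto simp: extend_tableau_def)
    next
      case False
      then have "T c = undefined"
        using T by (cases c) (auto simp: fssyt_def PiE_def extensional_def)
      then show ?thesis using False by simp
    qed
  qed
qed

text \<open>The converse direction: weakly increasing rows make the cells with n a tail of each row,
  and strictly increasing columns make these tails a horizontal strip.\<close>

lemma fssyt_inner:
  assumes a: "antimono a" and b: "antimono b" and ba: "\<And>i. b i \<le> a i"
    and T: "T \<in> fssyt a b (Suc n)"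
  defines "r \<equiv> inner_shape a b n T"
  shows "r \<in> horizontal_strips a" and "b i \<le> r i"
    and "restrict T (fdiag r b) \<in> fssyt r b n"
    and "extend_tableau a b n r (restrict T (fdiag r b)) = T"
proof -
  have T1: "T c < Suc n" if "c \<in> fdiag a b" for c
    using T that by (auto simp: fssyt_def)
  have T2: "T (i, j) \<le> T (i, j')" if "(i, j) \<in> fdiag a b" "(i, j') \<in> fdiag a b" "j < j'" for i j j'
    using T that by (auto simp: fssyt_def)
  have T3: "T (i, j) < T (i', j)" if "(i, j) \<in> fdiag a b" "(i', j) \<in> fdiag a b" "i < i'" for i i' j
    using T that by (auto simp: fssyt_def)
  have r: "b i \<le> r i \<and> (a i \<le> r i \<or> n \<le> T (i, r i))" for i
    unfolding r_def inner_shape_def by (rule LeastI[of _ "a i"]) (simp add: ba)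
  have r_le: "r i \<le> j" if "b i \<le> j" "a i \<le> j \<or> n \<le> T (i, j)" for i j
    unfolding r_def inner_shape_def using that by (intro Least_le) simp
  have r_le_a: "r i \<le> a i" for i
    by (rule r_le) (simp_all add: ba)
  have key: "T (i, j) < n \<longleftrightarrow> j < r i" if "(i, j) \<in> fdiag a b" for i j
  proof
    assume "T (i, j) < n"
    show "j < r i"
    proof (rule ccontr)
      assume "\<not> j < r i"
      then have "(i, r i) \<in> fdiag a b" "n \<le> T (i, r i)" "r i \<le> j"
        using that r[of i] by (auto simp: fdiag_def)
      then show False
        using T2[of i "r i" j] that \<open>T (i, j) < n\<close> by (cases "r i = j") auto
    qed
  next
    assume "j < r i"
    then show "T (i, j) < n"
      using r_le[of i j] that by (auto simp: fdiag_def not_le[symmetric])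
  qed
  show b_le: "b i \<le> r i" for i
    using r by blast
  have sub: "fdiag r b \<subseteq> fdiag a b"
    using r_le_a by (auto simp: fdiag_def intro: order.strict_trans2)
  have "a (Suc i) \<le> r i" for i
  proof (rule ccontr)
    assume *: "\<not> a (Suc i) \<le> r i"
    \<comment> \<open>Otherwise the cell (i, r i) carries n and the cell below it exists, so the
      entry there would exceed n.\<close>
    then have i: "(i, r i) \<in> fdiag a b" "(Suc i, r i) \<in> fdiag a b"
      using b_le[of i] antimonoD[OF a, of i "Suc i"] antimonoD[OF b, of i "Suc i"] by (auto simp: fdiag_def)
    then show False
      using key[OF i(1)] T3[OF i] T1[OF i(2)] by simp
  qed
  then show "r \<in> horizontal_strips a"
    using r_le_a by (simp add: horizontal_strips_def)
  have lt: "T (i, j) < n" if "(i, j) \<in> fdiag r b" for i j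
    using key[of i j] that sub by (auto simp: fdiag_def)
  show "restrict T (fdiag r b) \<in> fssyt r b n"
    unfolding fssyt_def using lt T2 T3 sub by (auto simp: subset_iff)
  show "extend_tableau a b n r (restrict T (fdiag r b)) = T"
  proof
    fix c :: "nat \<times> nat"
    obtain i j where c: "c = (i, j)" by (cases c)
    show "extend_tableau a b n r (restrict T (fdiag r b)) c = T c"
    proof (cases "c \<in> fdiag a b")
      case True
      have "T c = n" if "c \<notin> fdiag r b"
        using that key[of i j] T1[OF True] True by (auto simp: c fdiag_def)
      then show ?thesis
        using True by (auto simp: extend_tableau_def)
    next
      case False
      then have "T c = undefined"
        using T by (auto simp: fssyt_def PiE_def extensional_def c)
      then show ?thesis
        using False by (simp add: extend_tableau_def)
    qed
  qed
qed

lemma finite_fdiag: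
  assumes "\<And>i. l \<le> i \<Longrightarrow> a i = 0"
  shows "finite (fdiag a b)"
proof (rule finite_subset)
  show "fdiag a b \<subseteq> Sigma {..<l} (\<lambda>i. {..<a i})"
  proof
    fix c assume "c \<in> fdiag a b"
    then obtain i j where c: "c = (i, j)" "b i \<le> j" "j < a i"
      by (auto simp: fdiag_def)
    then have "i < l"
      using assms[of i] by (cases "i < l") auto
    then show "c \<in> Sigma {..<l} (\<lambda>i. {..<a i})"
      using c by simp
  qed
qed auto

lemma finite_fssyt: "finite (fdiag a b) \<Longrightarrow> finite (fssyt a b n)"
  by (rule finite_subset[of _ "fdiag a b \<rightarrow>\<^sub>E {..<n}"]) (auto simp: fssyt_def intro: finite_PiE)

lemma fdiag_weight:
  fixes y :: "nat \<Rightarrow> 'a::comm_semiring_1"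
  assumes fin: "\<And>i. l \<le> i \<Longrightarrow> a i = 0" and r: "r \<in> horizontal_strips a" "\<And>i. b i \<le> r i"
  shows "(\<Prod>c\<in>fdiag a b. y (extend_tableau a b n r T c)) =
    y n ^ (sum a {..<l} - sum r {..<l}) * (\<Prod>c\<in>fdiag r b. y (T c))"
proof -
  have r_le: "r i \<le> a i" for i
    using r by (simp add: horizontal_strips_def)
  have "(i, j) \<in> fdiag a b \<longleftrightarrow> (i, j) \<in> fdiag a r \<union> fdiag r b" for i j
    using r(2)[of i] r_le[of i] by (auto simp: fdiag_def)
  then have un: "fdiag a b = fdiag a r \<union> fdiag r b"
    by auto
  have dj: "fdiag a r \<inter> fdiag r b = {}"
    by (auto simp: fdiag_def)
  have "fdiag a r = Sigma {..<l} (\<lambda>i. {r i..<a i})"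
  proof -
    have "i < l" if "r i \<le> j" "j < a i" for i j
      using that fin[of i] by (cases "i < l") auto
    then show ?thesis by (auto simp: fdiag_def)
  qed
  then have "card (fdiag a r) = (\<Sum>i<l. a i - r i)"
    by simp
  also have "\<dots> = sum a {..<l} - sum r {..<l}"
    using r_le by (simp add: sum_subtractf_nat)
  finally have card: "card (fdiag a r) = sum a {..<l} - sum r {..<l}" .
  have "finite (fdiag a b)"
    by (rule finite_fdiag[OF fin])
  then have "(\<Prod>c\<in>fdiag a b. y (extend_tableau a b n r T c)) =
      (\<Prod>c\<in>fdiag a r. y (extend_tableau a b n r T c)) * (\<Prod>c\<in>fdiag r b. y (extend_tableau a b n r T c))"
    using dj unfolding un by (intro prod.union_disjoint) auto
  moreover have "(\<Prod>c\<in>fdiag a r. y (extend_tableau a b n r T c)) = (\<Prod>c\<in>fdiag a r. y n)"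
    using un dj by (intro prod.cong) (auto simp: extend_tableau_def)
  moreover have "(\<Prod>c\<in>fdiag r b. y (extend_tableau a b n r T c)) = (\<Prod>c\<in>fdiag r b. y (T c))"
    using un by (intro prod.cong) (auto simp: extend_tableau_def)
  ultimately show ?thesis
    by (simp add: card)
qed

definition fschur :: "(nat \<Rightarrow> nat) \<Rightarrow> (nat \<Rightarrow> nat) \<Rightarrow> nat \<Rightarrow> xfrac" where
  "fschur a b n = (\<Sum>T\<in>fssyt a b n. \<Prod>c\<in>fdiag a b. xvar (T c))"

lemma skew_schur_fschur: "skew_schur lam mu n = fschur (part lam) (part mu) n"
  by (simp add: skew_schur_def fschur_def ssyt_fssyt skew_diagram_fdiag)

lemma horizontal_strips_supp: "r \<in> horizontal_strips a \<Longrightarrow> (\<And>i. l \<le> i \<Longrightarrow> a i = 0) \<Longrightarrow> l \<le> i \<Longrightarrow> r i = 0"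
  by (metis (mono_tags, lifting) horizontal_strips_def le_zero_eq mem_Collect_eq)

lemma finite_horizontal_strips:
  assumes fin: "\<And>i. l \<le> i \<Longrightarrow> a i = 0"
  shows "finite (horizontal_strips a)"
proof (rule finite_imageD)
  let ?f = "\<lambda>r. restrict r {..<l}"
  show "finite (?f ` horizontal_strips a)"
    by (rule finite_subset[of _ "PiE {..<l} (\<lambda>i. {..a i})"])
       (auto simp: horizontal_strips_def intro!: finite_PiE split: if_splits)
  show "inj_on ?f (horizontal_strips a)"
  proof (rule inj_onI, rule ext)
    fix r r' i assume r: "r \<in> horizontal_strips a" "r' \<in> horizontal_strips a" "?f r = ?f r'"
    show "r i = r' i"
      using fun_cong[OF r(3), of i] horizontal_strips_supp[OF r(1) fin, of i] horizontal_strips_supp[OF r(2) fin, of i]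
      by (cases "i < l") auto
  qed
qed

text \<open>Branching rule: a tableau is determined by the strip of its largest letter together with
  the tableau that remains.\<close>

lemma fschur_Suc:
  assumes a: "antimono a" and b: "antimono b" and ba: "\<And>i. b i \<le> a i" and fin: "\<And>i. l \<le> i \<Longrightarrow> a i = 0"
  shows "fschur a b (Suc n) =
    (\<Sum>r | r \<in> horizontal_strips a \<and> (\<forall>i. b i \<le> r i). xvar n ^ (sum a {..<l} - sum r {..<l}) * fschur r b n)"
proof -
  let ?H = "{r. r \<in> horizontal_strips a \<and> (\<forall>i. b i \<le> r i)}"
  let ?S = "Sigma ?H (\<lambda>r. fssyt r b n)"
  have "fschur a b (Suc n) =
      (\<Sum>(r, T)\<in>?S. xvar n ^ (sum a {..<l} - sum r {..<l}) * (\<Prod>c\<in>fdiag r b. xvar (T c)))"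
    unfolding fschur_def
  proof (rule sum.reindex_bij_witness[of _ "\<lambda>(r, T). extend_tableau a b n r T"
        "\<lambda>T. (inner_shape a b n T, restrict T (fdiag (inner_shape a b n T) b))"], goal_cases)
    case (1 T)
    then show ?case
      using fssyt_inner(4)[OF a b ba 1] by simp
  next
    case (2 T)
    then show ?case
      using fssyt_inner(1-3)[OF a b ba 2] by simp
  next
    case (3 p)
    then show ?case
      using fssyt_extend(2,3)[OF a ba, of "fst p" "snd p" n] by auto
  next
    case (4 p)
    then show ?case
      using fssyt_extend(1)[OF a ba, of "fst p" "snd p" n] by auto
  next
    case (5 T)
    note i = fssyt_inner[OF a b ba 5]
    show ?case
      using fdiag_weight[OF fin i(1,2), where y = xvar and T = "restrict T (fdiag (inner_shape a b n T) b)" and n = n]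
      unfolding i(4) by simp
  qed
  also have "\<dots> = (\<Sum>r\<in>?H. \<Sum>T\<in>fssyt r b n. xvar n ^ (sum a {..<l} - sum r {..<l}) * (\<Prod>c\<in>fdiag r b. xvar (T c)))"
  proof (rule sum.Sigma[symmetric])
    show "finite ?H"
      using finite_horizontal_strips[OF fin] by simp
    show "\<forall>r\<in>?H. finite (fssyt r b n)"
    proof
      fix r assume "r \<in> ?H"
      then have "r i = 0" if "l \<le> i" for i
        using that by (auto intro: horizontal_strips_supp fin)
      then show "finite (fssyt r b n)"
        by (intro finite_fssyt finite_fdiag)
    qed
  qed
  finally show ?thesis
    by (simp add: fschur_def sum_distrib_left)
qed

lemma fschur_0:
  assumes "\<And>i. b i \<le> a i"
  shows "fschur a b 0 = (if a = b then 1 else 0)"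
proof (cases "a = b")
  case True
  then have "fdiag a b = {}"
    by (auto simp: fdiag_def)
  then show ?thesis
    using True by (simp add: fschur_def fssyt_def)
next
  case False
  then obtain i where "a i \<noteq> b i" by auto
  then have "(i, b i) \<in> fdiag a b"
    using assms[of i] by (simp add: fdiag_def)
  then have "fssyt a b 0 = {}"
    by (auto simp: fssyt_def)
  then show ?thesis
    using False by (simp add: fschur_def)
qed

text \<open>Adding the staircase turns the weak inequality a (i + 1) \<le> r i into the strict one
  of \<open>interlacing\<close>. The last row has no lower bound there, in accordance with a l =
  0.\<close>

lemma bij_betw_strips_interlacing:
  assumes fin: "\<And>i. l \<le> i \<Longrightarrow> a i = 0"
  shows "bij_betw (\<lambda>r. restrict (\<lambda>i. r i + (l - Suc i)) {..<l}) (horizontal_strips a)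
    (interlacing l (\<lambda>i. a i + (l - Suc i)))"
proof (rule bij_betw_byWitness[where f' = "\<lambda>ga i. if i < l then ga i - (l - Suc i) else 0"])
  let ?f = "\<lambda>r. restrict (\<lambda>i. r i + (l - Suc i)) {..<l}"
  let ?g = "\<lambda>ga i. if i < l then ga i - (l - Suc i) else (0::nat)"
  have ge: "a (Suc i) + (l - Suc i) \<le> ga i" if "ga \<in> interlacing l (\<lambda>i. a i + (l - Suc i))" "i < l" for ga i
  proof (cases "Suc i < l")
    case True
    then have "a (Suc i) + (l - Suc (Suc i)) < ga i"
      using that by (auto simp: interlacing_def)
    then show ?thesis using True by simp
  next
    case False
    then show ?thesis using fin[of "Suc i"] that by simp
  qed
  have le: "ga i \<le> a i + (l - Suc i)" if "ga \<in> interlacing l (\<lambda>i. a i + (l - Suc i))" "i < l" for ga i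
    using PiE_mem[of ga "{..<l}" "\<lambda>i. {..a i + (l - Suc i)}" i] that by (simp add: interlacing_def)
  show "\<forall>r\<in>horizontal_strips a. ?g (?f r) = r"
  proof
    fix r assume "r \<in> horizontal_strips a"
    then show "?g (?f r) = r"
      using horizontal_strips_supp[OF _ fin, of r] by (auto simp: fun_eq_iff)
  qed
  show "\<forall>ga\<in>interlacing l (\<lambda>i. a i + (l - Suc i)). ?f (?g ga) = ga"
  proof
    fix ga assume ga: "ga \<in> interlacing l (\<lambda>i. a i + (l - Suc i))"
    show "?f (?g ga) = ga"
    proof
      fix i show "?f (?g ga) i = ga i"
      proof (cases "i < l")
        case True
        then show ?thesis using ge[OF ga True] by simp
      next
        case False
        then show ?thesis using ga by (auto simp: interlacing_def PiE_def extensional_def)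
      qed
    qed
  qed
  show "?f ` horizontal_strips a \<subseteq> interlacing l (\<lambda>i. a i + (l - Suc i))"
  proof clarify
    fix r assume r: "r \<in> horizontal_strips a"
    have r': "a (Suc i) \<le> r i" "r i \<le> a i" for i
      using r by (auto simp: horizontal_strips_def)
    have "a (Suc i) + (l - Suc (Suc i)) < r i + (l - Suc i)" if "Suc i < l" for i
      using r'(1)[of i] that by simp
    moreover have "r i + (l - Suc i) \<le> a i + (l - Suc i)" for i
      using r'(2)[of i] by simp
    ultimately show "?f r \<in> interlacing l (\<lambda>i. a i + (l - Suc i))"
      unfolding interlacing_def by (simp add: restrict_PiE_iff del: add_diff_assoc Nat.add_diff_assoc)
  qed
  show "?g ` interlacing l (\<lambda>i. a i + (l - Suc i)) \<subseteq> horizontal_strips a"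
  proof clarify
    fix ga assume ga: "ga \<in> interlacing l (\<lambda>i. a i + (l - Suc i))"
    show "?g ga \<in> horizontal_strips a"
      unfolding horizontal_strips_def
    proof (intro CollectI allI)
      fix i show "a (Suc i) \<le> ?g ga i \<and> ?g ga i \<le> a i"
        using ge[OF ga, of i] le[OF ga, of i] fin[of "Suc i"] by (cases "i < l") auto
    qed
  qed
qed

text \<open>Both sides obey the same recursion in n, obtained by splitting off x_n. On the
  determinant side strips that do not contain b survive the cancellation, but their determinants
  vanish by \<open>jacobi_trudi_eq_0\<close>. With no variables both sides detect whether a =
  b.\<close>

lemma fschur_jacobi_trudi:
  assumes "antimono a" "antimono b" "\<And>i. b i \<le> a i" "\<And>i. l \<le> i \<Longrightarrow> a i = 0"
  shows "fschur a b n = jacobi_trudi 0 l n (\<lambda>i. a i + (l - Suc i)) (\<lambda>i. b i + (l - Suc i))"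
  using assms
proof (induction n arbitrary: a)
  case 0
  show ?case
  proof (cases "a = b")
    case True
    have "inj_on (\<lambda>i. b i + (l - Suc i)) {..<l}"
    proof (rule linorder_inj_onI)
      fix i j assume "i < j" "j \<in> {..<l}"
      then show "b i + (l - Suc i) \<noteq> b j + (l - Suc j)"
        using antimonoD[OF 0(2), of i j] by simp
    qed auto
    then have "jacobi_trudi 0 l 0 (\<lambda>i. b i + (l - Suc i)) (\<lambda>i. b i + (l - Suc i)) = 1"
      by (intro jacobi_trudi_0_self) auto
    then show ?thesis
      using True by (simp add: fschur_0)
  next
    case False
    then obtain k where k: "a k \<noteq> b k" by auto
    then have "b k < a k" using 0(3)[of k] by simp
    then have "k < l" using 0(4)[of k] by (cases "k < l") auto
    then have "sum b {..<l} < sum a {..<l}"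
      using 0(3) \<open>b k < a k\<close> by (intro sum_strict_mono_ex1) auto
    then have "jacobi_trudi 0 l 0 (\<lambda>i. a i + (l - Suc i)) (\<lambda>i. b i + (l - Suc i)) = 0"
      by (intro jacobi_trudi_0_eq_0) (unfold sum.distrib, simp)
    then show ?thesis
      using False 0(3) by (simp add: fschur_0)
  qed
next
  case (Suc n)
  note a = Suc.prems(1) and b = Suc.prems(2) and ba = Suc.prems(3) and fin = Suc.prems(4)
  let ?c = "\<lambda>i. b i + (l - Suc i)"
  have strip: "antimono r" if "r \<in> horizontal_strips a" for r
  proof (rule decseq_SucI)
    fix i show "r (Suc i) \<le> r i"
      using that by (auto simp: horizontal_strips_def intro: order.trans)
  qed
  have dec: "antimono (\<lambda>i. r i + (l - Suc i))" if "antimono r" for r :: "nat \<Rightarrow> nat"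
    using that by (auto simp: antimono_def intro!: add_mono)
  have zero: "jacobi_trudi 0 l n (\<lambda>i. r i + (l - Suc i)) ?c = 0" if r: "r \<in> horizontal_strips a" "\<not> (\<forall>i. b i \<le> r i)" for r
  proof -
    obtain k where k: "r k < b k" using r(2) by (auto simp: not_le)
    then have "k < l" using ba[of k] fin[of k] by (cases "k < l") auto
    show ?thesis
    proof (rule jacobi_trudi_eq_0[where k = k])
      fix i j :: nat assume "i \<le> j"
      then show "r j + (l - Suc j) \<le> r i + (l - Suc i)" "b j + (l - Suc j) \<le> b i + (l - Suc i)"
        by (rule antimonoD[OF dec[OF strip[OF r(1)]]], rule antimonoD[OF dec[OF b]])
    next
      show "k < l" by fact
      show "r k + (l - Suc k) < b k + (l - Suc k)"
        using k by simp
    qed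
  qed
  have bij: "bij_betw (\<lambda>r. restrict (\<lambda>i. r i + (l - Suc i)) {..<l}) (horizontal_strips a)
      (interlacing l (\<lambda>i. a i + (l - Suc i)))"
    by (rule bij_betw_strips_interlacing) (fact fin)
  have "jacobi_trudi 0 l (Suc n) (\<lambda>i. a i + (l - Suc i)) ?c =
      (\<Sum>ga\<in>interlacing l (\<lambda>i. a i + (l - Suc i)).
         xvar n ^ ((\<Sum>i<l. a i + (l - Suc i)) - sum ga {..<l}) * jacobi_trudi 0 l n ga ?c)"
  proof (rule jacobi_trudi_Suc_interlacing)
    fix i assume "Suc i < l"
    then show "a (Suc i) + (l - Suc (Suc i)) < a i + (l - Suc i)"
      using antimonoD[OF a, of i "Suc i"] by simp
  qed
  also have "\<dots> = (\<Sum>r\<in>horizontal_strips a.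
      xvar n ^ (sum a {..<l} - sum r {..<l}) * jacobi_trudi 0 l n (\<lambda>i. r i + (l - Suc i)) ?c)"
  proof (rule trans[OF sum.reindex_bij_betw[OF bij, symmetric] sum.cong[OF refl]])
    fix r
    have "jacobi_trudi 0 l n (restrict (\<lambda>i. r i + (l - Suc i)) {..<l}) ?c = jacobi_trudi 0 l n (\<lambda>i. r i + (l - Suc i)) ?c"
      by (rule jacobi_trudi_cong) simp
    moreover have "(\<Sum>i<l. a i + (l - Suc i)) - sum (restrict (\<lambda>i. r i + (l - Suc i)) {..<l}) {..<l} = sum a {..<l} - sum r {..<l}"
      by (simp add: sum.distrib del: add_diff_assoc Nat.add_diff_assoc)
    ultimately show "xvar n ^ ((\<Sum>i<l. a i + (l - Suc i)) - sum (restrict (\<lambda>i. r i + (l - Suc i)) {..<l}) {..<l}) *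
        jacobi_trudi 0 l n (restrict (\<lambda>i. r i + (l - Suc i)) {..<l}) ?c =
        xvar n ^ (sum a {..<l} - sum r {..<l}) * jacobi_trudi 0 l n (\<lambda>i. r i + (l - Suc i)) ?c"
      by simp
  qed
  also have "\<dots> = (\<Sum>r | r \<in> horizontal_strips a \<and> (\<forall>i. b i \<le> r i).
      xvar n ^ (sum a {..<l} - sum r {..<l}) * jacobi_trudi 0 l n (\<lambda>i. r i + (l - Suc i)) ?c)"
    using finite_horizontal_strips[OF fin] zero by (intro sum.mono_neutral_right) auto
  also have "\<dots> = (\<Sum>r | r \<in> horizontal_strips a \<and> (\<forall>i. b i \<le> r i).
      xvar n ^ (sum a {..<l} - sum r {..<l}) * fschur r b n)"
  proof (intro sum.cong refl arg_cong2[where f = "(*)"])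
    fix r assume r: "r \<in> {r. r \<in> horizontal_strips a \<and> (\<forall>i. b i \<le> r i)}"
    show "jacobi_trudi 0 l n (\<lambda>i. r i + (l - Suc i)) ?c = fschur r b n"
      by (rule Suc.IH[symmetric]) (use r strip b horizontal_strips_supp[OF _ fin] in auto)
  qed
  also have "\<dots> = fschur a b (Suc n)"
    by (rule fschur_Suc[OF a b ba fin, symmetric])
  finally show ?case ..
qed

section \<open>Power sums and the substitution\<close>

text \<open>Meaningful only on \<open>range to_fract\<close>; elsewhere \<open>inv\<close> gives an
  unspecified value. This is why polynomiality has to be proved before monomials are
  compared.\<close>

definition xcoeff :: "xfrac \<Rightarrow> (nat \<Rightarrow>\<^sub>0 nat) \<Rightarrow> qt" where
  "xcoeff f = Poly_Mapping.lookup (inv to_fract f)"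

lemma inj_to_fract: "inj to_fract"
  by (simp add: inj_def)

lemma xcoeff_to_fract [simp]: "xcoeff (to_fract p) = Poly_Mapping.lookup p"
  by (simp add: xcoeff_def inv_f_f inj_to_fract)

lemma lookup_single_0_mult: "Poly_Mapping.lookup (Poly_Mapping.single 0 c * p) a = c * Poly_Mapping.lookup p a"
  for c :: "'a::semiring_0" and a :: "'b::monoid_add"
  by (auto simp: Poly_Mapping.map.rep_eq when_def simp flip: mult_map_scale_conv_mult)

lemma xcoeff_lincomb:
  assumes "\<And>i. i \<in> S \<Longrightarrow> f i \<in> range to_fract"
  shows "xcoeff (\<Sum>i\<in>S. scalar (c i) * f i) a = (\<Sum>i\<in>S. c i * xcoeff (f i) a)"
proof -
  have "\<forall>i\<in>S. \<exists>p. f i = to_fract p" using assms by blast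
  then obtain p where p: "\<And>i. i \<in> S \<Longrightarrow> f i = to_fract (p i)" by metis
  then have eq: "(\<Sum>i\<in>S. scalar (c i) * f i) = to_fract (\<Sum>i\<in>S. Poly_Mapping.single 0 (c i) * p i)"
    by (simp add: to_fract_sum scalar_def)
  show ?thesis
    unfolding eq xcoeff_to_fract by (simp add: lookup_sum lookup_single_0_mult p)
qed

definition list_exp :: "nat list \<Rightarrow> nat \<Rightarrow>\<^sub>0 nat" where
  "list_exp l = (\<Sum>i<length l. Poly_Mapping.single i (l ! i))"

lemma lookup_list_exp: "Poly_Mapping.lookup (list_exp l) i = part l i"
  by (auto simp: list_exp_def lookup_sum lookup_single when_def part_def)

lemma xvar_power: "xvar i ^ r = to_fract (Poly_Mapping.single (Poly_Mapping.single i r) 1)"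
  by (simp add: xvar_def single_power mult_single flip: to_fract_power single_of_nat)

lemma prod_single:
  fixes a :: "'c \<Rightarrow> 'a::comm_monoid_add" and b :: "'c \<Rightarrow> 'b::comm_semiring_1"
  shows "(\<Prod>k\<in>A. Poly_Mapping.single (a k) (b k)) = Poly_Mapping.single (\<Sum>k\<in>A. a k) (\<Prod>k\<in>A. b k)"
  by (induction A rule: infinite_finite_induct) (auto simp: mult_single single_one)

lemma prod_list_nth: "(\<Prod>r\<leftarrow>l. f r) = (\<Prod>k<length l. f (l ! k))" for f :: "'a \<Rightarrow> 'b::comm_monoid_mult"
  by (simp add: prod.list_conv_set_nth atLeast0LessThan)

text \<open>Multiplying out p_mu chooses a variable for every part; these are the choices that
  produce x^a.\<close>

definition fillings :: "nat list \<Rightarrow> nat \<Rightarrow> (nat \<Rightarrow>\<^sub>0 nat) \<Rightarrow> (nat \<Rightarrow> nat) set" where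
  "fillings mu n a = {f \<in> PiE {..<length mu} (\<lambda>_. {..<n}). (\<Sum>k<length mu. Poly_Mapping.single (f k) (mu ! k)) = a}"

lemma finite_fillings: "finite (fillings mu n a)"
  by (rule finite_subset[of _ "PiE {..<length mu} (\<lambda>_. {..<n})"]) (auto simp: fillings_def intro: finite_PiE)

lemma power_sum_expand:
  "power_sum mu n = to_fract (\<Sum>f\<in>PiE {..<length mu} (\<lambda>_. {..<n}).
     Poly_Mapping.single (\<Sum>k<length mu. Poly_Mapping.single (f k) (mu ! k)) 1)"
proof -
  have "power_sum mu n = (\<Prod>k<length mu. \<Sum>i<n. xvar i ^ (mu ! k))"
    by (simp add: power_sum_def prod_list_nth)
  also have "\<dots> = (\<Sum>f\<in>PiE {..<length mu} (\<lambda>_. {..<n}). \<Prod>k<length mu. xvar (f k) ^ (mu ! k))"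
    by (rule prod_sum_PiE) auto
  finally show ?thesis
    by (simp add: xvar_power to_fract_sum prod_single flip: to_fract_prod)
qed

lemma power_sum_in_range: "power_sum mu n \<in> range to_fract"
  unfolding power_sum_expand by (rule rangeI)

lemma xcoeff_power_sum: "xcoeff (power_sum mu n) a = of_nat (card (fillings mu n a))"
proof -
  have "xcoeff (power_sum mu n) a =
      (\<Sum>f\<in>PiE {..<length mu} (\<lambda>_. {..<n}). if (\<Sum>k<length mu. Poly_Mapping.single (f k) (mu ! k)) = a then 1 else 0)"
    unfolding power_sum_expand xcoeff_to_fract by (simp add: lookup_sum lookup_single when_def)
  also have "\<dots> = (\<Sum>f\<in>fillings mu n a. 1)"
    unfolding fillings_def by (rule sum.inter_filter[symmetric]) (auto intro: finite_PiE)
  finally show ?thesis by simp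
qed

lemma partition_eqI_mset:
  assumes "is_partition l" "is_partition l'" "mset l = mset l'"
  shows "l = l'"
proof -
  have "sorted (rev l)" "sorted (rev l')"
    using assms by (auto simp: is_partition_def sorted_wrt_rev)
  moreover have "mset (rev l) = mset (rev l')"
    using assms(3) by simp
  ultimately have "rev l = rev l'"
    by (metis properties_for_sort)
  then show ?thesis by simp
qed

lemma mset_conv_nth: "mset l = image_mset ((!) l) (mset_set {..<length l})"
  by (metis map_nth mset_map mset_set_upto_eq_mset_upto)

text \<open>Every variable occurring in x^nu must receive at least one part of mu. As mu has no more
  parts than nu, each receives exactly one, so parts are matched and never merged.\<close>

lemma fillings_eq:
  assumes mu: "is_partition mu" and nu: "is_partition nu" and len: "length mu \<le> length nu"
    and f: "f \<in> fillings mu n (list_exp nu)"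
  shows "mu = nu"
proof -
  let ?L = "length mu"
  have eq: "part nu i = (\<Sum>k<?L. if f k = i then mu ! k else 0)" for i
  proof -
    have "list_exp nu = (\<Sum>k<?L. Poly_Mapping.single (f k) (mu ! k))"
      using f by (simp add: fillings_def)
    then have "Poly_Mapping.lookup (list_exp nu) i = (\<Sum>k<?L. Poly_Mapping.lookup (Poly_Mapping.single (f k) (mu ! k)) i)"
      by (simp only: lookup_sum)
    then show ?thesis
      by (simp add: lookup_list_exp lookup_single when_def)
  qed
  have "{..<length nu} \<subseteq> f ` {..<?L}"
  proof
    fix i assume i: "i \<in> {..<length nu}"
    then have "part nu i \<noteq> 0"
      using part_eq_0_iff[OF nu, of i] by simp
    then obtain k where "k < ?L" "f k = i"
      unfolding eq by (auto dest!: sum.not_neutral_contains_not_neutral split: if_splits)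
    then show "i \<in> f ` {..<?L}" by auto
  qed
  moreover have c: "card (f ` {..<?L}) \<le> ?L"
    using card_image_le[of "{..<?L}" f] by simp
  ultimately have "length nu \<le> card (f ` {..<?L})"
    using card_mono[of "f ` {..<?L}" "{..<length nu}"] by simp
  then have L: "?L = length nu" and cf: "card (f ` {..<?L}) = card {..<?L}"
    using len c by simp_all
  have inj: "inj_on f {..<?L}"
    using cf by (intro eq_card_imp_inj_on) auto
  have im: "f ` {..<?L} = {..<length nu}"
    using \<open>{..<length nu} \<subseteq> f ` {..<?L}\<close> cf L by (intro card_subset_eq[symmetric]) auto
  have "mu ! k = nu ! f k" if k: "k < ?L" for k
  proof -
    have "f k < length nu" using im k by auto
    moreover have "part nu (f k) = (\<Sum>k'<?L. if k' = k then mu ! k' else 0)"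
      unfolding eq using inj k by (intro sum.cong) (auto dest: inj_onD)
    ultimately show ?thesis
      using k by (simp add: part_def)
  qed
  then have "mset mu = image_mset (\<lambda>k. nu ! f k) (mset_set {..<?L})"
    unfolding mset_conv_nth[of mu] by (intro image_mset_cong) auto
  also have "\<dots> = image_mset ((!) nu) (image_mset f (mset_set {..<?L}))"
    by (simp add: image_mset.compositionality o_def)
  also have "image_mset f (mset_set {..<?L}) = mset_set {..<length nu}"
    using inj im by (simp add: image_mset_mset_set)
  finally have "mset mu = mset nu"
    by (simp add: mset_conv_nth[of nu])
  then show ?thesis
    by (rule partition_eqI_mset[OF mu nu])
qed

lemma fillings_self: "fillings nu (length nu) (list_exp nu) \<noteq> {}"
proof -
  have "restrict id {..<length nu} \<in> fillings nu (length nu) (list_exp nu)"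
    by (simp add: fillings_def list_exp_def)
  then show ?thesis by blast
qed

text \<open>In a nontrivial relation, take nu with the most parts and test the coefficient of x^nu:
  by \<open>fillings_eq\<close> no other p_mu contributes to it.\<close>

lemma indep_power_sum: "indep_family power_sum"
  unfolding indep_family_def
proof (intro allI impI, rule ccontr)
  fix S c assume S: "finite S" "S \<subseteq> Collect is_partition"
    and zero: "\<forall>n. (\<Sum>\<nu>\<in>S. scalar (c \<nu>) * power_sum \<nu> n) = 0" and "\<not> (\<forall>\<nu>\<in>S. c \<nu> = 0)"
  define T where "T = {\<nu>\<in>S. c \<nu> \<noteq> 0}"
  have T: "finite T" "T \<noteq> {}"
    using S(1) \<open>\<not> _\<close> by (auto simp: T_def)
  then have "\<exists>\<nu>\<in>T. \<forall>\<mu>\<in>T. length \<mu> \<le> length \<nu>"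
    using Max_in[of "length ` T"] Max_ge[of "length ` T"] by (metis (no_types, lifting) finite_imageI image_iff image_is_empty imageI)
  then obtain \<nu> where \<nu>: "\<nu> \<in> T" and max: "\<And>\<mu>. \<mu> \<in> T \<Longrightarrow> length \<mu> \<le> length \<nu>" by blast
  let ?n = "length \<nu>" and ?a = "list_exp \<nu>"
  have "0 = xcoeff (\<Sum>\<mu>\<in>S. scalar (c \<mu>) * power_sum \<mu> ?n) ?a"
    using zero xcoeff_to_fract[of 0] by simp
  also have "\<dots> = (\<Sum>\<mu>\<in>S. c \<mu> * of_nat (card (fillings \<mu> ?n ?a)))"
    by (subst xcoeff_lincomb) (simp_all add: power_sum_in_range xcoeff_power_sum)
  also have "\<dots> = (\<Sum>\<mu>\<in>{\<nu>}. c \<mu> * of_nat (card (fillings \<mu> ?n ?a)))"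
  proof (rule sum.mono_neutral_right)
    show "\<forall>\<mu>\<in>S - {\<nu>}. c \<mu> * of_nat (card (fillings \<mu> ?n ?a)) = 0"
    proof
      fix \<mu> assume \<mu>: "\<mu> \<in> S - {\<nu>}"
      show "c \<mu> * of_nat (card (fillings \<mu> ?n ?a)) = 0"
      proof (cases "c \<mu> = 0")
        case False
        then have "\<mu> \<in> T" using \<mu> by (simp add: T_def)
        then have "fillings \<mu> ?n ?a = {}"
          using fillings_eq[of \<mu> \<nu> _ ?n] max[of \<mu>] \<mu> \<nu> S(2) by (auto simp: T_def)
        then show ?thesis by simp
      qed simp
    qed
  qed (use S \<nu> in \<open>auto simp: T_def\<close>)
  \<comment> \<open>The number of fillings is positive, hence nonzero in characteristic 0.\<close>
  finally have "c \<nu> = 0"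
    using fillings_self[of \<nu>] finite_fillings[of \<nu>] by simp
  then show False
    using \<nu> by (simp add: T_def)
qed

text \<open>Both alphabets \<open>X\<close> (with \<open>s = 0\<close>) and \<open>(1 - t)X\<close> (with \<open>s = t\<close>) are treated at once,
  so that a linear relation between functions on this domain is compatible with the substitution.\<close>

definition subst_dom :: "(xfrac \<times> nat) set" where
  "subst_dom = {0, tx} \<times> UNIV"

text \<open>At s = 0 the factors 1 - s^r are 1 as long as r > 0; at s = t they carry out the
  substitution.\<close>

definition scaled_power_sum :: "nat list \<Rightarrow> xfrac \<times> nat \<Rightarrow> xfrac" where
  "scaled_power_sum al = (\<lambda>(s, n). \<Prod>r\<leftarrow>al. (1 - s ^ r) * (\<Sum>i<n. xvar i ^ r))"

abbreviation scaled_power_sum_span :: "(xfrac \<times> nat \<Rightarrow> xfrac) set" where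
  "scaled_power_sum_span \<equiv> lspan subst_dom UNIV scaled_power_sum (Collect is_partition)"

lemma scaled_power_sum_in_span:
  assumes "0 \<notin> set al"
  shows "scaled_power_sum al \<in> scaled_power_sum_span"
proof -
  have "filter (\<lambda>r. r \<noteq> 0) al = al"
    using assms by (metis (mono_tags, lifting) filter_True)
  then have "mset (canon al) = mset al"
    by (simp only: canon_def mset_rev mset_sort)
  moreover have "scaled_power_sum l d = prod_mset (image_mset (\<lambda>r. (1 - fst d ^ r) * (\<Sum>i<snd d. xvar i ^ r)) (mset l))" for l d
    by (induction l) (auto simp: scaled_power_sum_def case_prod_unfold)
  ultimately have "scaled_power_sum al = scaled_power_sum (canon al)" by auto
  then show ?thesis
    by (simp add: lspan_base)
qed

lemma scaled_power_sum_span_mult: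
  assumes "f \<in> scaled_power_sum_span" "g \<in> scaled_power_sum_span"
  shows "(\<lambda>d. f d * g d) \<in> scaled_power_sum_span"
proof (rule lspan_mult[OF coeff_ring_UNIV assms])
  fix i j assume "i \<in> Collect is_partition" "j \<in> Collect is_partition"
  then have "scaled_power_sum (i @ j) \<in> scaled_power_sum_span"
    by (intro scaled_power_sum_in_span) (auto simp: is_partition_def)
  moreover have "scaled_power_sum (i @ j) = (\<lambda>d. scaled_power_sum i d * scaled_power_sum j d)"
    by (auto simp: scaled_power_sum_def)
  ultimately show "(\<lambda>d. scaled_power_sum i d * scaled_power_sum j d) \<in> scaled_power_sum_span" by simp
qed

lemma scaled_power_sum_span_one: "(\<lambda>d. 1) \<in> scaled_power_sum_span"
  using scaled_power_sum_in_span[of "[]"] by (simp add: scaled_power_sum_def case_prod_unfold)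

lemma scaled_power_sum_span_prod:
  assumes "\<And>i. i \<in> A \<Longrightarrow> f i \<in> scaled_power_sum_span"
  shows "(\<lambda>d. \<Prod>i\<in>A. f i d) \<in> scaled_power_sum_span"
  using assms by (induction A rule: infinite_finite_induct) (auto intro: scaled_power_sum_span_one scaled_power_sum_span_mult)

text \<open>Newton's identities solved for q_k have the same shape at both values of s, so one set
  of coefficients works for both. The division by k forces rational coefficients.\<close>

lemma qcoef_in_scaled_power_sum_span: "(\<lambda>(s, n). qcoef s xvar {..<n} k) \<in> scaled_power_sum_span"
proof (induction k rule: less_induct)
  case (less k)
  show ?case
  proof (cases k)
    case 0
    then show ?thesis using scaled_power_sum_span_one by (simp add: case_prod_unfold)
  next
    case (Suc m)
    have "(\<lambda>d. \<Sum>j\<le>m. (case d of (s, n) \<Rightarrow> qcoef s xvar {..<n} j) * scaled_power_sum [Suc (m - j)] d) \<in> scaled_power_sum_span"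
      by (intro lspan_sum coeff_ring_UNIV scaled_power_sum_span_mult less scaled_power_sum_in_span) (auto simp: Suc)
    then have "(\<lambda>d. scalar (inverse (of_nat (Suc m))) *
        (\<Sum>j\<le>m. (case d of (s, n) \<Rightarrow> qcoef s xvar {..<n} j) * scaled_power_sum [Suc (m - j)] d)) \<in> scaled_power_sum_span"
      by (intro lspan_scale) auto
    then show ?thesis
    proof (rule lspan_cong, clarify)
      fix s n
      have "of_nat (Suc m) * qcoef s xvar {..<n} (Suc m) =
          (\<Sum>j\<le>m. qcoef s xvar {..<n} j * scaled_power_sum [Suc (m - j)] (s, n))"
        by (subst qcoef_newton) (simp_all add: scaled_power_sum_def)
      moreover have "(of_nat (Suc m) :: xfrac) \<noteq> 0"
        using of_nat_neq_0 by blast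
      ultimately have "qcoef s xvar {..<n} (Suc m) = inverse (of_nat (Suc m)) *
          (\<Sum>j\<le>m. qcoef s xvar {..<n} j * scaled_power_sum [Suc (m - j)] (s, n))"
        by (metis (no_types, lifting) left_inverse mult.assoc mult_1)
      then show "qcoef s xvar {..<n} k = scalar (inverse (of_nat (Suc m))) *
          (\<Sum>j\<le>m. qcoef s xvar {..<n} j * scaled_power_sum [Suc (m - j)] (s, n))"
        by (simp only: Suc scalar_inverse scalar_of_nat)
    qed
  qed
qed

lemma jacobi_trudi_in_scaled_power_sum_span: "(\<lambda>(s, n). jacobi_trudi s l n be c) \<in> scaled_power_sum_span"
proof -
  have h: "(\<lambda>(s, n). jt_entry s n b e) \<in> scaled_power_sum_span" for b e
    using qcoef_in_scaled_power_sum_span[of "b - e"] lspan_zero[OF coeff_ring_UNIV] by (cases "e \<le> b") (auto simp: jt_entry_def case_prod_unfold)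
  have "(\<lambda>d. \<Sum>\<sigma> | \<sigma> permutes {..<l}. scalar (of_int (sign \<sigma>)) * (\<Prod>i<l. (\<lambda>(s, n). jt_entry s n (be i) (c (\<sigma> i))) d)) \<in> scaled_power_sum_span"
    by (intro lspan_sum lspan_scale coeff_ring_UNIV scaled_power_sum_span_prod h UNIV_I)
  moreover have "scalar (of_int (sign \<sigma>)) = of_int (sign \<sigma>)" for \<sigma> :: "nat \<Rightarrow> nat"
    by (cases \<sigma> rule: sign_cases) (auto simp: scalar_uminus)
  ultimately show ?thesis
    by (simp add: jacobi_trudi_def case_prod_unfold)
qed

lemma scaled_power_sum_0: "is_partition nu \<Longrightarrow> scaled_power_sum nu (0, n) = power_sum nu n"
proof -
  assume "is_partition nu"
  then have "0 \<notin> set nu" by (simp add: is_partition_def)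
  then show ?thesis
    by (induction nu) (auto simp: scaled_power_sum_def power_sum_def power_0_left)
qed

text \<open>The determinant has one expansion in scaled power sums, valid at s = 0 and at s = t.
  Read at s = 0 it must, by independence, be the expansion that \<open>subst_1mt\<close> selects;
  read at s = t it is the result of the substitution.\<close>

lemma subst_1mt_skew_schur:
  assumes lam: "is_partition lam" and mu: "is_partition mu" and sub: "partition_subset mu lam"
  defines "l \<equiv> length lam"
  defines "be \<equiv> \<lambda>i. part lam i + (l - Suc i)" and "c \<equiv> \<lambda>i. part mu i + (l - Suc i)"
  shows "skew_schur lam mu n = jacobi_trudi 0 l n be c" and "subst_1mt (skew_schur lam mu) n = jacobi_trudi tx l n be c"
proof -
  have anti: "antimono (part lam)" "antimono (part mu)"
    using lam mu by (auto simp: is_partition_def intro: antimono_part)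
  have s: "skew_schur lam mu n = jacobi_trudi 0 l n be c" for n
    unfolding skew_schur_fschur be_def c_def
    by (rule fschur_jacobi_trudi) (use anti sub in \<open>auto simp: partition_subset_def l_def part_def\<close>)
  then show "skew_schur lam mu n = jacobi_trudi 0 l n be c" .
  obtain S e where S: "finite S" "S \<subseteq> Collect is_partition"
    and J: "\<And>d. d \<in> subst_dom \<Longrightarrow> (\<lambda>(s, n). jacobi_trudi s l n be c) d = (\<Sum>i\<in>S. scalar (e i) * scaled_power_sum i d)"
    using jacobi_trudi_in_scaled_power_sum_span[of l be c] unfolding lspan_def by blast
  define e' where "e' i = (if i \<in> S then e i else 0)" for i
  have e': "{i. e' i \<noteq> 0} \<subseteq> S" by (auto simp: e'_def)
  have J': "jacobi_trudi s l n be c = (\<Sum>i | e' i \<noteq> 0. scalar (e' i) * scaled_power_sum i (s, n))" if "s \<in> {0, tx}" for s n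
  proof -
    have "jacobi_trudi s l n be c = (\<Sum>i\<in>S. scalar (e i) * scaled_power_sum i (s, n))"
      using J[of "(s, n)"] that by (auto simp: subst_dom_def)
    also have "\<dots> = (\<Sum>i | e' i \<noteq> 0. scalar (e' i) * scaled_power_sum i (s, n))"
      using S by (intro sum.mono_neutral_cong_right) (auto simp: e'_def)
    finally show ?thesis .
  qed
  have "has_expansion power_sum (skew_schur lam mu) e'"
    unfolding has_expansion_def
  proof (intro conjI allI)
    show "finite {i. e' i \<noteq> 0}" "{i. e' i \<noteq> 0} \<subseteq> Collect is_partition"
      using e' S finite_subset by auto
    fix n show "skew_schur lam mu n = (\<Sum>i | e' i \<noteq> 0. scalar (e' i) * power_sum i n)"
      unfolding s J'[of 0 n, simplified] using e' S by (intro sum.cong) (auto simp: scaled_power_sum_0)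
  qed
  then have "expansion_coeff power_sum (skew_schur lam mu) = e'"
    by (rule expansion_coeff_eqI[OF indep_power_sum])
  then show "subst_1mt (skew_schur lam mu) n = jacobi_trudi tx l n be c"
    unfolding subst_1mt_def J'[of tx n, simplified]
    by (simp add: scaled_power_sum_def scalar_diff scalar_power tx_def)
qed

section \<open>Grading the field of rational functions\<close>

text \<open>c may be 0, so d is only a lower bound for the order; this keeps the notion stable under
  sums with cancellation.\<close>

definition init_coeff :: "'a::field fls \<Rightarrow> int \<Rightarrow> 'a \<Rightarrow> bool" where
  "init_coeff F d c \<longleftrightarrow> (\<forall>k<d. fls_nth F k = 0) \<and> fls_nth F d = c"

lemma init_coeff_shift_fps:
  assumes "init_coeff F d c"
  obtains f where "F = fls_shift (- d) (fps_to_fls f)" "fps_nth f 0 = c"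
proof (cases "F = 0")
  case True
  then show ?thesis
    using assms that[of 0] by (simp add: init_coeff_def)
next
  case False
  then have "- d \<ge> - fls_subdegree F"
    using assms by (auto simp: init_coeff_def intro!: fls_subdegree_geI)
  then obtain f where f: "F = fls_shift (- d) (fps_to_fls f)"
    using fls_as_fps by blast
  moreover have "fps_nth f 0 = c"
    using assms by (simp add: f init_coeff_def)
  ultimately show ?thesis by (rule that)
qed

lemma init_coeff_mult:
  assumes "init_coeff F d c" "init_coeff G e c'"
  shows "init_coeff (F * G) (d + e) (c * c')"
proof -
  obtain f where f: "F = fls_shift (- d) (fps_to_fls f)" "fps_nth f 0 = c"
    using assms(1) by (rule init_coeff_shift_fps)
  obtain g where g: "G = fls_shift (- e) (fps_to_fls g)" "fps_nth g 0 = c'"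
    using assms(2) by (rule init_coeff_shift_fps)
  have "F * G = fls_shift (- d - e) (fps_to_fls (f * g))"
    by (simp add: f g fls_times_both_shifted_simp fls_times_fps_to_fls)
  then show ?thesis
    using f(2) g(2) by (simp add: init_coeff_def)
qed

lemma init_coeff_1: "init_coeff 1 0 1"
  by (simp add: init_coeff_def)

lemma init_coeff_prod:
  assumes "\<And>i. i \<in> A \<Longrightarrow> init_coeff (F i) (d i) (c i)"
  shows "init_coeff (\<Prod>i\<in>A. F i) (\<Sum>i\<in>A. d i) (\<Prod>i\<in>A. c i)"
  using assms by (induction A rule: infinite_finite_induct) (auto simp: init_coeff_1 intro: init_coeff_mult)

lemma init_coeff_power: "init_coeff F d c \<Longrightarrow> init_coeff (F ^ n) (int n * d) (c ^ n)"
  using init_coeff_prod[of "{..<n}" "\<lambda>_. F" "\<lambda>_. d" "\<lambda>_. c"] by simp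

lemma init_coeff_sum:
  assumes "\<And>i. i \<in> A \<Longrightarrow> init_coeff (F i) d (c i)"
  shows "init_coeff (\<Sum>i\<in>A. F i) d (\<Sum>i\<in>A. c i)"
  using assms by (auto simp: init_coeff_def fls_nth_sum intro: sum.neutral)

lemma init_coeff_diff: "init_coeff F d c \<Longrightarrow> init_coeff G d c' \<Longrightarrow> init_coeff (F - G) d (c - c')"
  by (auto simp: init_coeff_def)

lemma init_coeff_weaken:
  "init_coeff F d c \<Longrightarrow> e \<le> d \<Longrightarrow> init_coeff F e (if e = d then c else 0)"
  by (auto simp: init_coeff_def)

lemma init_coeff_inverse:
  assumes "init_coeff F d c" "c \<noteq> 0"
  shows "init_coeff (inverse F) (- d) (inverse c)"
proof -
  have F: "F \<noteq> 0" using assms by (auto simp: init_coeff_def)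
  have "fls_subdegree F = d"
    using assms by (intro fls_subdegree_eqI) (auto simp: init_coeff_def)
  define G where "G = inverse F"
  have FG: "F * G = 1"
    using F by (simp add: G_def)
  then have "G \<noteq> 0" by auto
  have "fls_subdegree (F * G) = d + fls_subdegree G"
    using F \<open>G \<noteq> 0\<close> \<open>fls_subdegree F = d\<close> by simp
  then have e: "fls_subdegree G = - d"
    by (simp add: FG)
  have G: "init_coeff G (- d) (fls_nth G (- d))"
    using e by (auto simp: init_coeff_def)
  have "c * fls_nth G (- d) = 1"
    using init_coeff_mult[OF assms(1) G] by (simp add: FG init_coeff_def)
  then have "fls_nth G (- d) = inverse c"
    by (simp add: inverse_unique)
  then show ?thesis
    using G by (simp add: G_def)
qed

lemma init_coeff_divide:
  assumes "init_coeff F d c" "init_coeff G e c'" "c' \<noteq> 0"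
  shows "init_coeff (F / G) (d - e) (c / c')"
  using init_coeff_mult[OF assms(1) init_coeff_inverse[OF assms(2,3)]] by (simp add: divide_inverse)

section \<open>Weights and the rescaling homomorphism into Laurent series\<close>

definition weight :: "(nat \<Rightarrow> nat) \<Rightarrow> (nat \<Rightarrow>\<^sub>0 nat) \<Rightarrow> nat" where
  "weight w a = (\<Sum>i\<in>Poly_Mapping.keys a. w i * Poly_Mapping.lookup a i)"

lemma weight_add: "weight w (a + b) = weight w a + weight w b"
  unfolding weight_def by (rule setsum_keys_plus_distrib) (auto simp: algebra_simps)

lemma weight_0 [simp]: "weight w 0 = 0"
  by (simp add: weight_def)

lemma weight_single [simp]: "weight w (Poly_Mapping.single i r) = w i * r"
  by (simp add: weight_def)

lemma weight_sum: "weight w (\<Sum>k\<in>A. f k) = (\<Sum>k\<in>A. weight w (f k))"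
  by (induction A rule: infinite_finite_induct) (auto simp: weight_add)

type_synonym mpoly = "(nat \<Rightarrow>\<^sub>0 nat) \<Rightarrow>\<^sub>0 qt"

text \<open>A positive shift lowers exponents, so the monomials of largest weight become the initial
  terms. The monomial itself stays in the coefficient, hence nothing is lost and the map is
  injective.\<close>

definition grade_mono :: "(nat \<Rightarrow> nat) \<Rightarrow> (nat \<Rightarrow>\<^sub>0 nat) \<Rightarrow> qt \<Rightarrow> xfrac fls" where
  "grade_mono w a c = fls_shift (int (weight w a)) (fls_const (to_fract (Poly_Mapping.single a c)))"

text \<open>The substitution \<open>x\<^sub>i \<mapsto> x\<^sub>i u\<^bsup>-w i\<^esup>\<close>, where \<open>u\<close> is the variable of the Laurent series.\<close>

definition grade_poly :: "(nat \<Rightarrow> nat) \<Rightarrow> mpoly \<Rightarrow> xfrac fls" where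
  "grade_poly w p = (\<Sum>a\<in>Poly_Mapping.keys p. grade_mono w a (Poly_Mapping.lookup p a))"

lemma grade_mono_0 [simp]: "grade_mono w a 0 = 0"
  by (simp add: grade_mono_def)

lemma grade_mono_add: "grade_mono w a (c + d) = grade_mono w a c + grade_mono w a d"
  by (simp add: grade_mono_def single_add fls_plus_const[symmetric])

lemma grade_mono_mult: "grade_mono w a c * grade_mono w b d = grade_mono w (a + b) (c * d)"
  by (simp add: grade_mono_def fls_times_both_shifted_simp weight_add mult_single flip: to_fract_mult)

lemma grade_poly_add: "grade_poly w (p + q) = grade_poly w p + grade_poly w q"
  unfolding grade_poly_def by (rule setsum_keys_plus_distrib) (auto simp: grade_mono_add)

lemma grade_poly_0 [simp]: "grade_poly w 0 = 0"
  by (simp add: grade_poly_def)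

lemma grade_poly_sum: "grade_poly w (sum f A) = (\<Sum>x\<in>A. grade_poly w (f x))"
  by (induction A rule: infinite_finite_induct) (auto simp: grade_poly_add)

lemma grade_poly_single: "grade_poly w (Poly_Mapping.single a c) = grade_mono w a c"
  by (cases "c = 0") (simp_all add: grade_poly_def)

lemma poly_mapping_sum_single: "p = (\<Sum>a\<in>Poly_Mapping.keys p. Poly_Mapping.single a (Poly_Mapping.lookup p a))"
proof (rule poly_mapping_eqI)
  fix b
  have "(\<Sum>a\<in>Poly_Mapping.keys p. Poly_Mapping.lookup (Poly_Mapping.single a (Poly_Mapping.lookup p a)) b) =
      (\<Sum>a\<in>Poly_Mapping.keys p. if a = b then Poly_Mapping.lookup p a else 0)"
    by (simp add: lookup_single when_def)
  also have "\<dots> = Poly_Mapping.lookup p b"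
    by (simp add: in_keys_iff)
  finally show "Poly_Mapping.lookup p b =
      Poly_Mapping.lookup (\<Sum>a\<in>Poly_Mapping.keys p. Poly_Mapping.single a (Poly_Mapping.lookup p a)) b"
    by (simp add: lookup_sum)
qed

lemma grade_poly_mult: "grade_poly w (p * q) = grade_poly w p * grade_poly w q"
proof -
  have "p * q = (\<Sum>a\<in>Poly_Mapping.keys p. Poly_Mapping.single a (Poly_Mapping.lookup p a)) *
      (\<Sum>b\<in>Poly_Mapping.keys q. Poly_Mapping.single b (Poly_Mapping.lookup q b))"
    using poly_mapping_sum_single[of p] poly_mapping_sum_single[of q] by simp
  also have "grade_poly w \<dots> = grade_poly w p * grade_poly w q"
    unfolding sum_product mult_single grade_poly_sum grade_poly_single
    by (simp add: grade_poly_def sum_product grade_mono_mult)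
  finally show ?thesis .
qed

lemma grade_poly_nth: "fls_nth (grade_poly w p) k =
  to_fract (\<Sum>a\<in>Poly_Mapping.keys p. if k = - int (weight w a) then Poly_Mapping.single a (Poly_Mapping.lookup p a) else 0)"
  unfolding grade_poly_def fls_nth_sum to_fract_sum
  by (intro sum.cong refl) (auto simp: grade_mono_def)

lemma xcoeff_grade_poly: "xcoeff (fls_nth (grade_poly w p) k) a =
  (if k = - int (weight w a) then Poly_Mapping.lookup p a else 0)"
proof -
  have "xcoeff (fls_nth (grade_poly w p) k) a =
      (\<Sum>b\<in>Poly_Mapping.keys p. if b = a then if k = - int (weight w b) then Poly_Mapping.lookup p b else 0 else 0)"
    unfolding grade_poly_nth xcoeff_to_fract lookup_sum
    by (intro sum.cong refl) (auto simp: lookup_single when_def)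
  then show ?thesis
    by (simp add: in_keys_iff)
qed

lemma grade_poly_eq_0_iff [simp]: "grade_poly w p = 0 \<longleftrightarrow> p = 0"
proof
  assume 0: "grade_poly w p = 0"
  show "p = 0"
  proof (rule poly_mapping_eqI)
    fix a
    have "Poly_Mapping.lookup p a = xcoeff (fls_nth (grade_poly w p) (- int (weight w a))) a"
      by (simp add: xcoeff_grade_poly)
    then show "Poly_Mapping.lookup p a = Poly_Mapping.lookup 0 a"
      using xcoeff_to_fract[of 0] by (simp add: 0)
  qed
qed simp

text \<open>The injective ring homomorphism \<open>grade_poly\<close> extends to fractions;
  \<open>grade_quotient\<close> shows by cross multiplication that the chosen representative does
  not matter.\<close>

definition grade :: "(nat \<Rightarrow> nat) \<Rightarrow> xfrac \<Rightarrow> xfrac fls" where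
  "grade w f = (let p = SOME p. snd p \<noteq> 0 \<and> f = to_fract (fst p) / to_fract (snd p)
     in grade_poly w (fst p) / grade_poly w (snd p))"

lemma grade_quotient:
  assumes "b \<noteq> 0"
  shows "grade w (to_fract a / to_fract b) = grade_poly w a / grade_poly w b"
proof -
  define p where "p = (SOME p. snd p \<noteq> 0 \<and> to_fract a / to_fract b = to_fract (fst p) / to_fract (snd p))"
  have p: "snd p \<noteq> 0 \<and> to_fract a / to_fract b = to_fract (fst p) / to_fract (snd p)"
    unfolding p_def by (rule someI[of _ "(a, b)"]) (use assms in simp)
  then have "to_fract (a * snd p) = to_fract (fst p * b)"
    using assms by (simp add: field_simps)
  then have "grade_poly w a * grade_poly w (snd p) = grade_poly w (fst p) * grade_poly w b"
    by (simp only: to_fract_eq_iff flip: grade_poly_mult)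
  moreover have "grade w (to_fract a / to_fract b) = grade_poly w (fst p) / grade_poly w (snd p)"
    by (simp add: grade_def Let_def p_def)
  ultimately show ?thesis
    using p assms by (simp add: frac_eq_eq)
qed

lemma xfrac_cases:
  obtains a b where "b \<noteq> 0" "f = to_fract a / to_fract (b :: 'a::idom)"
  by (metis Fract_cases Fract_conv_to_fract)

lemma grade_poly_1 [simp]: "grade_poly w 1 = 1"
proof -
  have "grade_poly w (1 * 1) = grade_poly w 1 * grade_poly w 1"
    by (rule grade_poly_mult)
  then show ?thesis
    using grade_poly_eq_0_iff[of w 1] by simp
qed

lemma grade_to_fract: "grade w (to_fract a) = grade_poly w a"
  using grade_quotient[of 1 w a] by simp

lemma grade_mult: "grade w (f * g) = grade w f * grade w g"
proof -
  obtain a b where f: "b \<noteq> 0" "f = to_fract a / to_fract b" by (rule xfrac_cases)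
  obtain c d where g: "d \<noteq> 0" "g = to_fract c / to_fract d" by (rule xfrac_cases)
  have "f * g = to_fract (a * c) / to_fract (b * d)"
    by (simp add: f g)
  then show ?thesis
    using f g grade_quotient[of "b * d" w "a * c"] by (simp add: grade_quotient grade_poly_mult)
qed

lemma grade_add: "grade w (f + g) = grade w f + grade w g"
proof -
  obtain a b where f: "b \<noteq> 0" "f = to_fract a / to_fract b" by (rule xfrac_cases)
  obtain c d where g: "d \<noteq> 0" "g = to_fract c / to_fract d" by (rule xfrac_cases)
  have "f + g = to_fract (a * d + c * b) / to_fract (b * d)"
    using f g by (simp add: add_frac_eq)
  then have "grade w (f + g) = (grade_poly w a * grade_poly w d + grade_poly w c * grade_poly w b) / (grade_poly w b * grade_poly w d)"
    using f g grade_quotient[of "b * d" w "a * d + c * b"] by (simp add: grade_poly_mult grade_poly_add)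
  then show ?thesis
    using f g by (simp add: grade_quotient add_frac_eq)
qed

lemma grade_0 [simp]: "grade w 0 = 0"
  using grade_to_fract[of w 0] by simp

lemma grade_1 [simp]: "grade w 1 = 1"
  using grade_to_fract[of w 1] by simp

lemma grade_diff: "grade w (f - g) = grade w f - grade w g"
  using grade_add[of w "f - g" g] by simp

lemma grade_divide: "grade w (f / g) = grade w f / grade w g"
proof (cases "g = 0")
  case False
  then have "grade w (f / g) * grade w g = grade w f" "grade w (1 / g) * grade w g = 1"
    by (simp_all flip: grade_mult)
  then show ?thesis
    by (metis mult_eq_0_iff nonzero_eq_divide_eq zero_neq_one)
qed simp

lemma grade_sum: "grade w (sum f A) = (\<Sum>x\<in>A. grade w (f x))"
  by (induction A rule: infinite_finite_induct) (auto simp: grade_add)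

lemma grade_prod: "grade w (prod f A) = (\<Prod>x\<in>A. grade w (f x))"
  by (induction A rule: infinite_finite_induct) (auto simp: grade_mult)

lemma grade_power: "grade w (f ^ n) = grade w f ^ n"
  by (induction n) (auto simp: grade_mult)

lemma grade_scalar: "init_coeff (grade w (scalar c)) 0 (scalar c)"
  by (simp add: scalar_def grade_to_fract grade_poly_single grade_mono_def init_coeff_def)

lemma grade_xvar: "init_coeff (grade w (xvar i)) (- int (w i)) (xvar i)"
  by (simp add: xvar_def grade_to_fract grade_poly_single grade_mono_def init_coeff_def)

text \<open>What remains of (x_a - t x_b)/(x_a - x_b) after rescaling as u tends to 0: the variable
  of larger weight dominates numerator and denominator alike.\<close>

definition lead_ratio :: "(nat \<Rightarrow> nat) \<Rightarrow> nat \<Rightarrow> nat \<Rightarrow> xfrac" where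
  "lead_ratio w a b = (if w a > w b then 1 else if w a < w b then tx
     else (xvar a - tx * xvar b) / (xvar a - xvar b))"

lemma grade_ratio:
  assumes "a \<noteq> b"
  shows "init_coeff (grade w ((xvar a - tx * xvar b) / (xvar a - xvar b))) 0 (lead_ratio w a b)"
proof -
  have a: "init_coeff (grade w (xvar a)) (- int (w a)) (xvar a)"
    and b: "init_coeff (grade w (xvar b)) (- int (w b)) (xvar b)"
    by (rule grade_xvar)+
  have tb: "init_coeff (grade w (tx * xvar b)) (- int (w b)) (tx * xvar b)"
    using init_coeff_mult[OF grade_scalar[of w tt] b] by (simp add: grade_mult tx_def)
  \<comment> \<open>Numerator and denominator are compared at the common order -max (w a) (w b), so
    the quotient gets order 0. A and B are what x_a and x_b contribute at this order.\<close>
  define m where "m = - int (max (w a) (w b))"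
  define A where "A = (if w b \<le> w a then xvar a else 0)"
  define B where "B = (if w a \<le> w b then xvar b else 0)"
  have A: "init_coeff (grade w (xvar a)) m A"
    using init_coeff_weaken[OF a, of m] by (auto simp: m_def A_def max_def split: if_splits)
  have B: "init_coeff (grade w (xvar b)) m B"
    using init_coeff_weaken[OF b, of m] by (auto simp: m_def B_def max_def split: if_splits)
  have tB: "init_coeff (grade w (tx * xvar b)) m (tx * B)"
    using init_coeff_weaken[OF tb, of m] by (auto simp: m_def B_def max_def split: if_splits)
  have "A - B \<noteq> 0"
    using assms by (auto simp: A_def B_def)
  then have "init_coeff (grade w ((xvar a - tx * xvar b) / (xvar a - xvar b))) (m - m) ((A - tx * B) / (A - B))"
    unfolding grade_divide grade_diff by (intro init_coeff_divide init_coeff_diff A B tB)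
  moreover have "(A - tx * B) / (A - B) = lead_ratio w a b"
    by (auto simp: A_def B_def lead_ratio_def)
  ultimately show ?thesis by simp
qed

text \<open>All quotients have initial order 0, so the order of a summand is governed by its
  permuted monomial alone. M is any bound for the weights; if it is not attained, the coefficient is
  an empty sum.\<close>

lemma init_coeff_hall_littlewood_P:
  assumes len: "length lam \<le> n" and M: "\<And>\<sigma>. \<sigma> permutes {..<n} \<Longrightarrow> (\<Sum>i<length lam. (lam ! i) * w (\<sigma> i)) \<le> M"
  shows "init_coeff (grade w (hall_littlewood_P lam n)) (- int M)
    (scalar (inverse (hl_v lam n)) * (\<Sum>\<sigma> | \<sigma> permutes {..<n} \<and> (\<Sum>i<length lam. (lam ! i) * w (\<sigma> i)) = M.
       (\<Prod>i<length lam. xvar (\<sigma> i) ^ (lam ! i)) * (\<Prod>j<n. \<Prod>i<j. lead_ratio w (\<sigma> i) (\<sigma> j))))"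
proof -
  define F where "F \<sigma> = (\<Prod>i<length lam. xvar (\<sigma> i) ^ (lam ! i)) *
     (\<Prod>j<n. \<Prod>i<j. (xvar (\<sigma> i) - tx * xvar (\<sigma> j)) / (xvar (\<sigma> i) - xvar (\<sigma> j)))" for \<sigma>
  define G where "G \<sigma> = (\<Prod>i<length lam. xvar (\<sigma> i) ^ (lam ! i)) * (\<Prod>j<n. \<Prod>i<j. lead_ratio w (\<sigma> i) (\<sigma> j))" for \<sigma>
  define W where "W \<sigma> = (\<Sum>i<length lam. (lam ! i) * w (\<sigma> i))" for \<sigma> :: "nat \<Rightarrow> nat"
  have "init_coeff (grade w (F \<sigma>)) (- int M) (if W \<sigma> = M then G \<sigma> else 0)" if \<sigma>: "\<sigma> permutes {..<n}" for \<sigma>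
  proof -
    have inj: "\<sigma> i \<noteq> \<sigma> j" if "i < j" for i j
      using permutes_inj[OF \<sigma>] that by (auto dest: injD)
    have 1: "init_coeff (grade w (\<Prod>i<length lam. xvar (\<sigma> i) ^ (lam ! i)))
        (\<Sum>i<length lam. int (lam ! i) * (- int (w (\<sigma> i)))) (\<Prod>i<length lam. xvar (\<sigma> i) ^ (lam ! i))"
      unfolding grade_prod grade_power by (intro init_coeff_prod init_coeff_power grade_xvar)
    have 2: "init_coeff (grade w (\<Prod>j<n. \<Prod>i<j. (xvar (\<sigma> i) - tx * xvar (\<sigma> j)) / (xvar (\<sigma> i) - xvar (\<sigma> j))))
        (\<Sum>j<n. \<Sum>i<j. 0) (\<Prod>j<n. \<Prod>i<j. lead_ratio w (\<sigma> i) (\<sigma> j))"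
      unfolding grade_prod by (intro init_coeff_prod grade_ratio inj) auto
    have "init_coeff (grade w (F \<sigma>)) (- int (W \<sigma>)) (G \<sigma>)"
      using init_coeff_mult[OF 1 2] by (simp add: F_def G_def W_def grade_mult sum_negf)
    moreover have "W \<sigma> \<le> M"
      using M[OF \<sigma>] by (simp add: W_def)
    ultimately show ?thesis
      using init_coeff_weaken[of "grade w (F \<sigma>)" "- int (W \<sigma>)" "G \<sigma>" "- int M"] by (auto split: if_splits)
  qed
  then have "init_coeff (grade w (\<Sum>\<sigma> | \<sigma> permutes {..<n}. F \<sigma>)) (- int M) (\<Sum>\<sigma> | \<sigma> permutes {..<n}. if W \<sigma> = M then G \<sigma> else 0)"
    unfolding grade_sum by (intro init_coeff_sum) auto
  from init_coeff_mult[OF grade_scalar[of w "inverse (hl_v lam n)"] this]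
  have "init_coeff (grade w (hall_littlewood_P lam n)) (- int M)
     (scalar (inverse (hl_v lam n)) * (\<Sum>\<sigma> | \<sigma> permutes {..<n}. if W \<sigma> = M then G \<sigma> else 0))"
    using len by (simp add: hall_littlewood_P_def F_def grade_mult tx_def)
  also have "(\<Sum>\<sigma> | \<sigma> permutes {..<n}. if W \<sigma> = M then G \<sigma> else 0) = (\<Sum>\<sigma> | \<sigma> permutes {..<n} \<and> W \<sigma> = M. G \<sigma>)"
    by (subst sum.inter_filter[symmetric]) (auto simp: finite_permutations)
  finally show ?thesis
    unfolding G_def W_def .
qed

section \<open>Leading monomials of the Hall--Littlewood functions\<close>

lemma range_to_fract_mult: "f \<in> range to_fract \<Longrightarrow> g \<in> range to_fract \<Longrightarrow> f * g \<in> range to_fract"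
  by (auto simp flip: to_fract_mult)

lemma range_to_fract_add: "f \<in> range to_fract \<Longrightarrow> g \<in> range to_fract \<Longrightarrow> f + g \<in> range to_fract"
  by (auto simp flip: to_fract_add)

lemma range_to_fract_diff: "f \<in> range to_fract \<Longrightarrow> g \<in> range to_fract \<Longrightarrow> f - g \<in> range to_fract"
  by (auto simp flip: to_fract_diff)

lemma range_to_fract_sum: "(\<And>i. i \<in> A \<Longrightarrow> f i \<in> range to_fract) \<Longrightarrow> sum f A \<in> range to_fract"
  by (induction A rule: infinite_finite_induct) (auto intro: range_eqI[of _ _ 0] range_to_fract_add)

lemma range_to_fract_power: "f \<in> range to_fract \<Longrightarrow> f ^ n \<in> range to_fract"
  by (auto simp flip: to_fract_power)

lemma scalar_in_range: "scalar c \<in> range to_fract"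
  by (simp add: scalar_def)

lemma xvar_in_range: "xvar i \<in> range to_fract"
  by (simp add: xvar_def)

lemma one_in_range: "1 \<in> range to_fract"
  by (metis rangeI to_fract_1)

lemma lspan_in_range:
  assumes "f \<in> lspan D K B I" "d \<in> D" "\<And>i. i \<in> I \<Longrightarrow> B i d \<in> range to_fract"
  shows "f d \<in> range to_fract"
proof -
  obtain S c where "S \<subseteq> I" "f d = (\<Sum>i\<in>S. scalar (c i) * B i d)"
    using assms(1,2) unfolding lspan_def by blast
  then show ?thesis
    using assms(3) by (auto intro!: range_to_fract_sum range_to_fract_mult scalar_in_range)
qed

lemma qprod_in_range: "qprod tx al {..<n} \<in> range to_fract"
proof -
  have "scaled_power_sum l (tx, n) \<in> range to_fract" for l
    unfolding scaled_power_sum_def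
    by (induction l)
       (auto simp: tx_def intro!: one_in_range range_to_fract_mult range_to_fract_diff range_to_fract_power
         range_to_fract_sum scalar_in_range xvar_in_range)
  then have "(\<lambda>(s, n). qcoef s xvar {..<n} k) (tx, n) \<in> range to_fract" for k
    by (intro lspan_in_range[OF qcoef_in_scaled_power_sum_span]) (auto simp: subst_dom_def)
  then show ?thesis
    by (induction al) (auto intro: one_in_range range_to_fract_mult)
qed

lemma hall_littlewood_P_eq_Q: "hall_littlewood_P lam n = scalar (inverse (hl_b lam)) * hall_littlewood_Q lam n"
  by (simp add: hall_littlewood_Q_def scalar_inverse)

lemma hall_littlewood_P_in_range:
  assumes "is_partition lam"
  shows "hall_littlewood_P lam n \<in> range to_fract"
proof -
  have "(\<lambda>V. hlQ lam V - qprod tx lam V)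
    \<in> lspan {V. finite V} Zt (qprod tx) {be. dominance_le lam be \<and> be \<noteq> lam \<and> length be = length lam}"
    using assms by (intro hlQ_minus_qprod) (simp add: is_partition_def)
  from lspan_in_range[OF this, of "{..<n}"]
  have "hlQ lam {..<n} - qprod tx lam {..<n} \<in> range to_fract"
    by (simp add: qprod_in_range)
  then have "hlQ lam {..<n} \<in> range to_fract"
    using range_to_fract_add[OF _ qprod_in_range, of "hlQ lam {..<n} - qprod tx lam {..<n}" lam n] by simp
  then show ?thesis
    unfolding hall_littlewood_P_eq_Q hall_littlewood_Q_hlQ by (intro range_to_fract_mult scalar_in_range)
qed

lemma weight_list_exp: "weight w (list_exp l) = (\<Sum>i<length l. l ! i * w i)"
  by (simp add: list_exp_def weight_sum mult.commute)

lemma psum_conv_length: "psum l j = (\<Sum>i<length l. l ! i * (if i < j then 1 else 0))"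
proof -
  have "psum l j = (\<Sum>i\<in>{..<length l} \<inter> {..<j}. l ! i)"
    unfolding psum_def by (rule sum.mono_neutral_cong_right) (auto simp: part_def)
  also have "\<dots> = (\<Sum>i<length l. if i \<in> {..<j} then l ! i else 0)"
    by (rule sum.inter_restrict) simp
  also have "\<dots> = (\<Sum>i<length l. l ! i * (if i < j then 1 else 0))"
    by (intro sum.cong) auto
  finally show ?thesis .
qed

text \<open>An injection sends at most j indices below j, and at most j parts of lam add up to no
  more than its first j.\<close>

lemma permuted_psum_le:
  assumes "is_partition lam" "\<sigma> permutes {..<n}"
  shows "(\<Sum>i<length lam. lam ! i * (if \<sigma> i < j then 1 else 0)) \<le> psum lam j"
proof -
  let ?A = "{i \<in> {..<length lam}. \<sigma> i < j}"
  have inj: "inj_on \<sigma> ?A"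
    using permutes_inj_on[OF assms(2)] .
  have "card ?A = card (\<sigma> ` ?A)"
    using inj by (simp add: card_image)
  also have "\<dots> \<le> j"
    using card_mono[of "{..<j}" "\<sigma> ` ?A"] by auto
  finally have "card ?A \<le> j" .
  have "(\<Sum>i<length lam. lam ! i * (if \<sigma> i < j then 1 else 0)) = (\<Sum>i\<in>?A. lam ! i)"
    by (subst sum.inter_filter) (auto intro!: sum.cong)
  also have "\<dots> = sum (part lam) ?A"
    by (intro sum.cong) (auto simp: part_def)
  also have "\<dots> \<le> psum lam (card ?A)"
    unfolding psum_def using assms(1) by (intro sum_antimono_le_sum_lessThan antimono_part) (auto simp: is_partition_def)
  also have "\<dots> \<le> psum lam j"
    unfolding psum_def using \<open>card ?A \<le> j\<close> by (intro sum_mono2) auto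
  finally show ?thesis .
qed

text \<open>Give weight 1 to the first j variables. Then x^mu has weight \<open>psum mu j\<close>,
  while no summand of P exceeds \<open>psum lam j\<close>; a larger prefix sum would put a term
  below the initial order.\<close>

lemma hall_littlewood_P_support:
  assumes lam: "is_partition lam" and nz: "xcoeff (hall_littlewood_P lam n) (list_exp mu) \<noteq> 0"
  shows "psum mu j \<le> psum lam j"
proof (rule ccontr)
  assume less: "\<not> psum mu j \<le> psum lam j"
  define w where "w i = (if i < j then 1 else 0 :: nat)" for i
  obtain p where p: "hall_littlewood_P lam n = to_fract p"
    using hall_littlewood_P_in_range[OF lam] by blast
  have len: "length lam \<le> n"
    using nz xcoeff_to_fract[of 0] by (cases "length lam \<le> n") (auto simp: hall_littlewood_P_def)
  note ic = init_coeff_hall_littlewood_P[OF len, of w "psum lam j"]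
  have "fls_nth (grade w (hall_littlewood_P lam n)) (- int (psum mu j)) = 0"
    using ic permuted_psum_le[OF lam, of _ n j] less by (auto simp: init_coeff_def w_def)
  then have "0 = xcoeff (fls_nth (grade_poly w p) (- int (weight w (list_exp mu)))) (list_exp mu)"
    using xcoeff_to_fract[of 0] by (simp add: p grade_to_fract weight_list_exp w_def flip: psum_conv_length)
  also have "\<dots> = xcoeff (hall_littlewood_P lam n) (list_exp mu)"
    by (simp add: xcoeff_grade_poly p)
  finally show False
    using nz by simp
qed

text \<open>A strictly decreasing weight separates all variables, so every quotient reduces to 1 or
  t. Up to normalization the coefficient of x^lam is then a sum of powers of t that includes a term
  for the identity; at t = 1 it is a positive count, hence it is not 0.\<close>

lemma hall_littlewood_P_lead:
  assumes lam: "is_partition lam" and len: "length lam \<le> n"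
  shows "xcoeff (hall_littlewood_P lam n) (list_exp lam) \<noteq> 0"
proof -
  \<comment> \<open>n - i counts the j with 1 \<le> j \<le> n and i < j. So this weight is the sum
    of the prefix weights used for the support, each of which is maximal at the identity.\<close>
  define w where "w i = n - i" for i
  define M where "M = (\<Sum>j=1..n. psum lam j)"
  have w: "w i = (\<Sum>j=1..n. if i < j then 1 else 0)" for i
  proof -
    have "(\<Sum>j=1..n. if i < j then 1 else 0) = card {j \<in> {1..n}. i < j}"
      by (simp add: sum.inter_filter[symmetric])
    also have "{j \<in> {1..n}. i < j} = {Suc i..n}"
      by auto
    finally show ?thesis by (simp add: w_def)
  qed
  have W: "(\<Sum>i<length lam. lam ! i * w (\<sigma> i)) = (\<Sum>j=1..n. \<Sum>i<length lam. lam ! i * (if \<sigma> i < j then 1 else 0))" for \<sigma>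
    unfolding w sum_distrib_left by (rule sum.swap)
  have M: "(\<Sum>i<length lam. lam ! i * w (\<sigma> i)) \<le> M" if "\<sigma> permutes {..<n}" for \<sigma>
    unfolding W M_def using permuted_psum_le[OF lam that] by (intro sum_mono) auto
  have M_id: "(\<Sum>i<length lam. lam ! i * w i) = M"
    using W[of "\<lambda>i. i"] by (simp add: M_def psum_conv_length)
  define S where "S = {\<sigma>. \<sigma> permutes {..<n} \<and> (\<Sum>i<length lam. lam ! i * w (\<sigma> i)) = M}"
  define E where "E \<sigma> = (\<Sum>i<length lam. Poly_Mapping.single (\<sigma> i) (lam ! i))" for \<sigma> :: "nat \<Rightarrow> nat"
  define g where "g \<sigma> = (\<Prod>j<n. \<Prod>i<j. if \<sigma> i < \<sigma> j then 1 else [:0, 1:] :: int poly)" for \<sigma> :: "nat \<Rightarrow> nat"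
  obtain p where p: "hall_littlewood_P lam n = to_fract p"
    using hall_littlewood_P_in_range[OF lam] by blast
  have ratio: "(\<Prod>j<n. \<Prod>i<j. lead_ratio w (\<sigma> i) (\<sigma> j)) = scalar (to_fract (g \<sigma>))" if \<sigma>: "\<sigma> permutes {..<n}" for \<sigma>
    unfolding g_def to_fract_prod scalar_prod
  proof (intro prod.cong refl)
    fix i j assume ij: "j \<in> {..<n}" "i \<in> {..<j}"
    have "\<sigma> i < n" "\<sigma> j < n" "\<sigma> i \<noteq> \<sigma> j"
      using ij permutes_in_image[OF \<sigma>] permutes_inj[OF \<sigma>] by (auto dest: injD)
    then show "lead_ratio w (\<sigma> i) (\<sigma> j) = scalar (to_fract (if \<sigma> i < \<sigma> j then 1 else [:0, 1:]))"
      by (auto simp: lead_ratio_def w_def tx_def tt_def)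
  qed
  have mono: "(\<Prod>i<length lam. xvar (\<sigma> i) ^ (lam ! i)) = to_fract (Poly_Mapping.single (E \<sigma>) 1)" for \<sigma>
    unfolding E_def by (simp add: xvar_power prod_single flip: to_fract_prod)
  have "fls_nth (grade_poly w p) (- int M) =
     scalar (inverse (hl_v lam n)) * (\<Sum>\<sigma>\<in>S. to_fract (Poly_Mapping.single (E \<sigma>) 1) * scalar (to_fract (g \<sigma>)))"
    using init_coeff_hall_littlewood_P[OF len M] ratio
    unfolding p grade_to_fract init_coeff_def by (simp add: S_def mono)
  also have "\<dots> = (\<Sum>\<sigma>\<in>S. scalar (inverse (hl_v lam n) * to_fract (g \<sigma>)) * to_fract (Poly_Mapping.single (E \<sigma>) 1))"
    by (simp add: sum_distrib_left scalar_mult mult_ac)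
  finally have "xcoeff (fls_nth (grade_poly w p) (- int M)) (list_exp lam) =
     (\<Sum>\<sigma>\<in>S. inverse (hl_v lam n) * to_fract (g \<sigma>) * xcoeff (to_fract (Poly_Mapping.single (E \<sigma>) 1)) (list_exp lam))"
    by (simp only: xcoeff_lincomb rangeI)
  moreover have "weight w (list_exp lam) = M"
    using M_id by (simp add: weight_list_exp)
  ultimately have "xcoeff (hall_littlewood_P lam n) (list_exp lam) =
     inverse (hl_v lam n) * (\<Sum>\<sigma>\<in>S. if E \<sigma> = list_exp lam then to_fract (g \<sigma>) else 0)"
    by (simp add: xcoeff_grade_poly p sum_distrib_left lookup_single when_def if_distrib cong: if_cong)
  also have "(\<Sum>\<sigma>\<in>S. if E \<sigma> = list_exp lam then to_fract (g \<sigma>) else 0) = to_fract (\<Sum>\<sigma>\<in>{\<sigma>\<in>S. E \<sigma> = list_exp lam}. g \<sigma>)"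
    unfolding to_fract_sum by (subst sum.inter_filter) (auto simp: S_def finite_permutations)
  finally have main: "xcoeff (hall_littlewood_P lam n) (list_exp lam) =
     inverse (hl_v lam n) * to_fract (\<Sum>\<sigma>\<in>{\<sigma>\<in>S. E \<sigma> = list_exp lam}. g \<sigma>)" .
  have "poly (if b then 1 else [:0, 1:]) 1 = (1 :: int)" for b
    by simp
  then have "poly (g \<sigma>) 1 = 1" for \<sigma>
    unfolding g_def poly_prod by simp
  then have "poly (\<Sum>\<sigma>\<in>{\<sigma>\<in>S. E \<sigma> = list_exp lam}. g \<sigma>) 1 = int (card {\<sigma>\<in>S. E \<sigma> = list_exp lam})"
    by (simp add: poly_sum)
  moreover have "id \<in> {\<sigma>\<in>S. E \<sigma> = list_exp lam}"
    using M_id by (simp add: S_def E_def list_exp_def permutes_id)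
  moreover have "finite {\<sigma>\<in>S. E \<sigma> = list_exp lam}"
    by (simp add: S_def finite_permutations)
  ultimately have "poly (\<Sum>\<sigma>\<in>{\<sigma>\<in>S. E \<sigma> = list_exp lam}. g \<sigma>) 1 \<noteq> 0"
    by (metis card_0_eq empty_iff of_nat_eq_0_iff)
  then have "(\<Sum>\<sigma>\<in>{\<sigma>\<in>S. E \<sigma> = list_exp lam}. g \<sigma>) \<noteq> 0"
    by (metis poly_0)
  then have "to_fract (\<Sum>\<sigma>\<in>{\<sigma>\<in>S. E \<sigma> = list_exp lam}. g \<sigma>) \<noteq> 0"
    by (simp only: to_fract_eq_0_iff not_False_eq_True)
  then show ?thesis
    unfolding main mult_eq_0_iff inverse_nonzero_iff_nonzero by (simp only: hl_v_nonzero simp_thms)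
qed

text \<open>Prefix sums order partitions also when their sizes differ; on partitions of the same size
  this is dominance.\<close>

definition psum_le :: "nat list \<Rightarrow> nat list \<Rightarrow> bool" where
  "psum_le mu nu \<longleftrightarrow> (\<forall>j. psum mu j \<le> psum nu j)"

lemma psum_le_trans: "psum_le a b \<Longrightarrow> psum_le b c \<Longrightarrow> psum_le a c"
  unfolding psum_le_def by (metis order.trans)

lemma psum_le_antisym: "is_partition a \<Longrightarrow> is_partition b \<Longrightarrow> psum_le a b \<Longrightarrow> psum_le b a \<Longrightarrow> a = b"
  unfolding psum_le_def by (intro partition_eqI) (auto intro: order.antisym)

text \<open>Take a maximal nu among the indices that violate Q. Any other P_mu containing x^nu has
  mu above nu, so mu violates Q too and maximality excludes it; hence x^nu occurs in f, contrary to
  \<open>supp\<close>. The constant predicate False yields independence, and being below lam yields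
  the triangularity of the Kostka-Foulkes matrix.\<close>

lemma hall_littlewood_P_triangular:
  assumes S: "finite S" "S \<subseteq> Collect is_partition"
    and f: "\<And>n. f n = (\<Sum>\<mu>\<in>S. scalar (c \<mu>) * hall_littlewood_P \<mu> n)"
    and supp: "\<And>\<nu> n. is_partition \<nu> \<Longrightarrow> xcoeff (f n) (list_exp \<nu>) \<noteq> 0 \<Longrightarrow> Q \<nu>"
    and down: "\<And>\<mu> \<nu>. psum_le \<nu> \<mu> \<Longrightarrow> Q \<mu> \<Longrightarrow> Q \<nu>"
    and \<mu>: "\<mu> \<in> S" "c \<mu> \<noteq> 0"
  shows "Q \<mu>"
proof (rule ccontr)
  assume "\<not> Q \<mu>"
  define T where "T = {\<mu>\<in>S. c \<mu> \<noteq> 0 \<and> \<not> Q \<mu>}"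
  have T: "finite T" "T \<noteq> {}" "T \<subseteq> Collect is_partition"
    using S \<mu> \<open>\<not> Q \<mu>\<close> by (auto simp: T_def)
  have "\<exists>m\<in>T. \<forall>x\<in>T. x \<noteq> m \<longrightarrow> \<not> (psum_le m x \<and> m \<noteq> x)"
  proof (rule Finite_Set.bex_max_element[OF T(1) _ _ T(2)])
    show "asymp_on T (\<lambda>m x. psum_le m x \<and> m \<noteq> x)"
      using T(3) psum_le_antisym by (intro asymp_onI) blast
    show "transp_on T (\<lambda>m x. psum_le m x \<and> m \<noteq> x)"
      using T(3) psum_le_antisym psum_le_trans by (intro transp_onI) blast
  qed
  then obtain \<nu> where \<nu>: "\<nu> \<in> T" and max: "\<And>\<mu>. \<mu> \<in> T \<Longrightarrow> psum_le \<nu> \<mu> \<Longrightarrow> \<mu> = \<nu>"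
    by blast
  have \<nu>_part: "is_partition \<nu>" and \<nu>_S: "\<nu> \<in> S" and \<nu>_c: "c \<nu> \<noteq> 0" and \<nu>_Q: "\<not> Q \<nu>"
    using \<nu> T(3) by (auto simp: T_def)
  \<comment> \<open>As many variables as nu has parts: enough for
    \<open>hall_littlewood_P_lead\<close>.\<close>
  let ?n = "length \<nu>" and ?a = "list_exp \<nu>"
  have "0 = xcoeff (f ?n) ?a"
    using supp[OF \<nu>_part] \<nu>_Q by metis
  also have "\<dots> = (\<Sum>\<mu>\<in>S. c \<mu> * xcoeff (hall_littlewood_P \<mu> ?n) ?a)"
    unfolding f using S(2) by (intro xcoeff_lincomb hall_littlewood_P_in_range) auto
  also have "\<dots> = (\<Sum>\<mu>\<in>{\<nu>}. c \<mu> * xcoeff (hall_littlewood_P \<mu> ?n) ?a)"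
  proof (rule sum.mono_neutral_right)
    show "\<forall>\<mu>\<in>S - {\<nu>}. c \<mu> * xcoeff (hall_littlewood_P \<mu> ?n) ?a = 0"
    proof (rule ballI, rule ccontr)
      fix \<mu> assume \<mu>: "\<mu> \<in> S - {\<nu>}" and nz: "c \<mu> * xcoeff (hall_littlewood_P \<mu> ?n) ?a \<noteq> 0"
      have "is_partition \<mu>"
        using \<mu> S(2) by auto
      then have le: "psum_le \<nu> \<mu>"
        using hall_littlewood_P_support[of \<mu> ?n \<nu>] nz by (simp add: psum_le_def)
      then have "\<mu> \<in> T"
        using \<mu> nz down \<nu>_Q by (auto simp: T_def)
      then show False
        using max le \<mu> by blast
    qed
  qed (use S \<nu>_S in auto)
  finally show False
    using hall_littlewood_P_lead[OF \<nu>_part] \<nu>_c by simp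
qed

lemma indep_hall_littlewood_P: "indep_family hall_littlewood_P"
  unfolding indep_family_def
proof (intro allI impI ballI, rule ccontr)
  fix S c \<nu> assume S: "finite S" "S \<subseteq> Collect is_partition"
    and zero: "\<forall>n. (\<Sum>\<nu>\<in>S. scalar (c \<nu>) * hall_littlewood_P \<nu> n) = 0" and "\<nu> \<in> S" "c \<nu> \<noteq> 0"
  show False
    by (rule hall_littlewood_P_triangular[OF S, of "\<lambda>_. 0" c "\<lambda>_. False"])
       (use zero \<open>\<nu> \<in> S\<close> \<open>c \<nu> \<noteq> 0\<close> xcoeff_to_fract[of 0] in auto)
qed

lemma indep_hall_littlewood_Q: "indep_family hall_littlewood_Q"
  unfolding indep_family_def
proof (intro allI impI)
  fix S c assume S: "finite S" "S \<subseteq> Collect is_partition"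
    and zero: "\<forall>n. (\<Sum>\<nu>\<in>S. scalar (c \<nu>) * hall_littlewood_Q \<nu> n) = 0"
  have "\<forall>n. (\<Sum>\<nu>\<in>S. scalar (c \<nu> * hl_b \<nu>) * hall_littlewood_P \<nu> n) = 0"
    using zero by (simp add: hall_littlewood_Q_def scalar_mult mult.assoc)
  then have "\<forall>\<nu>\<in>S. c \<nu> * hl_b \<nu> = 0"
    using indep_hall_littlewood_P S unfolding indep_family_def by (metis (no_types))
  then show "\<forall>\<nu>\<in>S. c \<nu> = 0"
    by simp
qed

section \<open>The Kostka--Foulkes and inverse \<open>t\<close>-Kostka coefficients\<close>

text \<open>Columns increase strictly, so entries in row i are at least i; hence all entries below j
  sit in the first j rows.\<close>

lemma schur_support:
  assumes lam: "is_partition lam" and nz: "xcoeff (schur lam n) (list_exp nu) \<noteq> 0"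
  shows "psum_le nu lam"
  unfolding psum_le_def
proof
  fix j :: nat
  let ?D = "skew_diagram lam []"
  have anti: "antimono (part lam)"
    using lam by (intro antimono_part) (simp add: is_partition_def)
  have D: "(i, k) \<in> ?D \<longleftrightarrow> k < part lam i" for i k
    by (simp add: skew_diagram_def)
  have fin: "finite ?D"
    unfolding skew_diagram_fdiag by (rule finite_fdiag[of "length lam"]) (simp add: part_def)
  have schur: "schur lam n = to_fract (\<Sum>T\<in>ssyt lam [] n. Poly_Mapping.single (\<Sum>c\<in>?D. Poly_Mapping.single (T c) 1) 1)"
    unfolding skew_schur_def xvar_def to_fract_prod[symmetric] prod_single prod.neutral_const to_fract_sum ..
  have "(\<Sum>T\<in>ssyt lam [] n. Poly_Mapping.lookup (Poly_Mapping.single (\<Sum>c\<in>?D. Poly_Mapping.single (T c) 1) 1) (list_exp nu)) \<noteq> (0 :: qt)"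
    using nz unfolding schur xcoeff_to_fract lookup_sum .
  then obtain T where T: "T \<in> ssyt lam [] n" and eq: "(\<Sum>c\<in>?D. Poly_Mapping.single (T c) 1) = list_exp nu"
    by (auto elim!: sum.not_neutral_contains_not_neutral simp: lookup_single when_def split: if_splits)
  have row: "i \<le> T (i, k)" if "(i, k) \<in> ?D" for i k
    using that
  proof (induction i)
    case (Suc i)
    then have "(i, k) \<in> ?D"
      using antimonoD[OF anti, of i "Suc i"] by (simp add: D)
    moreover from this have "T (i, k) < T (Suc i, k)"
      using T Suc.prems by (auto simp: ssyt_def)
    ultimately show ?case
      using Suc.IH by simp
  qed simp
  define w where "w i = (if i < j then 1 else 0 :: nat)" for i
  have "psum nu j = weight w (list_exp nu)"
    by (simp add: weight_list_exp w_def psum_conv_length)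
  also have "\<dots> = (\<Sum>c\<in>?D. w (T c))"
    by (simp add: weight_sum flip: eq)
  also have "\<dots> \<le> (\<Sum>c\<in>?D. w (fst c))"
    using row by (intro sum_mono) (force simp: w_def)
  also have "\<dots> = card {c \<in> ?D. fst c < j}"
    using fin by (simp add: w_def sum.inter_filter[symmetric])
  also have "{c \<in> ?D. fst c < j} = Sigma {..<j} (\<lambda>i. {..<part lam i})"
    by (auto simp: D)
  also have "card \<dots> = psum lam j"
    by (simp add: psum_def)
  finally show "psum nu j \<le> psum lam j" .
qed

section \<open>Existence of the Kostka-Foulkes expansion\<close>

abbreviation qprod_span :: "symfun set" where
  "qprod_span \<equiv> lspan UNIV UNIV (\<lambda>al n. qprod tx al {..<n}) UNIV"

lemma qprod_span_mult: "f \<in> qprod_span \<Longrightarrow> g \<in> qprod_span \<Longrightarrow> (\<lambda>n. f n * g n) \<in> qprod_span"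
proof (erule (1) lspan_mult[OF coeff_ring_UNIV])
  fix i j :: "nat list"
  have "(\<lambda>n. qprod tx (i @ j) {..<n}) \<in> qprod_span"
    by (rule lspan_base[OF coeff_ring_UNIV]) simp
  then show "(\<lambda>n. qprod tx i {..<n} * qprod tx j {..<n}) \<in> qprod_span"
    by (simp add: qprod_def)
qed

lemma qcoef_in_qprod_span: "(\<lambda>n. qcoef tx xvar {..<n} k) \<in> qprod_span"
  by (rule lspan_cong[OF lspan_base[OF coeff_ring_UNIV, of "[k]"]]) auto

text \<open>Newton's identities solved for p_k instead of q_k: the coefficient of p_k is 1 - t^k,
  which is invertible in \<rat>(t) but not in \<int>[t].\<close>

lemma power_sum_in_qprod_span: "k > 0 \<Longrightarrow> (\<lambda>n. \<Sum>i<n. xvar i ^ k) \<in> qprod_span"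
proof (induction k rule: less_induct)
  case (less k)
  define m where "m = k - 1"
  have k: "k = Suc m" using less.prems by (simp add: m_def)
  define p where "p r n = (\<Sum>i<n. xvar i ^ r)" for r n
  define R where "R n = (\<Sum>j\<in>{1..m}. scalar (1 - tt ^ Suc (m - j)) * (qcoef tx xvar {..<n} j * p (Suc (m - j)) n))" for n
  have "R \<in> qprod_span"
    unfolding R_def
  proof (intro lspan_sum lspan_scale coeff_ring_UNIV qprod_span_mult qcoef_in_qprod_span UNIV_I)
    fix j assume "j \<in> {1..m}"
    then show "(\<lambda>n. p (Suc (m - j)) n) \<in> qprod_span"
      unfolding p_def by (intro less.IH) (auto simp: k)
  qed
  then have "(\<lambda>n. scalar (inverse (1 - tt ^ k)) * (scalar (of_nat k) * qcoef tx xvar {..<n} k - R n)) \<in> qprod_span"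
    by (intro lspan_scale lspan_diff coeff_ring_UNIV qcoef_in_qprod_span UNIV_I)
  then show ?case
  proof (rule lspan_cong)
    fix n
    have "scalar (of_nat k) * qcoef tx xvar {..<n} k =
        (\<Sum>j\<le>m. scalar (1 - tt ^ Suc (m - j)) * (qcoef tx xvar {..<n} j * p (Suc (m - j)) n))"
      unfolding k scalar_of_nat p_def scalar_diff scalar_power tx_def[symmetric] scalar_1
      by (subst qcoef_newton) (simp_all only: finite_lessThan mult_ac)
    \<comment> \<open>The term j = 0 isolates p_k, since q_0 = 1.\<close>
    also have "{..m} = insert 0 {1..m}"
      by auto
    also have "(\<Sum>j\<in>insert 0 {1..m}. scalar (1 - tt ^ Suc (m - j)) * (qcoef tx xvar {..<n} j * p (Suc (m - j)) n)) =
        scalar (1 - tt ^ k) * p k n + R n"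
      by (subst sum.insert) (simp_all add: R_def k)
    finally have "scalar (of_nat k) * qcoef tx xvar {..<n} k - R n = scalar (1 - tt ^ k) * p k n"
      by simp
    moreover have "scalar (inverse (1 - tt ^ k)) * scalar (1 - tt ^ k) = 1"
      using one_minus_tt_power[OF less.prems] by (simp flip: scalar_mult)
    ultimately show "(\<Sum>i<n. xvar i ^ k) =
        scalar (inverse (1 - tt ^ k)) * (scalar (of_nat k) * qcoef tx xvar {..<n} k - R n)"
      by (metis (no_types, lifting) mult.assoc mult_1 p_def)
  qed
qed

text \<open>The chain of spans is power sums, q products, Q, P. Existence must be settled before the
  \<open>THE\<close> in \<open>kostka_foulkes\<close> denotes anything.\<close>

lemma schur_in_P_span:
  assumes lam: "is_partition lam"
  shows "schur lam \<in> lspan UNIV UNIV hall_littlewood_P (Collect is_partition)"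
proof -
  let ?l = "length lam"
  let ?J = "\<lambda>(s, n). jacobi_trudi s ?l n (\<lambda>i. part lam i + (?l - Suc i)) (\<lambda>i. part [] i + (?l - Suc i))"
  have "?J \<in> scaled_power_sum_span"
    by (rule jacobi_trudi_in_scaled_power_sum_span)
  then have "(\<lambda>n. ?J (0, n)) \<in> lspan UNIV UNIV (\<lambda>i n. scaled_power_sum i (0, n)) (Collect is_partition)"
    by (rule lspan_comp[OF coeff_ring_UNIV]) (simp add: subst_dom_def)
  moreover have "(\<lambda>n. ?J (0, n)) = schur lam"
    using subst_1mt_skew_schur(1)[OF lam, of "[]"] by (simp add: is_partition_def partition_subset_def fun_eq_iff)
  ultimately have "schur lam \<in> lspan UNIV UNIV (\<lambda>i n. scaled_power_sum i (0, n)) (Collect is_partition)"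
    by simp
  then have "schur lam \<in> qprod_span"
  proof (rule lspan_trans[OF coeff_ring_UNIV])
    fix nu assume "nu \<in> Collect is_partition"
    then have "0 \<notin> set nu" by (simp add: is_partition_def)
    then have "(\<lambda>n. \<Prod>r\<leftarrow>nu. \<Sum>i<n. xvar i ^ r) \<in> qprod_span"
    proof (induction nu)
      case Nil
      show ?case
        by (rule lspan_cong[OF lspan_base[OF coeff_ring_UNIV, of "[]"]]) auto
    next
      case (Cons r nu)
      then show ?case
        using qprod_span_mult[OF power_sum_in_qprod_span[of r]] by simp
    qed
    then show "(\<lambda>n. scaled_power_sum nu (0, n)) \<in> qprod_span"
      using \<open>nu \<in> _\<close> by (simp add: scaled_power_sum_0 power_sum_def)
  qed
  then have "schur lam \<in> lspan UNIV UNIV hall_littlewood_Q (Collect is_partition)"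
  proof (rule lspan_trans[OF coeff_ring_UNIV])
    fix al
    show "(\<lambda>n. qprod tx al {..<n}) \<in> lspan UNIV UNIV hall_littlewood_Q (Collect is_partition)"
      by (rule lspan_mono[OF lspan_mono_ring[OF qprod_lspan_hall_littlewood_Q]]) (auto simp: up_set_def)
  qed
  then show ?thesis
  proof (rule lspan_trans[OF coeff_ring_UNIV])
    fix nu assume "nu \<in> Collect is_partition"
    then have "(\<lambda>n. scalar (hl_b nu) * hall_littlewood_P nu n) \<in> lspan UNIV UNIV hall_littlewood_P (Collect is_partition)"
      by (intro lspan_scaled_base coeff_ring_UNIV UNIV_I)
    then show "hall_littlewood_Q nu \<in> lspan UNIV UNIV hall_littlewood_P (Collect is_partition)"
      by (simp add: hall_littlewood_Q_def[abs_def])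
  qed
qed

lemma kostka_foulkes_support:
  assumes lam: "is_partition lam" and nz: "kostka_foulkes lam nu \<noteq> 0"
  shows "psum_le nu lam"
proof -
  obtain c where c: "has_expansion hall_littlewood_P (schur lam) c"
    using schur_in_P_span[OF lam] by (rule lspan_has_expansion) auto
  then have "kostka_foulkes lam = c"
    using expansion_coeff_eqI[OF indep_hall_littlewood_P c] by (simp add: kostka_foulkes_def[abs_def])
  then have "c nu \<noteq> 0"
    using nz by simp
  show ?thesis
  proof (rule hall_littlewood_P_triangular[where Q = "\<lambda>\<nu>. psum_le \<nu> lam" and f = "schur lam" and c = c and S = "{\<nu>. c \<nu> \<noteq> 0}"])
    show "finite {\<nu>. c \<nu> \<noteq> 0}" "{\<nu>. c \<nu> \<noteq> 0} \<subseteq> Collect is_partition"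
      "\<And>n. schur lam n = (\<Sum>\<mu> | c \<mu> \<noteq> 0. scalar (c \<mu>) * hall_littlewood_P \<mu> n)"
      using c by (auto simp: has_expansion_def)
  qed (use \<open>c nu \<noteq> 0\<close> psum_le_trans schur_support[OF lam] in auto)
qed

section \<open>From the determinant in the q's to coefficients of Q functions\<close>

lemma prod_jt_entry:
  "(\<Prod>i<l. jt_entry s n (be i) (c i)) =
     (if \<forall>i<l. c i \<le> be i then qprod s (map (\<lambda>i. be i - c i) [0..<l]) {..<n} else 0)"
proof (cases "\<forall>i<l. c i \<le> be i")
  case True
  then show ?thesis
    by (simp add: qprod_def jt_entry_def prod_list_nth)
next
  case False
  then show ?thesis
    by (auto simp: jt_entry_def intro!: prod_zero)
qed

lemma scalar_sign: "scalar (of_int (sign \<sigma>)) = of_int (sign \<sigma>)"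
  by (cases \<sigma> rule: sign_cases) (auto simp: scalar_uminus)

lemma sign_in_Zt: "of_int (sign \<sigma>) \<in> Zt"
  by (cases \<sigma> rule: sign_cases) (auto simp: Zt_uminus)

text \<open>The set A of permutations is left free: all of them give integrality, all but the
  identity give the remainder strictly above lam.\<close>

lemma jacobi_trudi_in_Q_span:
  assumes "\<And>\<sigma>. \<sigma> \<in> A \<Longrightarrow> \<forall>i<l. c (\<sigma> i) \<le> be i \<Longrightarrow> up_set (map (\<lambda>i. be i - c (\<sigma> i)) [0..<l]) \<subseteq> I"
  shows "(\<lambda>n. \<Sum>\<sigma>\<in>A. of_int (sign \<sigma>) * (\<Prod>i<l. jt_entry tx n (be i) (c (\<sigma> i)))) \<in> lspan D Zt hall_littlewood_Q I"
proof -
  have "(\<lambda>n. \<Prod>i<l. jt_entry tx n (be i) (c (\<sigma> i))) \<in> lspan D Zt hall_littlewood_Q I" if "\<sigma> \<in> A" for \<sigma>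
  proof (cases "\<forall>i<l. c (\<sigma> i) \<le> be i")
    case True
    then show ?thesis
      using lspan_mono[OF qprod_lspan_hall_littlewood_Q assms[OF that]]
      by (simp add: prod_jt_entry[where c = "\<lambda>i. c (\<sigma> i)"])
  next
    case False
    show ?thesis
      unfolding prod_jt_entry[where c = "\<lambda>i. c (\<sigma> i)"] if_not_P[OF False] by (rule lspan_zero[OF coeff_ring_Zt])
  qed
  then have "(\<lambda>n. \<Sum>\<sigma>\<in>A. scalar (of_int (sign \<sigma>)) * (\<Prod>i<l. jt_entry tx n (be i) (c (\<sigma> i)))) \<in> lspan D Zt hall_littlewood_Q I"
    by (intro lspan_sum lspan_scale coeff_ring_Zt sign_in_Zt)
  then show ?thesis
    by (simp only: scalar_sign)
qed

lemma inv_kostka_skew_in_Zt: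
  assumes "is_partition lam" "is_partition mu" "partition_subset mu lam"
  shows "inv_kostka_skew lam mu nu \<in> Zt"
proof -
  have "subst_1mt (skew_schur lam mu) \<in> lspan UNIV Zt hall_littlewood_Q (Collect is_partition)"
    unfolding subst_1mt_skew_schur(2)[OF assms, abs_def] jacobi_trudi_def
    by (rule jacobi_trudi_in_Q_span) (auto simp: up_set_def)
  then obtain c where c: "has_expansion hall_littlewood_Q (subst_1mt (skew_schur lam mu)) c" "\<And>i. c i \<in> Zt"
    by (rule lspan_has_expansion) auto
  then show ?thesis
    by (simp add: inv_kostka_skew_def expansion_coeff_eqI[OF indep_hall_littlewood_Q c(1)])
qed

lemma psum_min: "psum l j = (\<Sum>i<min j (length l). l ! i)"
  unfolding psum_def by (rule sum.mono_neutral_cong_right) (auto simp: part_def)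

lemma sum_list_psum: "sum_list l = psum l (length l)"
  by (simp add: psum_min sum_list_sum_nth atLeast0LessThan)

text \<open>Without the staircase shifts the index is \<lambda>_i + \<sigma>(i) - i, and the first m
  values of \<sigma> add up to at least 0 + ... + (m - 1).\<close>

lemma jacobi_trudi_index_dominates:
  assumes \<sigma>: "\<sigma> permutes {..<l}" and l: "l = length lam"
    and le: "\<forall>i<l. l - Suc (\<sigma> i) \<le> part lam i + (l - Suc i)"
  defines "al \<equiv> map (\<lambda>i. part lam i + (l - Suc i) - (l - Suc (\<sigma> i))) [0..<l]"
  shows "dominance_le lam al" and "\<sigma> \<noteq> id \<Longrightarrow> al \<noteq> lam"
proof -
  have len: "length al = l"
    by (simp add: al_def)
  have al: "al ! i + (l - Suc (\<sigma> i)) = lam ! i + (l - Suc i)" if "i < l" for i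
  proof -
    have "al ! i = part lam i + (l - Suc i) - (l - Suc (\<sigma> i))" "part lam i = lam ! i"
      using that by (simp_all add: al_def part_def l)
    then show ?thesis
      using le that by (metis le_add_diff_inverse2)
  qed
  \<comment> \<open>An additive form of the prefix sums, free of truncated subtraction.\<close>
  have bal: "(\<Sum>i<m. al ! i) + (\<Sum>i<m. l - Suc (\<sigma> i)) = (\<Sum>i<m. lam ! i) + (\<Sum>i<m. l - Suc i)" if "m \<le> l" for m
    unfolding sum.distrib[symmetric] using al that by (intro sum.cong) auto
  have delta: "(\<Sum>i<m. l - Suc (\<sigma> i)) \<le> (\<Sum>i<m. l - Suc i)" for m
  proof -
    have inj: "inj_on \<sigma> {..<m}"
      using permutes_inj_on[OF \<sigma>] .
    have "(\<Sum>i<m. l - Suc (\<sigma> i)) = (\<Sum>i\<in>\<sigma> ` {..<m}. l - Suc i)"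
      using inj by (simp add: sum.reindex)
    also have "\<dots> \<le> (\<Sum>i<card (\<sigma> ` {..<m}). l - Suc i)"
      by (rule sum_antimono_le_sum_lessThan) (auto simp: antimono_def)
    finally show ?thesis
      using inj by (simp add: card_image)
  qed
  have "psum lam j \<le> psum al j" for j
    unfolding psum_min len l[symmetric] using bal[OF min.cobounded2, of j] delta[of "min j l"] by linarith
  moreover have "(\<Sum>i<l. l - Suc (\<sigma> i)) = (\<Sum>i<l. l - Suc i)"
    using sum.permute[OF \<sigma>, of "\<lambda>i. l - Suc i"] by (simp add: o_def)
  then have "sum_list lam = sum_list al"
    using bal[of l] by (simp add: sum_list_psum psum_min len flip: l)
  ultimately show "dominance_le lam al"
    by (simp add: dominance_le_psum)
  show "al \<noteq> lam" if \<sigma>_id: "\<sigma> \<noteq> id"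
  proof
    assume "al = lam"
    obtain i where i: "\<sigma> i \<noteq> i" using \<sigma>_id by (auto simp: fun_eq_iff)
    then have "i < l"
      using \<sigma> by (metis lessThan_iff permutes_not_in)
    then have "\<sigma> i < l"
      using permutes_in_image[OF \<sigma>] by simp
    then show False
      using al[OF \<open>i < l\<close>] \<open>al = lam\<close> \<open>i < l\<close> i by simp
  qed
qed

text \<open>The identity permutation contributes q_lam, whose leading term is Q_lam. The corrections
  of q_lam and all other permutations lie strictly above lam.\<close>

lemma inv_kostka_expansion:
  assumes lam: "is_partition lam"
  obtains c where "\<And>nu. inv_kostka lam nu = c nu" "c lam = 1" "\<And>nu. c nu \<noteq> 0 \<Longrightarrow> dominance_le lam nu"
proof -
  let ?l = "length lam"
  let ?I = "up_set lam - {lam}"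
  define be where "be i = part lam i + (?l - Suc i)" for i
  define d where "d i = ?l - Suc i" for i
  let ?P = "{\<sigma>. \<sigma> permutes {..<?l}}"
  define rest where "rest n = (\<Sum>\<sigma>\<in>?P - {id}. of_int (sign \<sigma>) * (\<Prod>i<?l. jt_entry tx n (be i) (d (\<sigma> i))))" for n
  have S: "subst_1mt (schur lam) n = qprod tx lam {..<n} + rest n" for n
  proof -
    have "subst_1mt (schur lam) n = jacobi_trudi tx ?l n be d"
      using subst_1mt_skew_schur(2)[OF lam, of "[]" n]
      by (simp add: is_partition_def partition_subset_def be_def[abs_def] d_def[abs_def])
    also have "\<dots> = (\<Prod>i<?l. jt_entry tx n (be i) (d i)) + rest n"
      unfolding jacobi_trudi_def rest_def
      by (subst sum.remove[of ?P id]) (simp_all add: finite_permutations permutes_id sign_id)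
    also have "(\<Prod>i<?l. jt_entry tx n (be i) (d i)) = qprod tx lam {..<n}"
    proof -
      have "map (\<lambda>i. be i - d i) [0..<?l] = lam"
        by (rule nth_equalityI) (auto simp: be_def d_def part_def)
      then show ?thesis
        by (simp add: prod_jt_entry) (simp add: be_def d_def)
    qed
    finally show ?thesis .
  qed
  have "rest \<in> lspan UNIV Zt hall_littlewood_Q ?I"
    unfolding rest_def
  proof (rule jacobi_trudi_in_Q_span)
    fix \<sigma> assume \<sigma>: "\<sigma> \<in> ?P - {id}" and le: "\<forall>i<?l. d (\<sigma> i) \<le> be i"
    let ?al = "map (\<lambda>i. be i - d (\<sigma> i)) [0..<?l]"
    have dom: "dominance_le lam ?al" and ne: "?al \<noteq> lam"
      using jacobi_trudi_index_dominates[of \<sigma> ?l lam] \<sigma> le by (auto simp: be_def d_def)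
    \<comment> \<open>The index need not be sorted, but it has the length of lam, so coinciding
      prefix sums would already make it equal to lam.\<close>
    have "lam \<notin> up_set ?al"
    proof
      assume "lam \<in> up_set ?al"
      then have "psum ?al j = psum lam j" for j
        using dom by (auto simp: up_set_def dominance_le_psum intro: order.antisym)
      then show False
        using psum_eq_imp_eq[of ?al lam] ne by simp
    qed
    then show "up_set ?al \<subseteq> ?I"
      using up_set_mono[OF dom] by auto
  qed
  then have "(\<lambda>n. (qprod tx lam {..<n} - hall_littlewood_Q lam n) + rest n) \<in> lspan UNIV Zt hall_littlewood_Q ?I"
    by (intro lspan_add coeff_ring_Zt qprod_minus_hall_littlewood_Q lam)
  then have "(\<lambda>n. subst_1mt (schur lam) n - hall_littlewood_Q lam n) \<in> lspan UNIV Zt hall_littlewood_Q ?I"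
    by (rule lspan_cong) (simp add: S)
  then obtain e where e: "has_expansion hall_littlewood_Q (\<lambda>n. subst_1mt (schur lam) n - hall_littlewood_Q lam n) e"
    and e_I: "\<And>i. e i \<noteq> 0 \<Longrightarrow> i \<in> ?I"
    by (rule lspan_has_expansion) (auto simp: up_set_def)
  \<comment> \<open>e vanishes at lam, so raising its value there to 1 adds back exactly
    Q_lam.\<close>
  define c where "c = e(lam := 1)"
  have e_lam: "e lam = 0" using e_I by blast
  then have supp: "{\<nu>. c \<nu> \<noteq> 0} = insert lam {\<nu>. e \<nu> \<noteq> 0}"
    by (auto simp: c_def)
  have "has_expansion hall_littlewood_Q (subst_1mt (schur lam)) c"
    unfolding has_expansion_def
  proof (intro conjI allI)
    show "finite {\<nu>. c \<nu> \<noteq> 0}" "{\<nu>. c \<nu> \<noteq> 0} \<subseteq> Collect is_partition"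
      using e lam by (auto simp: supp has_expansion_def)
    fix n
    have "(\<Sum>\<nu> | e \<nu> \<noteq> 0. scalar (c \<nu>) * hall_littlewood_Q \<nu> n) = (\<Sum>\<nu> | e \<nu> \<noteq> 0. scalar (e \<nu>) * hall_littlewood_Q \<nu> n)"
      using e_lam by (intro sum.cong) (auto simp: c_def)
    moreover have "subst_1mt (schur lam) n - hall_littlewood_Q lam n = (\<Sum>\<nu> | e \<nu> \<noteq> 0. scalar (e \<nu>) * hall_littlewood_Q \<nu> n)"
      using e by (simp add: has_expansion_def)
    moreover have "finite {\<nu>. e \<nu> \<noteq> 0}"
      using e by (simp add: has_expansion_def)
    ultimately show "subst_1mt (schur lam) n = (\<Sum>\<nu> | c \<nu> \<noteq> 0. scalar (c \<nu>) * hall_littlewood_Q \<nu> n)"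
      unfolding supp using e_lam by (simp add: c_def diff_eq_eq add.commute)
  qed
  then have "expansion_coeff hall_littlewood_Q (subst_1mt (schur lam)) = c"
    by (rule expansion_coeff_eqI[OF indep_hall_littlewood_Q])
  then have 1: "inv_kostka lam nu = c nu" for nu
    by (simp add: inv_kostka_def inv_kostka_skew_def)
  have "dominance_le lam nu" if "c nu \<noteq> 0" for nu
    using that e_I[of nu] dominance_le_refl[of lam] by (auto simp: c_def up_set_def split: if_splits)
  then show ?thesis
    using that[of c] 1 by (simp add: c_def)
qed

theorem corollary7p16:
  shows "(\<forall>lam \<mu> \<nu>. is_partition lam \<and> is_partition \<mu> \<and> is_partition \<nu> \<and> partition_subset \<mu> lam
            \<longrightarrow> inv_kostka_skew lam \<mu> \<nu> \<in> Zt)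
       \<and> (\<forall>lam \<nu>. is_partition lam \<and> is_partition \<nu> \<and> \<not> dominance_le lam \<nu>
            \<longrightarrow> inv_kostka lam \<nu> = 0)
       \<and> (\<forall>lam. is_partition lam \<longrightarrow> inv_kostka lam lam = 1)
       \<and> (\<forall>k. unitriangular_on (partitions_of k) dominance_le inv_kostka
            \<and> triangular_on (partitions_of k) (\<lambda>lam \<nu>. dominance_le \<nu> lam) kostka_foulkes)"
proof -
  have zero: "inv_kostka lam \<nu> = 0" if "is_partition lam" "\<not> dominance_le lam \<nu>" for lam \<nu>
    using inv_kostka_expansion[OF that(1)] that(2) by metis
  have one: "inv_kostka lam lam = 1" if "is_partition lam" for lam
    using inv_kostka_expansion[OF that] by metis
  have "kostka_foulkes lam \<nu> = 0"
    if "lam \<in> partitions_of k" "\<nu> \<in> partitions_of k" "\<not> dominance_le \<nu> lam" for k lam \<nu>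
    using kostka_foulkes_support[of lam \<nu>] that by (auto simp: partitions_of_def dominance_le_psum psum_le_def)
  then show ?thesis
    using inv_kostka_skew_in_Zt zero one
    by (auto simp: unitriangular_on_def triangular_on_def partitions_of_def)
qed

end
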